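(* Let Assumption P (stated in the context) hold for $y_t=b_rz_t^r+b_uz_t^u+u_t$, with $n=\mathrm{rank}(b_r)$ and $b=[b_r,b_u]$. (I) Let $c_y\le n$ denote the rank of $b_rH_{r,\parallel}$. Then the cointegrating rank of $(z_t^r)_{t\in\mathbb Z}$ is $m_r-c_r$ and the cointegrating rank of $(y_t-b_uz_t^u)_{t\in\mathbb Z}$ is $s-c_y$. (II) There exist nonsingular matrices $\mathcal T_y\in\mathbb R^{s\times s}$, $\mathcal T_{z,r}\in\mathbb R^{m_r\times m_r}$ and $\mathcal T_{z,u}\in\mathbb R^{m_u\times m_u}$ such that, writing $$\tilde z_t=\mathcal T_{z,r}z_t^r=\begin{bmatrix}\tilde z_{t,1}\\ \tilde z_{t,2}\\ \tilde z_{t,3}\end{bmatrix},\qquad \tilde z_t^u=\mathcal T_{z,u}z_t^u=\begin{bmatrix}\tilde z_{t,1}^u\\ \tilde z_{t,2}^u\end{bmatrix}$$ (with block dimensions $c_y$, $c_r-c_y$, $m_r-c_r$ and $c_u$, $m_u-c_u$ respectively) and $\tilde\varepsilon_t=\mathcal T_y\Lambda\varepsilon_t$, one has $$\tilde y_t=\begin{bmatrix}\tilde y_{t,1}\\ \tilde y_{t,2}\end{bmatrix}=\mathcal T_y(y_t-b_uz_t^u)=\tilde b_r\tilde z_t+\tilde\varepsilon_t=\begin{bmatrix}I_{c_y}&0&0\\0&0&\tilde b_{2,3}\end{bmatrix}\begin{bmatrix}\tilde z_{t,1}\\ \tilde z_{t,2}\\ \tilde z_{t,3}\end{bmatrix}+\begin{bmatrix}\tilde\varepsilon_{t,1}\\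 \tilde\varepsilon_{t,2}\end{bmatrix},$$ where $\Delta(L)\tilde z_{t,1}=\tilde c_{z,1}(L)\varepsilon_t$, $\Delta(L)\tilde z_{t,2}=\tilde c_{z,2}(L)\varepsilon_t$, $\Delta(L)\tilde z_{t,1}^u=\tilde c_{z,u}(L)\varepsilon_t$ for $t\in\mathbb Z$, the matrix $[\tilde c_{z,1}(1)',\tilde c_{z,2}(1)',\tilde c_{z,u}(1)']$ is of full column rank, and $(\tilde z_{t,3})_{t\in\mathbb Z}$ and $(\tilde z_{t,2}^u)_{t\in\mathbb Z}$ are stationary processes with nonsingular spectrum at $z=1$ (i.e. at frequency zero).
   Context: Model: $y_t\in\mathbb R^s$, $z_t^r\in\mathbb R^{m_r}$, $z_t^u\in\mathbb R^{m_u}$, $y_t=b_rz_t^r+b_uz_t^u+u_t$, where $b_r$ has rank $n<\min(s,m_r)$. Assumption P. $u_t=\Lambda\varepsilon_t$ with $\Lambda\in\mathbb R^{s\times k}$ of full row rank. For some orthogonal matrices $H_r=[H_{r,\parallel},H_{r,\perp}]$, $H_u=[H_{u,\parallel},H_{u,\perp}]$ with $H_{r,\parallel}\in\mathbb R^{m_r\times c_r}$, $H_{u,\parallel}\in\mathbb R^{m_u\times c_u}$, $$\mathrm{diag}(\Delta(L)I_{c_r},I_{m_r-c_r})H_r'z_t^r=v_t,\qquad \mathrm{diag}(\Delta(L)I_{c_u},I_{m_u-c_u})H_u'z_t^u=w_t,\qquad t\in\mathbb Z,$$ where $L$ is the backward shift operator, $\Delta(L)=1-L$, and $\nu_t=[v_t',w_t']'$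 is the stationary process $\nu_t=\sum_{j=1}^\infty C_j\varepsilon_{t-j}$ with $\sum_{j=1}^\infty j^a\|C_j\|<\infty$ for some $a>3/2$; for $c(z)=\sum_{j=1}^\infty C_jz^j$ the matrix $c(1)$ is of full row rank. Moreover the covariance matrix of $[(H_{r,\perp}'z_t^r)',(H_{u,\perp}'z_t^u)']'$ is positive definite. $(\varepsilon_t)_{t\in\mathbb Z}$ is an iid process in $\mathbb R^k$ with zero mean, nonsingular variance $\Sigma$ and finite fourth moments. Finally $H_{r,\parallel}'z_0^r=0$ and $H_{u,\parallel}'z_0^u=0$. The cointegrating rank of an I(1) process $(x_t)$ is the dimension of its cointegrating space, i.e. of the space of vectors $\beta$ such that $(\beta'x_t)$ is stationary. The $\tilde c_{z,1},\tilde c_{z,2},\tilde c_{z,u}$ are transfer functions (power series with matrix coefficients) evaluated at the backward shift $L$. *)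

theory Defs
  imports
    "HOL-Probability.Probability"
    "Jordan_Normal_Form.DL_Rank"
begin

(* Dimensions occurring here may be 0 and are computed from ranks, so vectors and matrices are
   those of Jordan_Normal_Form, with explicit carriers. The clashing notation of the
   type-indexed vectors is switched off. *)
no_notation vec_nth (infixl \<open>$\<close> 90)
no_notation inner (infix \<open>\<bullet>\<close> 70)
hide_const (open) Finite_Cartesian_Product.vec

definition append_cols :: "'a::zero mat \<Rightarrow> 'a mat \<Rightarrow> 'a mat" (infixr \<open>@\<^sub>c\<close> 66) where
  "A @\<^sub>c B = four_block_mat A B (0\<^sub>m 0 (dim_col A)) (0\<^sub>m 0 (dim_col B))"

definition subvec :: "nat \<Rightarrow> nat \<Rightarrow> 'a vec \<Rightarrow> 'a vec" where
  "subvec i l v = vec l (\<lambda>j. v $ (i + j))"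

definition mat_rank :: "real mat \<Rightarrow> nat" where
  "mat_rank A = vec_space.rank (dim_row A) A"

definition full_row_rank :: "real mat \<Rightarrow> bool" where
  "full_row_rank A \<longleftrightarrow> mat_rank A = dim_row A"

definition full_col_rank :: "real mat \<Rightarrow> bool" where
  "full_col_rank A \<longleftrightarrow> mat_rank A = dim_col A"

definition orthogonal_matrix_of :: "nat \<Rightarrow> real mat \<Rightarrow> bool" where
  "orthogonal_matrix_of m H \<longleftrightarrow> H \<in> carrier_mat m m \<and> H\<^sup>T * H = 1\<^sub>m m \<and> H * H\<^sup>T = 1\<^sub>m m"

definition pos_def_mat :: "nat \<Rightarrow> real mat \<Rightarrow> bool" where
  "pos_def_mat n A \<longleftrightarrow> A \<in> carrier_mat n n \<and> A\<^sup>T = A \<and>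
     (\<forall>x\<in>carrier_vec n. x \<noteq> 0\<^sub>v n \<longrightarrow> x \<bullet> (A *\<^sub>v x) > 0)"

definition mat_norm :: "real mat \<Rightarrow> real" where
  "mat_norm A = sqrt (\<Sum>i<dim_row A. \<Sum>j<dim_col A. (A $$ (i, j))\<^sup>2)"

definition random_vector :: "'w measure \<Rightarrow> nat \<Rightarrow> ('w \<Rightarrow> real vec) \<Rightarrow> bool" where
  "random_vector M n X \<longleftrightarrow> (\<forall>\<omega>\<in>space M. X \<omega> \<in> carrier_vec n) \<and>
     (\<forall>i<n. (\<lambda>\<omega>. X \<omega> $ i) \<in> borel_measurable M)"

definition random_process :: "'w measure \<Rightarrow> nat \<Rightarrow> (int \<Rightarrow> 'w \<Rightarrow> real vec) \<Rightarrow> bool" where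
  "random_process M n x \<longleftrightarrow> (\<forall>t. random_vector M n (x t))"

definition cov_mat ::
    "'w measure \<Rightarrow> nat \<Rightarrow> ('w \<Rightarrow> real vec) \<Rightarrow> ('w \<Rightarrow> real vec) \<Rightarrow> real mat" where
  "cov_mat M n X Y = mat n n (\<lambda>(i, j).
     \<integral>\<omega>. (X \<omega> $ i - (\<integral>\<omega>'. X \<omega>' $ i \<partial>M)) * (Y \<omega> $ j - (\<integral>\<omega>'. Y \<omega>' $ j \<partial>M)) \<partial>M)"

(* A random vector is turned into a random element of the product space PiM {..<k} borel,
   the Borel sigma-algebra of k-dimensional space. *)
definition iid_process :: "'w measure \<Rightarrow> nat \<Rightarrow> (int \<Rightarrow> 'w \<Rightarrow> real vec) \<Rightarrow> bool" where
  "iid_process M k x \<longleftrightarrow>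
     (let B = PiM {..<k} (\<lambda>_. borel :: real measure);
          X = (\<lambda>t \<omega>. \<lambda>i\<in>{..<k}. x t \<omega> $ i)
      in random_process M k x \<and>
         prob_space.indep_vars M (\<lambda>_. B) X UNIV \<and>
         (\<forall>t t'. distr M B (X t) = distr M B (X t')))"

(* Stationarity is meant in the wide sense (second-order stationarity). *)
definition stationary :: "'w measure \<Rightarrow> nat \<Rightarrow> (int \<Rightarrow> 'w \<Rightarrow> real vec) \<Rightarrow> bool" where
  "stationary M n x \<longleftrightarrow> random_process M n x \<and>
     (\<forall>t. \<forall>i<n. integrable M (\<lambda>\<omega>. (x t \<omega> $ i)\<^sup>2)) \<and>
     (\<forall>t. \<forall>i<n. (\<integral>\<omega>. x t \<omega> $ i \<partial>M) = (\<integral>\<omega>. x 0 \<omega> $ i \<partial>M)) \<and>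
     (\<forall>t h. cov_mat M n (x (t + h)) (x t) = cov_mat M n (x h) (x 0))"

(* Spectral density of a stationary process as a function of z on the unit circle; z = 1 is
   frequency zero. The value is meaningful only if the series converges absolutely, which
   nonsingular_spectrum_at demands. *)
definition spectrum :: "'w measure \<Rightarrow> nat \<Rightarrow> (int \<Rightarrow> 'w \<Rightarrow> real vec) \<Rightarrow> complex \<Rightarrow> complex mat" where
  "spectrum M n x z = mat n n (\<lambda>(i, j).
     1 / (2 * complex_of_real pi) *
       (\<Sum>\<^sub>\<infinity>h::int. complex_of_real (cov_mat M n (x h) (x 0) $$ (i, j)) * z powi h))"

definition nonsingular_spectrum_at ::
    "'w measure \<Rightarrow> nat \<Rightarrow> (int \<Rightarrow> 'w \<Rightarrow> real vec) \<Rightarrow> complex \<Rightarrow> bool" where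
  "nonsingular_spectrum_at M n x z \<longleftrightarrow>
     (\<forall>i<n. \<forall>j<n. (\<lambda>h::int. complex_of_real (cov_mat M n (x h) (x 0) $$ (i, j)) * z powi h)
        summable_on UNIV) \<and>
     invertible_mat (spectrum M n x z)"

definition diff_proc :: "(int \<Rightarrow> 'w \<Rightarrow> real vec) \<Rightarrow> int \<Rightarrow> 'w \<Rightarrow> real vec" where
  "diff_proc x t \<omega> = x t \<omega> - x (t - 1) \<omega>"

(* diag (Delta(L) I_c, I_(m-c)) applied to an m-dimensional process *)
definition partial_diff ::
    "nat \<Rightarrow> nat \<Rightarrow> (int \<Rightarrow> 'w \<Rightarrow> real vec) \<Rightarrow> int \<Rightarrow> 'w \<Rightarrow> real vec" where
  "partial_diff c m x t \<omega> = subvec 0 c (diff_proc x t \<omega>) @\<^sub>v subvec c (m - c) (x t \<omega>)"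

(* x_t = C(L) eps_t almost surely, where C(L) = sum_j C_j L^j has r rows *)
definition is_filtered ::
    "'w measure \<Rightarrow> nat \<Rightarrow> (nat \<Rightarrow> real mat) \<Rightarrow> (int \<Rightarrow> 'w \<Rightarrow> real vec) \<Rightarrow>
     (int \<Rightarrow> 'w \<Rightarrow> real vec) \<Rightarrow> bool" where
  "is_filtered M r C eps x \<longleftrightarrow>
     (\<forall>t. AE \<omega> in M. x t \<omega> \<in> carrier_vec r \<and>
        (\<forall>i<r. (\<lambda>j. (C j *\<^sub>v eps (t - int j) \<omega>) $ i) sums (x t \<omega> $ i)))"

definition transfer_fun :: "nat \<Rightarrow> nat \<Rightarrow> (nat \<Rightarrow> real mat) \<Rightarrow> real \<Rightarrow> real mat" where
  "transfer_fun r k C z = mat r k (\<lambda>(i, l). \<Sum>j. C j $$ (i, l) * z ^ j)"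

definition cointegrating_space ::
    "'w measure \<Rightarrow> nat \<Rightarrow> (int \<Rightarrow> 'w \<Rightarrow> real vec) \<Rightarrow> real vec set" where
  "cointegrating_space M n x =
     {\<beta> \<in> carrier_vec n. stationary M 1 (\<lambda>t \<omega>. vec 1 (\<lambda>_. \<beta> \<bullet> x t \<omega>))}"

definition cointegrating_rank :: "'w measure \<Rightarrow> nat \<Rightarrow> (int \<Rightarrow> 'w \<Rightarrow> real vec) \<Rightarrow> nat" where
  "cointegrating_rank M n x = vectorspace.dim class_ring
     ((module_vec TYPE(real) n)\<lparr>carrier := cointegrating_space M n x\<rparr>)"

end

theory Submission
  imports Defs
begin

text \<open>
  A linear process in white noise with absolutely summable coefficients d is square integrable,
  its autocovariances depend on the lag only, and they sum over all lags to the quadratic form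
  of the noise covariance in the sum d(1) of the coefficients. Hence such a process is stationary and has
  a nonsingular spectrum at frequency zero as soon as the rows of its transfer function at 1 are independent.
  Conversely, if the differences of X are linear with coefficients d, then the coefficients
  of X(T) - X(0) at the lags j below T are the partial sums D(j) of d; a variance of X
  that does not depend on time bounds the sum of the quadratic form at all D(j), so d(1) = 0.

  Consequently a linear combination of the coordinates of H'z, the first c of which are integrated, is
  stationary iff the weights of those c coordinates vanish. The cointegrating spaces are therefore
  the left kernels of H_par and of b_r H_par. The transformations of part (II) come from
  a rank factorization of b_r H_par, the remaining block being absorbed into the
  coordinates of H'z by an upper triangular change of basis.
\<close>

section \<open>Rank factorization and kernels of matrices\<close>

text \<open>The obstacle is that the integrated coordinates are given only through their
  differences: their levels have no convergent expansion in the noise, so no autocovariance of a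
  level can be read off from coefficients. The variance of increments over longer and longer
  horizons replaces that computation. Full row rank of \<open>c(1)\<close> is used in two ways. It
  prevents the trends of different integrated coordinates from cancelling, so a combination is
  stationary only if it puts no weight on them; and it makes the covariance summed over all lags
  nonsingular for the stationary coordinates. The triangular change of basis is harmless for the
  same reason in both parts: a stationary coordinate added to an integrated one enters the
  difference with the factor \<open>1 - z\<close>, which is zero at \<open>z = 1\<close>. Hence the
  values at 1 of the differenced transfer functions are mixed by an invertible matrix only. Block
  sizes are ranks and may be 0, so matrices are compared entry by entry, and each invertible matrix
  carries its inverse along as an explicit partner.\<close>

definition inverse_pair :: "nat \<Rightarrow> real mat \<Rightarrow> real mat \<Rightarrow> bool" where
  "inverse_pair n P P' \<longleftrightarrow> P \<in> carrier_mat n n \<and> P' \<in> carrier_mat n n \<and>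
     P * P' = 1\<^sub>m n \<and> P' * P = 1\<^sub>m n"

lemma inverse_pair_sym: "inverse_pair n P P' \<Longrightarrow> inverse_pair n P' P"
  by (auto simp: inverse_pair_def)

lemma inverse_pairI:
  "P \<in> carrier_mat n n \<Longrightarrow> P' \<in> carrier_mat n n \<Longrightarrow> P * P' = 1\<^sub>m n \<Longrightarrow> inverse_pair n P P'"
  using mat_mult_left_right_inverse[of P n P'] by (auto simp: inverse_pair_def)

lemma inverse_pair_one: "inverse_pair n (1\<^sub>m n) (1\<^sub>m n)"
  by (auto simp: inverse_pair_def)

lemma inverse_pair_invertible: "inverse_pair n P P' \<Longrightarrow> invertible_mat P"
  unfolding inverse_pair_def invertible_mat_def inverts_mat_def by (auto intro!: exI[of _ P'])

lemma invertible_inverse_pair: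
  assumes "invertible_mat P" "P \<in> carrier_mat n n"
  shows "\<exists>P'. inverse_pair n P P'"
proof -
  obtain B where B: "P * B = 1\<^sub>m n" "B * P = 1\<^sub>m (dim_row B)"
    using assms unfolding invertible_mat_def inverts_mat_def by auto
  have "B \<in> carrier_mat n n"
    by (metis B assms(2) carrier_matD(2) carrier_matI index_mult_mat(3) index_one_mat(3))
  then show ?thesis using B assms by (auto simp: inverse_pair_def)
qed

lemma inverse_pair_mult:
  assumes "inverse_pair n P P'" "inverse_pair n Q Q'"
  shows "inverse_pair n (P * Q) (Q' * P')"
proof (rule inverse_pairI)
  have c: "P \<in> carrier_mat n n" "P' \<in> carrier_mat n n" "Q \<in> carrier_mat n n" "Q' \<in> carrier_mat n n"
    using assms by (auto simp: inverse_pair_def)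
  then show "P * Q \<in> carrier_mat n n" "Q' * P' \<in> carrier_mat n n" by auto
  have "P * Q * (Q' * P') = P * (Q * Q') * P'"
    using c by (simp add: assoc_mult_mat[of _ n n _ n _ n])
  then show "P * Q * (Q' * P') = 1\<^sub>m n"
    using assms c by (simp add: inverse_pair_def)
qed

lemma inverse_pair_transpose:
  assumes "inverse_pair n P P'"
  shows "inverse_pair n (P\<^sup>T) (P'\<^sup>T)"
proof -
  have c: "P \<in> carrier_mat n n" "P' \<in> carrier_mat n n" "P' * P = 1\<^sub>m n" "P * P' = 1\<^sub>m n"
    using assms by (auto simp: inverse_pair_def)
  show ?thesis
    by (rule inverse_pairI) (use c in \<open>auto simp: transpose_mult[symmetric]\<close>)
qed

lemma inverse_pair_cancel_vec:
  assumes "inverse_pair n P P'" "x \<in> carrier_vec n"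
  shows "P *\<^sub>v (P' *\<^sub>v x) = x" "P' *\<^sub>v (P *\<^sub>v x) = x"
  using assms assoc_mult_mat_vec[of P n n P' n x] assoc_mult_mat_vec[of P' n n P n x]
  by (auto simp: inverse_pair_def)

section \<open>Equivalence of matrices and reduction to the rank normal form\<close>

definition equivalent_mat :: "nat \<Rightarrow> nat \<Rightarrow> real mat \<Rightarrow> real mat \<Rightarrow> bool" where
  "equivalent_mat nr nc A B \<longleftrightarrow> A \<in> carrier_mat nr nc \<and> B \<in> carrier_mat nr nc \<and>
     (\<exists>P P' Q Q'. inverse_pair nr P P' \<and> inverse_pair nc Q Q' \<and> A = P * B * Q)"

lemma equivalent_mat_refl: "A \<in> carrier_mat nr nc \<Longrightarrow> equivalent_mat nr nc A A"
  unfolding equivalent_mat_def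
  by (auto intro!: exI[of _ "1\<^sub>m _"] inverse_pair_one)

lemma equivalent_mat_trans:
  assumes "equivalent_mat nr nc A B" "equivalent_mat nr nc B C"
  shows "equivalent_mat nr nc A C"
proof -
  obtain P P' Q Q' where 1: "inverse_pair nr P P'" "inverse_pair nc Q Q'" "A = P * B * Q"
    using assms by (auto simp: equivalent_mat_def)
  obtain R R' S S' where 2: "inverse_pair nr R R'" "inverse_pair nc S S'" "B = R * C * S"
    using assms by (auto simp: equivalent_mat_def)
  have c: "P \<in> carrier_mat nr nr" "R \<in> carrier_mat nr nr" "Q \<in> carrier_mat nc nc" "S \<in> carrier_mat nc nc"
      "C \<in> carrier_mat nr nc" "A \<in> carrier_mat nr nc"
    using 1 2 assms by (auto simp: inverse_pair_def equivalent_mat_def)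
  have "P * (R * C * S) * Q = (P * R) * C * (S * Q)"
    using c by (simp add: assoc_mult_mat[of _ nr nr _ nc _ nc] assoc_mult_mat[of _ nr nr _ nr _ nc]
      assoc_mult_mat[of _ nr nc _ nc _ nc])
  then show ?thesis
    using inverse_pair_mult[OF 1(1) 2(1)] inverse_pair_mult[OF 2(2) 1(2)] 1 2 c
    unfolding equivalent_mat_def by metis
qed

text \<open>The normal form \<open>diag(I_r, 0)\<close>. Written entrywise instead of in blocks, it
  needs no case distinction for empty blocks, its transpose has the same shape, and one further
  pivot only raises the three parameters by one.\<close>

definition rank_form :: "nat \<Rightarrow> nat \<Rightarrow> nat \<Rightarrow> real mat" where
  "rank_form nr nc r = mat nr nc (\<lambda>(i, j). if i = j \<and> i < r then 1 else 0)"

lemma rank_form_carrier [simp]: "rank_form nr nc r \<in> carrier_mat nr nc"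
  by (simp add: rank_form_def)

lemma inverse_pair_four_block_diag:
  assumes "inverse_pair n P P'"
  shows "inverse_pair (Suc n) (four_block_mat (1\<^sub>m 1) (0\<^sub>m 1 n) (0\<^sub>m n 1) P)
    (four_block_mat (1\<^sub>m 1) (0\<^sub>m 1 n) (0\<^sub>m n 1) P')"
proof (rule inverse_pairI)
  have c: "P \<in> carrier_mat n n" "P' \<in> carrier_mat n n" "P * P' = 1\<^sub>m n"
    using assms by (auto simp: inverse_pair_def)
  show "four_block_mat (1\<^sub>m 1) (0\<^sub>m 1 n) (0\<^sub>m n 1) P \<in> carrier_mat (Suc n) (Suc n)"
    "four_block_mat (1\<^sub>m 1) (0\<^sub>m 1 n) (0\<^sub>m n 1) P' \<in> carrier_mat (Suc n) (Suc n)"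
    using c by auto
  have "four_block_mat (1\<^sub>m 1) (0\<^sub>m 1 n) (0\<^sub>m n 1) P * four_block_mat (1\<^sub>m 1) (0\<^sub>m 1 n) (0\<^sub>m n 1) P'
    = four_block_mat (1\<^sub>m 1) (0\<^sub>m 1 n) (0\<^sub>m n 1) (1\<^sub>m n)"
    using c by (subst mult_four_block_mat[of _ 1 1 _ n _ n _ _ 1 _ n]) auto
  then show "four_block_mat (1\<^sub>m 1) (0\<^sub>m 1 n) (0\<^sub>m n 1) P *
      four_block_mat (1\<^sub>m 1) (0\<^sub>m 1 n) (0\<^sub>m n 1) P' = 1\<^sub>m (Suc n)"
    by (simp only: four_block_one_mat) simp
qed

text \<open>Carries the induction hypothesis for the Schur complement past a pivot that has already
  been split off.\<close>

lemma equivalent_mat_four_block_diag: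
  assumes "equivalent_mat nr nc A B"
  shows "equivalent_mat (Suc nr) (Suc nc) (four_block_mat (1\<^sub>m 1) (0\<^sub>m 1 nc) (0\<^sub>m nr 1) A)
    (four_block_mat (1\<^sub>m 1) (0\<^sub>m 1 nc) (0\<^sub>m nr 1) B)"
proof -
  obtain P P' Q Q' where 1: "inverse_pair nr P P'" "inverse_pair nc Q Q'" "A = P * B * Q"
    using assms by (auto simp: equivalent_mat_def)
  have c: "P \<in> carrier_mat nr nr" "Q \<in> carrier_mat nc nc" "B \<in> carrier_mat nr nc" "A \<in> carrier_mat nr nc"
    using 1 assms by (auto simp: inverse_pair_def equivalent_mat_def)
  let ?P = "four_block_mat (1\<^sub>m 1) (0\<^sub>m 1 nr) (0\<^sub>m nr 1) P"
  let ?Q = "four_block_mat (1\<^sub>m 1) (0\<^sub>m 1 nc) (0\<^sub>m nc 1) Q"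
  let ?B = "four_block_mat (1\<^sub>m 1) (0\<^sub>m 1 nc) (0\<^sub>m nr 1) B"
  have "?P * ?B = four_block_mat (1\<^sub>m 1) (0\<^sub>m 1 nc) (0\<^sub>m nr 1) (P * B)"
    using c by (subst mult_four_block_mat[of _ 1 1 _ nr _ nr _ _ 1 _ nc]) auto
  moreover have "four_block_mat (1\<^sub>m 1) (0\<^sub>m 1 nc) (0\<^sub>m nr 1) (P * B) * ?Q
    = four_block_mat (1\<^sub>m 1) (0\<^sub>m 1 nc) (0\<^sub>m nr 1) A"
    using c 1 by (subst mult_four_block_mat[of _ 1 1 _ nc _ nr _ _ 1 _ nc]) auto
  ultimately have "four_block_mat (1\<^sub>m 1) (0\<^sub>m 1 nc) (0\<^sub>m nr 1) A = ?P * ?B * ?Q" by simp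
  moreover have "inverse_pair (Suc nr) ?P (four_block_mat (1\<^sub>m 1) (0\<^sub>m 1 nr) (0\<^sub>m nr 1) P')"
    "inverse_pair (Suc nc) ?Q (four_block_mat (1\<^sub>m 1) (0\<^sub>m 1 nc) (0\<^sub>m nc 1) Q')"
    using inverse_pair_four_block_diag 1 by auto
  moreover have "?B \<in> carrier_mat (Suc nr) (Suc nc)"
    "four_block_mat (1\<^sub>m 1) (0\<^sub>m 1 nc) (0\<^sub>m nr 1) A \<in> carrier_mat (Suc nr) (Suc nc)"
    using c by auto
  ultimately show ?thesis unfolding equivalent_mat_def by blast
qed

lemma rank_form_Suc:
  "four_block_mat (1\<^sub>m 1) (0\<^sub>m 1 nc) (0\<^sub>m nr 1) (rank_form nr nc r) = rank_form (Suc nr) (Suc nc) (Suc r)"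
  by (rule eq_matI) (auto simp: rank_form_def)

text \<open>One step of Gaussian elimination, written as a factorization. \<open>D\<close> is the
  Schur complement of the pivot \<open>a\<close>, the unit triangular \<open>?L\<close> clears the
  first column, and \<open>?R\<close> clears the first row. The pivot itself sits in
  \<open>?R\<close>, which is why \<open>1/a\<close> occurs in its inverse.\<close>

lemma pivot_equivalent:
  assumes A: "A \<in> carrier_mat (Suc nr) (Suc nc)" and nz: "A $$ (0, 0) \<noteq> 0"
  shows "\<exists>D\<in>carrier_mat nr nc. equivalent_mat (Suc nr) (Suc nc) A
           (four_block_mat (1\<^sub>m 1) (0\<^sub>m 1 nc) (0\<^sub>m nr 1) D)"
proof -
  define a where "a = A $$ (0, 0)"
  define b where "b = mat 1 nc (\<lambda>(i, j). A $$ (0, Suc j))"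
  define c where "c = mat nr 1 (\<lambda>(i, j). A $$ (Suc i, 0) / a)"
  define D where "D = mat nr nc (\<lambda>(i, j). A $$ (Suc i, Suc j) - A $$ (Suc i, 0) / a * A $$ (0, Suc j))"
  let ?L = "four_block_mat (1\<^sub>m 1) (0\<^sub>m 1 nr) c (1\<^sub>m nr)"
  let ?L' = "four_block_mat (1\<^sub>m 1) (0\<^sub>m 1 nr) (- c) (1\<^sub>m nr)"
  let ?R = "four_block_mat (a \<cdot>\<^sub>m 1\<^sub>m 1) b (0\<^sub>m nc 1) (1\<^sub>m nc)"
  let ?R' = "four_block_mat ((1/a) \<cdot>\<^sub>m 1\<^sub>m 1) (- (1/a) \<cdot>\<^sub>m b) (0\<^sub>m nc 1) (1\<^sub>m nc)"
  let ?D = "four_block_mat (1\<^sub>m 1) (0\<^sub>m 1 nc) (0\<^sub>m nr 1) D"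
  have cc: "b \<in> carrier_mat 1 nc" "c \<in> carrier_mat nr 1" "D \<in> carrier_mat nr nc"
    by (auto simp: b_def c_def D_def)
  have a0: "a \<noteq> 0" using nz a_def by simp
  have "?L * ?L' = four_block_mat (1\<^sub>m 1) (0\<^sub>m 1 nr) (0\<^sub>m nr 1) (1\<^sub>m nr)"
    using cc by (subst mult_four_block_mat[of _ 1 1 _ nr _ nr _ _ 1 _ nr])
      (auto intro!: eq_matI simp: scalar_prod_def)
  then have L: "inverse_pair (Suc nr) ?L ?L'"
    using cc by (intro inverse_pairI) (auto simp only: four_block_one_mat, auto)
  have "?R * ?R' = four_block_mat (1\<^sub>m 1) (0\<^sub>m 1 nc) (0\<^sub>m nc 1) (1\<^sub>m nc)"
    using cc a0
    apply (subst mult_four_block_mat[of _ 1 1 _ nc _ nc _ _ 1 _ nc])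
    by (auto intro!: cong_four_block_mat eq_matI simp: scalar_prod_def)
  then have R: "inverse_pair (Suc nc) ?R ?R'"
    using cc by (intro inverse_pairI) (auto simp only: four_block_one_mat, auto)
  have 1: "?L * ?D = four_block_mat (1\<^sub>m 1) (0\<^sub>m 1 nc) c D"
    using cc by (subst mult_four_block_mat[of _ 1 1 _ nr _ nr _ _ 1 _ nc]) auto
  have 2: "four_block_mat (1\<^sub>m 1) (0\<^sub>m 1 nc) c D * ?R =
      four_block_mat (a \<cdot>\<^sub>m 1\<^sub>m 1) b (a \<cdot>\<^sub>m c) (c * b + D)"
    using cc by (subst mult_four_block_mat[of _ 1 1 _ nc _ nr _ _ 1 _ nc])
      (auto intro!: cong_four_block_mat eq_matI simp: scalar_prod_def)
  have 3: "four_block_mat (a \<cdot>\<^sub>m 1\<^sub>m 1) b (a \<cdot>\<^sub>m c) (c * b + D) = A"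
  proof (rule eq_matI)
    fix i j assume ij: "i < dim_row A" "j < dim_col A"
    show "four_block_mat (a \<cdot>\<^sub>m 1\<^sub>m 1) b (a \<cdot>\<^sub>m c) (c * b + D) $$ (i, j) = A $$ (i, j)"
      using A cc a0 ij
      by (cases i; cases j) (auto simp: scalar_prod_def b_def c_def D_def a_def)
  qed (use A cc in auto)
  have "A = ?L * ?D * ?R" using 1 2 3 by simp
  then have "equivalent_mat (Suc nr) (Suc nc) A ?D"
    unfolding equivalent_mat_def using L R A cc by auto
  then show ?thesis using cc by blast
qed

lemma equivalent_rank_form:
  "A \<in> carrier_mat nr nc \<Longrightarrow> \<exists>r \<le> min nr nc. equivalent_mat nr nc A (rank_form nr nc r)"
proof (induction nr arbitrary: nc A)
  case 0
  then have "A = rank_form 0 nc 0" by (auto simp: rank_form_def)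
  then show ?case using equivalent_mat_refl[OF rank_form_carrier] by auto
next
  case (Suc nr)
  show ?case
  proof (cases "A = 0\<^sub>m (Suc nr) nc")
    case True
    then have "A = rank_form (Suc nr) nc 0" by (auto simp: rank_form_def)
    then show ?thesis using equivalent_mat_refl[OF rank_form_carrier] by auto
  next
    case False
    then obtain i j where ij: "i < Suc nr" "j < nc" "A $$ (i, j) \<noteq> 0"
      using Suc.prems eq_matI[of A "0\<^sub>m (Suc nr) nc"] by auto
    then obtain nc' where nc: "nc = Suc nc'" by (cases nc) auto
    \<comment> \<open>Exchanging row \<open>i\<close> with row 0 and column \<open>j\<close> with
      column 0 brings the nonzero entry to the corner. The exchange matrices are their own inverses,
      so \<open>A\<close> is recovered by applying them again.\<close>
    define A1 where "A1 = swaprows 0 i (swapcols 0 j A)"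
    have A1: "A1 \<in> carrier_mat (Suc nr) (Suc nc')" using Suc.prems nc by (simp add: A1_def)
    have nz: "A1 $$ (0, 0) \<noteq> 0" using ij Suc.prems nc by (auto simp: A1_def)
    let ?S = "swaprows_mat (Suc nr) 0 i" and ?T = "swaprows_mat nc 0 j"
    have S: "inverse_pair (Suc nr) ?S ?S" "inverse_pair nc ?T ?T"
      using ij by (auto simp: inverse_pair_def swaprows_mat_inv)
    have "A1 = ?S * (A * ?T)"
      using ij Suc.prems unfolding A1_def
      by (subst swaprows_mat[of _ "Suc nr" nc]) (auto simp: swapcols_mat[of A "Suc nr" nc])
    moreover have "?S * (?S * (A * ?T)) = (?S * ?S) * (A * ?T)"
      using Suc.prems by (intro assoc_mult_mat[symmetric, of _ "Suc nr" "Suc nr" _ "Suc nr" _ nc]) auto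
    moreover have "A * ?T * ?T = A * (?T * ?T)"
      using Suc.prems by (intro assoc_mult_mat[of _ "Suc nr" nc _ nc _ nc]) auto
    ultimately have "?S * A1 * ?T = A"
      using Suc.prems ij by (simp add: swaprows_mat_inv left_mult_one_mat[of "A * ?T" "Suc nr" nc])
    then have "A = ?S * A1 * ?T" by simp
    then have "equivalent_mat (Suc nr) nc A A1"
      unfolding equivalent_mat_def using S Suc.prems A1 nc by metis
    moreover obtain D where D: "D \<in> carrier_mat nr nc'"
      "equivalent_mat (Suc nr) nc A1 (four_block_mat (1\<^sub>m 1) (0\<^sub>m 1 nc') (0\<^sub>m nr 1) D)"
      using pivot_equivalent[OF A1 nz] nc by blast
    moreover obtain r where r: "r \<le> min nr nc'" "equivalent_mat nr nc' D (rank_form nr nc' r)"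
      using Suc.IH[OF D(1)] by blast
    ultimately have "equivalent_mat (Suc nr) nc A (rank_form (Suc nr) nc (Suc r))"
      using equivalent_mat_trans equivalent_mat_four_block_diag[OF r(2)] nc rank_form_Suc by metis
    then show ?thesis using r nc by (intro exI[of _ "Suc r"]) auto
  qed
qed

section \<open>Rank, column space and left kernel\<close>

lemma mat_mult_unit_vec:
  fixes A :: "real mat"
  assumes "A \<in> carrier_mat nr nc" "i < nc"
  shows "A *\<^sub>v unit_vec nc i = col A i"
  using assms by (intro eq_vecI) (auto simp: scalar_prod_right_unit)

lemma mat_mult_zero_vec:
  fixes A :: "real mat"
  assumes "A \<in> carrier_mat nr nc"
  shows "A *\<^sub>v 0\<^sub>v nc = 0\<^sub>v nr"
  using assms by (intro eq_vecI) auto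

lemma dim_image_injective:
  assumes K: "K \<in> carrier_mat n r"
    and inj: "\<And>c. c \<in> carrier_vec r \<Longrightarrow> K *\<^sub>v c = 0\<^sub>v n \<Longrightarrow> c = 0\<^sub>v r"
  shows "vectorspace.dim class_ring
    ((module_vec TYPE(real) n)\<lparr>carrier := {K *\<^sub>v c | c. c \<in> carrier_vec r}\<rparr>) = r"
proof -
  interpret vec_space "TYPE(real)" n .
  \<comment> \<open>Linear independence is a property of the set of columns, in which a repeated
    column would be invisible. Two equal columns are excluded by the kernel vector
    \<open>unit_vec r i - unit_vec r j\<close>.\<close>
  have "distinct (cols K)"
  proof (rule ccontr)
    assume "\<not> distinct (cols K)"
    then obtain i j where ij: "i < r" "j < r" "i \<noteq> j" "col K i = col K j"
      using K by (auto simp: distinct_conv_nth)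
    have "K *\<^sub>v (unit_vec r i - unit_vec r j) = col K i - col K j"
      using K ij by (simp add: mult_minus_distrib_mat_vec[of _ n r] mat_mult_unit_vec)
    also have "\<dots> = 0\<^sub>v n" using ij K by auto
    finally have "unit_vec r i - unit_vec r j = (0\<^sub>v r :: real vec)" by (intro inj) auto
    then have "(unit_vec r i - unit_vec r j) $ i = (0\<^sub>v r :: real vec) $ i" by simp
    then show False using ij by simp
  qed
  moreover from this have "lin_indpt (set (cols K))"
    using lin_depE[OF K] inj by metis
  ultimately have "rank K = r" by (rule lin_indpt_full_rank[OF K])
  moreover have "col_space K = {K *\<^sub>v c | c. c \<in> carrier_vec r}"
    using K by (auto simp: col_space_eq[OF K])
  ultimately show ?thesis by (simp add: rank_def col_space_def)
qed

lemma rank_form_mult_vec: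
  assumes "x \<in> carrier_vec nc" "i < nr" "r \<le> nc"
  shows "(rank_form nr nc r *\<^sub>v x) $ i = (if i < r then x $ i else 0)"
proof -
  have "(rank_form nr nc r *\<^sub>v x) $ i = (\<Sum>j<nc. if j = i \<and> i < r then x $ j else 0)"
    using assms by (auto simp: rank_form_def scalar_prod_def lessThan_atLeast0 intro!: sum.cong)
  also have "\<dots> = (if i < r then x $ i else 0)"
    using assms by (cases "i < r") auto
  finally show ?thesis .
qed

text \<open>The factor \<open>Q\<close> is onto, so the column space of \<open>A\<close> is the
  image of the first \<open>r\<close> columns of \<open>P\<close>, and these are independent because
  \<open>P\<close> is invertible. This identifies the number of pivots found by elimination with the
  dimension that defines \<open>mat_rank\<close>.\<close>

lemma mat_rank_equivalent:
  assumes "equivalent_mat nr nc A (rank_form nr nc r)" "r \<le> min nr nc"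
  shows "mat_rank A = r"
proof -
  interpret vec_space "TYPE(real)" nr .
  obtain P P' Q Q' where 1: "inverse_pair nr P P'" "inverse_pair nc Q Q'" "A = P * rank_form nr nc r * Q"
    and A: "A \<in> carrier_mat nr nc"
    using assms by (auto simp: equivalent_mat_def)
  have c: "P \<in> carrier_mat nr nr" "Q \<in> carrier_mat nc nc" "Q' \<in> carrier_mat nc nc"
    using 1 by (auto simp: inverse_pair_def)
  define K where "K = P * rank_form nr r r"
  have K: "K \<in> carrier_mat nr r" using c by (auto simp: K_def)
  have Kv: "K *\<^sub>v x = P *\<^sub>v (rank_form nr r r *\<^sub>v x)" if "x \<in> carrier_vec r" for x
    using c that by (simp add: K_def assoc_mult_mat_vec[of _ nr nr _ r])
  have Av: "A *\<^sub>v x = P *\<^sub>v (rank_form nr nc r *\<^sub>v (Q *\<^sub>v x))" if "x \<in> carrier_vec nc" for x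
    using c that by (simp add: 1(3) assoc_mult_mat_vec[of _ nr nr _ nc] assoc_mult_mat_vec[of _ nr nc _ nc])
  have restrict: "rank_form nr nc r *\<^sub>v x = rank_form nr r r *\<^sub>v vec r (\<lambda>i. x $ i)"
    if "x \<in> carrier_vec nc" for x
    using that assms by (intro eq_vecI) (auto simp: rank_form_mult_vec carrier_matD[OF rank_form_carrier]
        simp del: index_mult_mat_vec)
  have "{A *\<^sub>v c | c. c \<in> carrier_vec nc} = {K *\<^sub>v c | c. c \<in> carrier_vec r}"
  proof (intro Set.set_eqI iffI)
    fix z assume "z \<in> {A *\<^sub>v c | c. c \<in> carrier_vec nc}"
    then obtain x where x: "z = A *\<^sub>v x" "x \<in> carrier_vec nc" by auto
    have "z = K *\<^sub>v vec r (\<lambda>i. (Q *\<^sub>v x) $ i)"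
      using x c by (subst Kv) (auto simp: Av restrict)
    then show "z \<in> {K *\<^sub>v c | c. c \<in> carrier_vec r}" by auto
  next
    fix z assume "z \<in> {K *\<^sub>v c | c. c \<in> carrier_vec r}"
    then obtain x where x: "z = K *\<^sub>v x" "x \<in> carrier_vec r" by auto
    define x' where "x' = vec nc (\<lambda>i. if i < r then x $ i else 0)"
    have "vec r (\<lambda>i. x' $ i) = x" using x assms by (auto simp: x'_def)
    then have "rank_form nr nc r *\<^sub>v x' = rank_form nr r r *\<^sub>v x"
      using restrict[of x'] by (simp add: x'_def)
    then have "z = A *\<^sub>v (Q' *\<^sub>v x')"
      using x c by (subst Av) (auto simp: Kv x'_def inverse_pair_cancel_vec[OF 1(2)])
    moreover have "Q' *\<^sub>v x' \<in> carrier_vec nc" using c by (auto simp: x'_def)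
    ultimately show "z \<in> {A *\<^sub>v c | c. c \<in> carrier_vec nc}" by blast
  qed
  moreover have "vectorspace.dim class_ring
    ((module_vec TYPE(real) nr)\<lparr>carrier := {K *\<^sub>v c | c. c \<in> carrier_vec r}\<rparr>) = r"
  proof (rule dim_image_injective[OF K])
    fix x :: "real vec" assume x: "x \<in> carrier_vec r" "K *\<^sub>v x = 0\<^sub>v nr"
    have "rank_form nr r r *\<^sub>v x = P' *\<^sub>v (K *\<^sub>v x)"
      using x(1) by (simp add: Kv inverse_pair_cancel_vec[OF 1(1)] mult_mat_vec_carrier[OF rank_form_carrier])
    also have "\<dots> = 0\<^sub>v nr" using x 1 by (auto simp: inverse_pair_def)
    finally have "(rank_form nr r r *\<^sub>v x) $ i = 0" if "i < r" for i using that assms by simp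
    then show "x = 0\<^sub>v r" using x assms by (intro eq_vecI) (auto simp: rank_form_mult_vec)
  qed
  moreover have "col_space A = {A *\<^sub>v c | c. c \<in> carrier_vec nc}"
    using A by (auto simp: col_space_eq[OF A])
  ultimately show ?thesis using A by (simp add: mat_rank_def rank_def col_space_def)
qed

lemma rank_factorization:
  assumes "A \<in> carrier_mat nr nc"
  obtains P P' Q Q' where "inverse_pair nr P P'" "inverse_pair nc Q Q'"
    "A = P * rank_form nr nc (mat_rank A) * Q" "mat_rank A \<le> min nr nc"
proof -
  obtain r where r: "r \<le> min nr nc" "equivalent_mat nr nc A (rank_form nr nc r)"
    using equivalent_rank_form[OF assms] by blast
  moreover have "mat_rank A = r" by (rule mat_rank_equivalent[OF r(2,1)])
  moreover from r obtain P P' Q Q' where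
    "inverse_pair nr P P'" "inverse_pair nc Q Q'" "A = P * rank_form nr nc r * Q"
    unfolding equivalent_mat_def by auto
  ultimately show ?thesis using that[of P P' Q Q'] by simp
qed

lemma rank_form_transpose: "(rank_form nr nc r)\<^sup>T = rank_form nc nr r"
  by (rule eq_matI) (auto simp: rank_form_def)

text \<open>In a rank factorization with left factor \<open>P\<close>, the equation for \<beta> says
  that the first \<open>r\<close> coordinates of \<open>P\<^sup>T *\<^sub>v \<beta>\<close> are
  zero, while the other \<open>nr - r\<close> are free. So the last columns of the inverse of
  \<open>P\<^sup>T\<close> form a basis of the left kernel; \<open>E\<close> embeds the free
  coordinates.\<close>

lemma transpose_kernel_image:
  assumes A: "A \<in> carrier_mat nr nc"
  obtains K where "K \<in> carrier_mat nr (nr - mat_rank A)"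
    "{\<beta> \<in> carrier_vec nr. A\<^sup>T *\<^sub>v \<beta> = 0\<^sub>v nc} = {K *\<^sub>v c | c. c \<in> carrier_vec (nr - mat_rank A)}"
    "\<And>c. c \<in> carrier_vec (nr - mat_rank A) \<Longrightarrow> K *\<^sub>v c = 0\<^sub>v nr \<Longrightarrow> c = 0\<^sub>v (nr - mat_rank A)"
proof -
  define r where "r = mat_rank A"
  obtain P P' Q Q' where 1: "inverse_pair nr P P'" "inverse_pair nc Q Q'"
    "A = P * rank_form nr nc r * Q" and r: "r \<le> min nr nc"
    using rank_factorization[OF A] r_def by metis
  have c: "P \<in> carrier_mat nr nr" "P' \<in> carrier_mat nr nr" "Q \<in> carrier_mat nc nc" "Q' \<in> carrier_mat nc nc"
    using 1 by (auto simp: inverse_pair_def)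
  have PT: "inverse_pair nr (P\<^sup>T) (P'\<^sup>T)" and QT: "inverse_pair nc (Q\<^sup>T) (Q'\<^sup>T)"
    using 1 by (auto intro: inverse_pair_transpose)
  have AT: "A\<^sup>T *\<^sub>v x = Q\<^sup>T *\<^sub>v (rank_form nc nr r *\<^sub>v (P\<^sup>T *\<^sub>v x))" if "x \<in> carrier_vec nr" for x
  proof -
    have "rank_form nc nr r * P\<^sup>T \<in> carrier_mat nc nr"
      by (rule mult_carrier_mat[of _ _ nr]) (use c in auto)
    then show ?thesis
      using c that by (simp add: 1(3) transpose_mult[of _ nr nc _ nc] transpose_mult[of _ nr nr _ nc]
        rank_form_transpose assoc_mult_mat_vec[of _ nc nc _ nr] assoc_mult_mat_vec[of _ nc nr _ nr])
  qed
  have ker: "A\<^sup>T *\<^sub>v x = 0\<^sub>v nc \<longleftrightarrow> (\<forall>i<r. (P\<^sup>T *\<^sub>v x) $ i = 0)" if x: "x \<in> carrier_vec nr" for x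
  proof
    assume 0: "A\<^sup>T *\<^sub>v x = 0\<^sub>v nc"
    have "rank_form nc nr r *\<^sub>v (P\<^sup>T *\<^sub>v x) = Q'\<^sup>T *\<^sub>v (A\<^sup>T *\<^sub>v x)"
      using x c inverse_pair_cancel_vec[OF QT, of "rank_form nc nr r *\<^sub>v (P\<^sup>T *\<^sub>v x)"]
      by (simp add: AT mult_mat_vec_carrier[OF rank_form_carrier])
    also have "\<dots> = 0\<^sub>v nc" using 0 c by (simp add: mat_mult_zero_vec)
    finally have 2: "(rank_form nc nr r *\<^sub>v (P\<^sup>T *\<^sub>v x)) $ i = 0" if "i < nc" for i using that by simp
    show "\<forall>i<r. (P\<^sup>T *\<^sub>v x) $ i = 0"
    proof (intro allI impI)
      fix i assume "i < r"
      then show "(P\<^sup>T *\<^sub>v x) $ i = 0"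
        using 2[of i] r c x rank_form_mult_vec[of "P\<^sup>T *\<^sub>v x" nr i nc r] by simp
    qed
  next
    assume 0: "\<forall>i<r. (P\<^sup>T *\<^sub>v x) $ i = 0"
    have "P\<^sup>T *\<^sub>v x \<in> carrier_vec nr" using c x by auto
    then have "rank_form nc nr r *\<^sub>v (P\<^sup>T *\<^sub>v x) = 0\<^sub>v nc"
      using 0 r by (intro eq_vecI)
        (auto simp: rank_form_mult_vec carrier_matD[OF rank_form_carrier]
          simp del: index_mult_mat_vec)
    then show "A\<^sup>T *\<^sub>v x = 0\<^sub>v nc" using AT[OF x] c by (simp add: mat_mult_zero_vec)
  qed
  define E :: "real mat" where "E = mat nr (nr - r) (\<lambda>(i, j). if i = r + j then 1 else 0)"
  have E: "E \<in> carrier_mat nr (nr - r)" by (simp add: E_def)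
  have Ev: "(E *\<^sub>v y) $ i = (if i < r then 0 else y $ (i - r))"
    if y: "y \<in> carrier_vec (nr - r)" "i < nr" for y i
  proof -
    have "(E *\<^sub>v y) $ i = (\<Sum>j<nr - r. if j = i - r \<and> \<not> i < r then y $ j else 0)"
      using y by (auto simp: E_def scalar_prod_def lessThan_atLeast0 intro!: sum.cong)
    also have "\<dots> = (if i < r then 0 else y $ (i - r))"
      using y by (cases "i < r") auto
    finally show ?thesis .
  qed
  define K where "K = P'\<^sup>T * E"
  have K: "K \<in> carrier_mat nr (nr - r)" using c E by (auto simp: K_def)
  have Kv: "K *\<^sub>v y = P'\<^sup>T *\<^sub>v (E *\<^sub>v y)" if "y \<in> carrier_vec (nr - r)" for y
    using c that E by (simp add: K_def assoc_mult_mat_vec[of _ nr nr _ "nr - r"])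
  have PK: "P\<^sup>T *\<^sub>v (K *\<^sub>v y) = E *\<^sub>v y" if "y \<in> carrier_vec (nr - r)" for y
    using that E by (simp add: Kv inverse_pair_cancel_vec[OF PT])
  show ?thesis
  proof (rule that[of K, folded r_def, OF K])
    show "{\<beta> \<in> carrier_vec nr. A\<^sup>T *\<^sub>v \<beta> = 0\<^sub>v nc} = {K *\<^sub>v c | c. c \<in> carrier_vec (nr - r)}"
    proof (intro Set.set_eqI iffI)
      fix z assume "z \<in> {\<beta> \<in> carrier_vec nr. A\<^sup>T *\<^sub>v \<beta> = 0\<^sub>v nc}"
      then have z: "z \<in> carrier_vec nr" "\<forall>i<r. (P\<^sup>T *\<^sub>v z) $ i = 0" using ker by auto
      define y where "y = vec (nr - r) (\<lambda>i. (P\<^sup>T *\<^sub>v z) $ (r + i))"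
      have y: "y \<in> carrier_vec (nr - r)" by (simp add: y_def)
      have "E *\<^sub>v y = P\<^sup>T *\<^sub>v z"
      proof (rule eq_vecI)
        fix i assume "i < dim_vec (P\<^sup>T *\<^sub>v z)"
        then have "i < nr" using c by simp
        then show "(E *\<^sub>v y) $ i = (P\<^sup>T *\<^sub>v z) $ i"
          using Ev[OF y] z(2) y_def by (cases "i < r") auto
      qed (use E c in auto)
      then have "z = K *\<^sub>v y" using z Kv[OF y] by (simp add: inverse_pair_cancel_vec[OF PT])
      then show "z \<in> {K *\<^sub>v c | c. c \<in> carrier_vec (nr - r)}" using y by auto
    next
      fix z assume "z \<in> {K *\<^sub>v c | c. c \<in> carrier_vec (nr - r)}"
      then obtain y where y: "z = K *\<^sub>v y" "y \<in> carrier_vec (nr - r)" by auto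
      then have "z \<in> carrier_vec nr" "\<forall>i<r. (P\<^sup>T *\<^sub>v z) $ i = 0"
        using K PK Ev r by (auto simp del: index_mult_mat_vec)
      then show "z \<in> {\<beta> \<in> carrier_vec nr. A\<^sup>T *\<^sub>v \<beta> = 0\<^sub>v nc}" using ker by auto
    qed
    fix y :: "real vec" assume y: "y \<in> carrier_vec (nr - r)" "K *\<^sub>v y = 0\<^sub>v nr"
    then have "E *\<^sub>v y = 0\<^sub>v nr" using PK[OF y(1)] c by (simp add: mat_mult_zero_vec)
    then have 0: "(E *\<^sub>v y) $ (r + i) = 0" if "i < nr - r" for i using that by simp
    show "y = 0\<^sub>v (nr - r)"
    proof (rule eq_vecI)
      fix i assume "i < dim_vec (0\<^sub>v (nr - r))"
      then show "y $ i = 0\<^sub>v (nr - r) $ i"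
        using 0[of i] Ev[OF y(1), of "r + i"] by simp
    qed (use y in auto)
  qed
qed

lemma dim_transpose_kernel:
  assumes "A \<in> carrier_mat nr nc"
  shows "vectorspace.dim class_ring ((module_vec TYPE(real) nr)
    \<lparr>carrier := {\<beta> \<in> carrier_vec nr. A\<^sup>T *\<^sub>v \<beta> = 0\<^sub>v nc}\<rparr>) = nr - mat_rank A"
proof (rule transpose_kernel_image[OF assms])
  fix K assume K: "K \<in> carrier_mat nr (nr - mat_rank A)"
    and eq: "{\<beta> \<in> carrier_vec nr. A\<^sup>T *\<^sub>v \<beta> = 0\<^sub>v nc} = {K *\<^sub>v c | c. c \<in> carrier_vec (nr - mat_rank A)}"
    and inj: "\<And>c. c \<in> carrier_vec (nr - mat_rank A) \<Longrightarrow> K *\<^sub>v c = 0\<^sub>v nr \<Longrightarrow> c = 0\<^sub>v (nr - mat_rank A)"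
  show ?thesis unfolding eq by (rule dim_image_injective[OF K inj])
qed

lemma full_row_rank_left_kernel:
  assumes A: "A \<in> carrier_mat nr nc" and "full_row_rank A"
    and "x \<in> carrier_vec nr" "A\<^sup>T *\<^sub>v x = 0\<^sub>v nc"
  shows "x = 0\<^sub>v nr"
proof (rule transpose_kernel_image[OF A])
  fix K assume K: "K \<in> carrier_mat nr (nr - mat_rank A)" and
    eq: "{\<beta> \<in> carrier_vec nr. A\<^sup>T *\<^sub>v \<beta> = 0\<^sub>v nc} = {K *\<^sub>v c | c. c \<in> carrier_vec (nr - mat_rank A)}"
  have "x \<in> {\<beta> \<in> carrier_vec nr. A\<^sup>T *\<^sub>v \<beta> = 0\<^sub>v nc}" using assms by simp
  then obtain c where "x = K *\<^sub>v c" "c \<in> carrier_vec (nr - mat_rank A)" unfolding eq by auto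
  moreover have "nr - mat_rank A = 0" using assms by (auto simp: full_row_rank_def)
  ultimately show ?thesis using K by (intro eq_vecI) (auto simp: scalar_prod_def)
qed

text \<open>If the rank \<open>r\<close> were below \<open>nc\<close>, the unit vector with index
  \<open>r\<close>, the first one that the rank form annihilates, would be carried by
  \<open>Q'\<close> to a nonzero kernel vector of \<open>A\<close>.\<close>

lemma injective_full_col_rank:
  assumes A: "A \<in> carrier_mat nr nc"
    and inj: "\<And>x. x \<in> carrier_vec nc \<Longrightarrow> A *\<^sub>v x = 0\<^sub>v nr \<Longrightarrow> x = 0\<^sub>v nc"
  shows "mat_rank A = nc"
proof -
  define r where "r = mat_rank A"
  obtain P P' Q Q' where 1: "inverse_pair nr P P'" "inverse_pair nc Q Q'"
    "A = P * rank_form nr nc r * Q" and r: "r \<le> min nr nc"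
    using rank_factorization[OF A] r_def by metis
  have c: "P \<in> carrier_mat nr nr" "Q \<in> carrier_mat nc nc" "Q' \<in> carrier_mat nc nc"
    using 1 by (auto simp: inverse_pair_def)
  have Av: "A *\<^sub>v x = P *\<^sub>v (rank_form nr nc r *\<^sub>v (Q *\<^sub>v x))" if "x \<in> carrier_vec nc" for x
    using c that by (simp add: 1(3) assoc_mult_mat_vec[of _ nr nr _ nc] assoc_mult_mat_vec[of _ nr nc _ nc])
  have "r = nc"
  proof (rule ccontr)
    assume "r \<noteq> nc"
    then have rn: "r < nc" using r by simp
    have "rank_form nr nc r *\<^sub>v unit_vec nc r = 0\<^sub>v nr"
    proof (rule eq_vecI)
      fix i assume "i < dim_vec (0\<^sub>v nr :: real vec)"
      then show "(rank_form nr nc r *\<^sub>v unit_vec nc r) $ i = 0\<^sub>v nr $ i"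
        using r rn rank_form_mult_vec[of "unit_vec nc r" nc i nr r] by auto
    qed (simp add: rank_form_def)
    then have "A *\<^sub>v (Q' *\<^sub>v unit_vec nc r) = 0\<^sub>v nr"
      using c by (simp add: Av inverse_pair_cancel_vec[OF 1(2)] mat_mult_zero_vec)
    then have "Q' *\<^sub>v unit_vec nc r = 0\<^sub>v nc" using c by (intro inj) auto
    then have "Q *\<^sub>v (Q' *\<^sub>v unit_vec nc r) = 0\<^sub>v nc" using c by (simp add: mat_mult_zero_vec)
    then have "unit_vec nc r = (0\<^sub>v nc :: real vec)"
      by (simp add: inverse_pair_cancel_vec[OF 1(2)])
    then show False using rn by (metis index_unit_vec(1) index_zero_vec(1) zero_neq_one)
  qed
  then show ?thesis by (simp add: r_def)
qed

section \<open>Linear processes in white noise\<close>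

lemma abs_mult_le_sum_squares: "\<bar>x * y\<bar> \<le> x\<^sup>2 + y\<^sup>2" for x y :: real
proof -
  have "2 * \<bar>x * y\<bar> \<le> x\<^sup>2 + y\<^sup>2"
    using sum_squares_bound[of "\<bar>x\<bar>" "\<bar>y\<bar>"] by (simp add: abs_mult mult.assoc)
  then show ?thesis using abs_ge_zero[of "x * y"] by linarith
qed

lemma integral_double_sum:
  fixes f :: "'i \<Rightarrow> 'j \<Rightarrow> 'w \<Rightarrow> real"
  assumes "\<And>i j. i \<in> A \<Longrightarrow> j \<in> B \<Longrightarrow> integrable M (f i j)"
  shows "(\<integral>\<omega>. (\<Sum>i\<in>A. \<Sum>j\<in>B. f i j \<omega>) \<partial>M) = (\<Sum>i\<in>A. \<Sum>j\<in>B. \<integral>\<omega>. f i j \<omega> \<partial>M)"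
  using assms
  by (subst Bochner_Integration.integral_sum)
    (auto intro!: Bochner_Integration.integrable_sum sum.cong Bochner_Integration.integral_sum)

text \<open>Second-order abstraction of the innovations: what follows refers to the noise through
  its means and covariances alone. Nonsingularity of \<open>S\<close> is phrased as a trivial left
  kernel, which is the form in which \<open>quad_pos\<close> needs it.\<close>

locale white_noise = prob_space M for M :: "'w measure" +
  fixes k :: nat and e :: "int \<Rightarrow> nat \<Rightarrow> 'w \<Rightarrow> real" and S :: "nat \<Rightarrow> nat \<Rightarrow> real"
  assumes noise_measurable [measurable]: "l < k \<Longrightarrow> e t l \<in> borel_measurable M"
    and noise_square: "l < k \<Longrightarrow> integrable M (\<lambda>\<omega>. (e t l \<omega>)\<^sup>2)"
    and noise_mean: "l < k \<Longrightarrow> (\<integral>\<omega>. e t l \<omega> \<partial>M) = 0"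
    and noise_cov: "l < k \<Longrightarrow> m < k \<Longrightarrow>
      (\<integral>\<omega>. e t l \<omega> * e s m \<omega> \<partial>M) = (if t = s then S l m else 0)"
    and noise_nondegenerate: "(\<And>m. m < k \<Longrightarrow> (\<Sum>l<k. x l * S l m) = 0) \<Longrightarrow> l < k \<Longrightarrow> x l = 0"
begin

text \<open>The coefficient of noise coordinate l at lag j is d j l; the sum of d over all lags is the row d(1) of the transfer function.\<close>
definition lag_term :: "(nat \<Rightarrow> nat \<Rightarrow> real) \<Rightarrow> int \<Rightarrow> nat \<Rightarrow> 'w \<Rightarrow> real" where
  "lag_term d t j \<omega> = (\<Sum>l<k. d j l * e (t - int j) l \<omega>)"

definition linear_process :: "(nat \<Rightarrow> nat \<Rightarrow> real) \<Rightarrow> (int \<Rightarrow> 'w \<Rightarrow> real) \<Rightarrow> bool" where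
  "linear_process d X \<longleftrightarrow> (\<forall>l<k. summable (\<lambda>j. \<bar>d j l\<bar>)) \<and>
     (\<forall>t. X t \<in> borel_measurable M \<and> (AE \<omega> in M. (\<lambda>j. lag_term d t j \<omega>) sums X t \<omega>))"

definition total :: "(nat \<Rightarrow> nat \<Rightarrow> real) \<Rightarrow> nat \<Rightarrow> real" where
  "total d l = (\<Sum>j. d j l)"

definition quad :: "(nat \<Rightarrow> real) \<Rightarrow> (nat \<Rightarrow> real) \<Rightarrow> real" where
  "quad x y = (\<Sum>l<k. \<Sum>m<k. x l * S l m * y m)"

section \<open>Covariances of the noise and of single lag terms\<close>

lemma noise_prod_integrable:
  assumes "l < k" "m < k"
  shows "integrable M (\<lambda>\<omega>. e t l \<omega> * e s m \<omega>)"
proof (rule Bochner_Integration.integrable_bound)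
  show "integrable M (\<lambda>\<omega>. (e t l \<omega>)\<^sup>2 + (e s m \<omega>)\<^sup>2)"
    using noise_square assms by auto
  show "(\<lambda>\<omega>. e t l \<omega> * e s m \<omega>) \<in> borel_measurable M" using assms by measurable
  show "AE \<omega> in M. norm (e t l \<omega> * e s m \<omega>) \<le> norm ((e t l \<omega>)\<^sup>2 + (e s m \<omega>)\<^sup>2)"
    using abs_mult_le_sum_squares by auto
qed

lemma noise_integrable: "l < k \<Longrightarrow> integrable M (e t l)"
  by (rule square_integrable_imp_integrable) (auto intro: noise_square)

lemma lag_term_measurable [measurable]: "lag_term d t j \<in> borel_measurable M"
  unfolding lag_term_def by measurable

lemma integral_lag_term_prod:
  "integrable M (\<lambda>\<omega>. lag_term d t i \<omega> * lag_term d' s j \<omega>)"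
  "(\<integral>\<omega>. lag_term d t i \<omega> * lag_term d' s j \<omega> \<partial>M) =
     (if t - int i = s - int j then quad (d i) (d' j) else 0)"
proof -
  have eq: "lag_term d t i \<omega> * lag_term d' s j \<omega> =
    (\<Sum>l<k. \<Sum>m<k. d i l * d' j m * (e (t - int i) l \<omega> * e (s - int j) m \<omega>))" for \<omega>
    unfolding lag_term_def sum_product by (intro sum.cong) auto
  have int: "integrable M (\<lambda>\<omega>. d i l * d' j m * (e (t - int i) l \<omega> * e (s - int j) m \<omega>))"
    if "l < k" "m < k" for l m
    using noise_prod_integrable[OF that] by simp
  then show "integrable M (\<lambda>\<omega>. lag_term d t i \<omega> * lag_term d' s j \<omega>)"
    unfolding eq by (intro Bochner_Integration.integrable_sum) auto
  have "(\<integral>\<omega>. lag_term d t i \<omega> * lag_term d' s j \<omega> \<partial>M) =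
    (\<Sum>l<k. \<Sum>m<k. d i l * d' j m * (if t - int i = s - int j then S l m else 0))"
    unfolding eq using int by (subst integral_double_sum) (auto intro!: sum.cong simp: noise_cov)
  also have "\<dots> = (if t - int i = s - int j then quad (d i) (d' j) else 0)"
    by (auto simp: quad_def mult_ac intro!: sum.cong)
  finally show "(\<integral>\<omega>. lag_term d t i \<omega> * lag_term d' s j \<omega> \<partial>M) =
     (if t - int i = s - int j then quad (d i) (d' j) else 0)" .
qed

lemma integral_lag_term: "integrable M (lag_term d t j)" "(\<integral>\<omega>. lag_term d t j \<omega> \<partial>M) = 0"
proof -
  have eq: "lag_term d t j = (\<lambda>\<omega>. \<Sum>l<k. d j l * e (t - int j) l \<omega>)" by (auto simp: lag_term_def)
  show "integrable M (lag_term d t j)" unfolding eq using noise_integrable by auto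
  show "(\<integral>\<omega>. lag_term d t j \<omega> \<partial>M) = 0"
    unfolding eq using noise_integrable
    by (subst Bochner_Integration.integral_sum) (auto simp: noise_mean)
qed

text \<open>Positive semidefiniteness of \<open>S\<close> is not postulated in the locale; it
  follows from writing the quadratic form as a second moment.\<close>

lemma quad_self: "quad x x = (\<integral>\<omega>. (\<Sum>l<k. x l * e 0 l \<omega>)\<^sup>2 \<partial>M)"
  using integral_lag_term_prod(2)[of "\<lambda>_. x" 0 0 "\<lambda>_. x" 0 0]
  by (simp add: lag_term_def power2_eq_square)

lemma quad_nonneg: "quad x x \<ge> 0"
  unfolding quad_self by simp

text \<open>A noise combination \<open>X\<close> with zero second moment vanishes almost surely.
  Then its covariance with each noise coordinate vanishes too, and these covariances are the entries
  of the row \<open>x\<close> times \<open>S\<close>.\<close>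

lemma quad_pos:
  assumes "l < k" "x l \<noteq> 0"
  shows "quad x x > 0"
proof (rule ccontr)
  define X where "X \<omega> = (\<Sum>l<k. x l * e 0 l \<omega>)" for \<omega>
  have [measurable]: "X \<in> borel_measurable M" unfolding X_def by measurable
  have X: "X = lag_term (\<lambda>_. x) 0 0" by (auto simp: X_def lag_term_def)
  assume "\<not> quad x x > 0"
  then have "(\<integral>\<omega>. (X \<omega>)\<^sup>2 \<partial>M) = 0" using quad_nonneg[of x] unfolding quad_self X_def by linarith
  moreover have "integrable M (\<lambda>\<omega>. (X \<omega>)\<^sup>2)"
    using integral_lag_term_prod(1)[of "\<lambda>_. x" 0 0 "\<lambda>_. x" 0 0] by (simp add: X power2_eq_square)
  ultimately have "AE \<omega> in M. (X \<omega>)\<^sup>2 = 0"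
    by (subst integral_nonneg_eq_0_iff_AE[symmetric]) auto
  then have 0: "AE \<omega> in M. X \<omega> = 0" by auto
  have "(\<Sum>l<k. x l * S l m) = 0" if m: "m < k" for m
  proof -
    have "(\<integral>\<omega>. X \<omega> * e 0 m \<omega> \<partial>M) = (\<integral>\<omega>. 0 \<partial>M)"
      by (rule integral_cong_AE) (use 0 m in auto)
    then have "0 = (\<integral>\<omega>. (\<Sum>l<k. x l * (e 0 l \<omega> * e 0 m \<omega>)) \<partial>M)"
      by (simp add: X_def sum_distrib_right mult.assoc)
    also have "\<dots> = (\<Sum>l<k. x l * S l m)"
      using m by (subst Bochner_Integration.integral_sum) (auto simp: noise_cov noise_prod_integrable)
    finally show ?thesis by simp
  qed
  then show False using noise_nondegenerate[of x l] assms by auto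
qed

lemma partial_sums_dominated:
  assumes d: "\<And>l. l < k \<Longrightarrow> summable (\<lambda>j. \<bar>d j l\<bar>)"
  shows "\<exists>H. integrable M H \<and> (AE \<omega> in M. \<forall>N. (\<Sum>j<N. lag_term d t j \<omega>)\<^sup>2 \<le> H \<omega>)"
proof -
  \<comment> \<open>By Cauchy-Schwarz with weights \<open>\<bar>d j l\<bar>\<close>, the squared partial sums are at most
      (\<open>\<Sum>j. a j\<close>) (\<open>\<Sum>j. h j\<close>), and the second factor has finite expectation.\<close>
  define h where "h j \<omega> = (\<Sum>l<k. \<bar>d j l\<bar> * (e (t - int j) l \<omega>)\<^sup>2)" for j \<omega>
  define a where "a j = (\<Sum>l<k. \<bar>d j l\<bar>)" for j
  have [measurable]: "h j \<in> borel_measurable M" for j unfolding h_def by measurable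
  have h0: "h j \<omega> \<ge> 0" for j \<omega> by (auto simp: h_def intro!: sum_nonneg)
  have a0: "a j \<ge> 0" for j by (auto simp: a_def intro!: sum_nonneg)
  have sa: "summable a" unfolding a_def by (rule summable_sum) (use d in auto)
  have hi: "integrable M (h j)" for j unfolding h_def using noise_square by auto
  have hI: "(\<integral>\<omega>. h j \<omega> \<partial>M) = (\<Sum>l<k. \<bar>d j l\<bar> * S l l)" for j
    unfolding h_def using noise_square noise_cov
    by (subst Bochner_Integration.integral_sum) (auto simp: power2_eq_square)
  have sI: "summable (\<lambda>j. \<integral>\<omega>. h j \<omega> \<partial>M)"
    unfolding hI by (rule summable_sum) (use d in \<open>auto intro: summable_mult2\<close>)
  have nn: "(\<integral>\<^sup>+\<omega>. (\<Sum>j. ennreal (h j \<omega>)) \<partial>M) \<noteq> \<infinity>"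
  proof -
    have "(\<integral>\<^sup>+\<omega>. (\<Sum>j. ennreal (h j \<omega>)) \<partial>M) = (\<Sum>j. \<integral>\<^sup>+\<omega>. ennreal (h j \<omega>) \<partial>M)"
      by (rule nn_integral_suminf) auto
    also have "\<dots> = (\<Sum>j. ennreal (\<integral>\<omega>. h j \<omega> \<partial>M))"
      using hi h0 by (subst nn_integral_eq_integral) auto
    also have "\<dots> \<noteq> \<infinity>"
      unfolding infinity_ennreal_def by (rule ennreal_suminf_neq_top[OF sI]) (auto intro!: Bochner_Integration.integral_nonneg h0)
    finally show ?thesis by simp
  qed
  have "AE \<omega> in M. (\<Sum>j. ennreal (h j \<omega>)) \<noteq> \<infinity>"
    by (rule nn_integral_PInf_AE[OF _ nn]) measurable
  then have sum_h: "AE \<omega> in M. summable (\<lambda>j. h j \<omega>)"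
    by eventually_elim (rule summable_suminf_not_top, auto simp: h0 infinity_ennreal_def)
  define H where "H \<omega> = suminf a * (\<Sum>j. h j \<omega>)" for \<omega>
  have "integrable M (\<lambda>\<omega>. \<Sum>j. h j \<omega>)"
    by (rule integrable_suminf) (use hi sum_h sI h0 in auto)
  then have "integrable M H" unfolding H_def by simp
  moreover have "AE \<omega> in M. \<forall>N. (\<Sum>j<N. lag_term d t j \<omega>)\<^sup>2 \<le> H \<omega>"
    using sum_h
  proof eventually_elim
    case (elim \<omega>)
    show ?case
    proof
      fix N :: nat
      let ?I = "{..<N} \<times> {..<k}"
      have "(\<Sum>j<N. lag_term d t j \<omega>)\<^sup>2 =
          (\<Sum>(j,l)\<in>?I. sqrt \<bar>d j l\<bar> * (sgn (d j l) * sqrt \<bar>d j l\<bar> * e (t - int j) l \<omega>))\<^sup>2"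
      proof -
        \<comment> \<open>The coefficient is split evenly over the two factors of the Cauchy-Schwarz
          inequality: the squares of the first add up to the absolute coefficients, those of the
          second to the weighted squares of the noise.\<close>
        have "x * y = sqrt \<bar>x\<bar> * (sgn x * sqrt \<bar>x\<bar> * y)" for x y :: real
        proof -
          have "sqrt \<bar>x\<bar> * (sgn x * sqrt \<bar>x\<bar> * y) = (sqrt \<bar>x\<bar> * sqrt \<bar>x\<bar>) * sgn x * y"
            by (simp only: mult_ac)
          also have "\<dots> = x * y" by (simp add: abs_mult_sgn)
          finally show ?thesis by (rule sym)
        qed
        then show ?thesis
          unfolding lag_term_def sum.cartesian_product by (intro arg_cong[where f = power2] sum.cong) auto
      qed
      also have "\<dots> = (\<Sum>p\<in>?I. sqrt \<bar>d (fst p) (snd p)\<bar> *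
          (sgn (d (fst p) (snd p)) * sqrt \<bar>d (fst p) (snd p)\<bar> * e (t - int (fst p)) (snd p) \<omega>))\<^sup>2"
        by (simp add: case_prod_unfold)
      also have "\<dots> \<le> (\<Sum>p\<in>?I. (sqrt \<bar>d (fst p) (snd p)\<bar>)\<^sup>2) *
          (\<Sum>p\<in>?I. (sgn (d (fst p) (snd p)) * sqrt \<bar>d (fst p) (snd p)\<bar> * e (t - int (fst p)) (snd p) \<omega>)\<^sup>2)"
        by (rule Cauchy_Schwarz_ineq_sum)
      also have "(\<Sum>p\<in>?I. (sqrt \<bar>d (fst p) (snd p)\<bar>)\<^sup>2) = (\<Sum>j<N. a j)"
        by (simp add: a_def sum.cartesian_product case_prod_unfold)
      also have "(\<Sum>p\<in>?I. (sgn (d (fst p) (snd p)) * sqrt \<bar>d (fst p) (snd p)\<bar> * e (t - int (fst p)) (snd p) \<omega>)\<^sup>2)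
          = (\<Sum>j<N. h j \<omega>)"
        unfolding h_def sum.cartesian_product
        by (intro sum.cong) (auto simp: power_mult_distrib sgn_real_def)
      also have "(\<Sum>j<N. a j) * (\<Sum>j<N. h j \<omega>) \<le> suminf a * (\<Sum>j. h j \<omega>)"
        using sa elim a0 h0
        by (intro mult_mono sum_le_suminf) (auto intro!: sum_nonneg suminf_nonneg)
      finally show "(\<Sum>j<N. lag_term d t j \<omega>)\<^sup>2 \<le> H \<omega>" by (simp add: H_def)
    qed
  qed
  ultimately show ?thesis by (intro exI[of _ H] conjI)
qed

text \<open>The partial sums converge almost surely and their products lie below the integrable
  \<open>H + G\<close>, so the expectation passes to the limit. The limit is stated along squares of
  index pairs, because both the invariance under time shifts and the regrouping by lags compare
  finite sums of this shape.\<close>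

lemma linear_process_second_moment:
  assumes X: "linear_process d X" and Y: "linear_process d' Y"
  shows "integrable M (\<lambda>\<omega>. X t \<omega> * Y s \<omega>)"
    and "(\<lambda>N. \<Sum>i<N. \<Sum>j<N. if t - int i = s - int j then quad (d i) (d' j) else 0)
      \<longlonglongrightarrow> (\<integral>\<omega>. X t \<omega> * Y s \<omega> \<partial>M)"
proof -
  obtain H where H: "integrable M H" "AE \<omega> in M. \<forall>N. (\<Sum>j<N. lag_term d t j \<omega>)\<^sup>2 \<le> H \<omega>"
    using partial_sums_dominated[of d t] X by (auto simp: linear_process_def)
  obtain G where G: "integrable M G" "AE \<omega> in M. \<forall>N. (\<Sum>j<N. lag_term d' s j \<omega>)\<^sup>2 \<le> G \<omega>"
    using partial_sums_dominated[of d' s] Y by (auto simp: linear_process_def)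
  have [measurable]: "X t \<in> borel_measurable M" "Y s \<in> borel_measurable M"
    using X Y by (auto simp: linear_process_def)
  define P where "P N \<omega> = (\<Sum>j<N. lag_term d t j \<omega>) * (\<Sum>j<N. lag_term d' s j \<omega>)" for N \<omega>
  have [measurable]: "P N \<in> borel_measurable M" for N unfolding P_def by measurable
  have W: "integrable M (\<lambda>\<omega>. H \<omega> + G \<omega>)" using H G by simp
  have XA: "AE \<omega> in M. (\<lambda>j. lag_term d t j \<omega>) sums X t \<omega>"
    and YA: "AE \<omega> in M. (\<lambda>j. lag_term d' s j \<omega>) sums Y s \<omega>"
    using X Y by (auto simp: linear_process_def)
  have lim: "AE \<omega> in M. (\<lambda>N. P N \<omega>) \<longlonglongrightarrow> X t \<omega> * Y s \<omega>"
    using XA YA by eventually_elim (auto simp: P_def sums_def intro!: tendsto_mult)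
  have bound: "AE \<omega> in M. norm (P N \<omega>) \<le> H \<omega> + G \<omega>" for N
    using H(2) G(2)
  proof eventually_elim
    case (elim \<omega>)
    have "norm (P N \<omega>) \<le> (\<Sum>j<N. lag_term d t j \<omega>)\<^sup>2 + (\<Sum>j<N. lag_term d' s j \<omega>)\<^sup>2"
      unfolding P_def real_norm_def by (rule abs_mult_le_sum_squares)
    then show ?case using elim by (meson add_mono order_trans)
  qed
  show "integrable M (\<lambda>\<omega>. X t \<omega> * Y s \<omega>)"
    by (rule integrable_dominated_convergence[OF _ _ W lim bound]) auto
  have conv: "(\<lambda>N. \<integral>\<omega>. P N \<omega> \<partial>M) \<longlonglongrightarrow> (\<integral>\<omega>. X t \<omega> * Y s \<omega> \<partial>M)"
    by (rule integral_dominated_convergence[OF _ _ W lim bound]) auto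
  have "(\<integral>\<omega>. P N \<omega> \<partial>M) =
      (\<Sum>i<N. \<Sum>j<N. if t - int i = s - int j then quad (d i) (d' j) else 0)" for N
    unfolding P_def sum_product
    by (subst integral_double_sum) (simp_all add: integral_lag_term_prod)
  then show "(\<lambda>N. \<Sum>i<N. \<Sum>j<N. if t - int i = s - int j then quad (d i) (d' j) else 0)
      \<longlonglongrightarrow> (\<integral>\<omega>. X t \<omega> * Y s \<omega> \<partial>M)"
    using conv by simp
qed

lemma linear_process_mean:
  assumes X: "linear_process d X"
  shows "(\<integral>\<omega>. X t \<omega> \<partial>M) = 0"
proof -
  obtain H where H: "integrable M H" "AE \<omega> in M. \<forall>N. (\<Sum>j<N. lag_term d t j \<omega>)\<^sup>2 \<le> H \<omega>"
    using partial_sums_dominated[of d t] X by (auto simp: linear_process_def)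
  have [measurable]: "X t \<in> borel_measurable M"
    using X by (auto simp: linear_process_def)
  have W: "integrable M (\<lambda>\<omega>. 1 + H \<omega>)" using H by simp
  have "AE \<omega> in M. (\<lambda>j. lag_term d t j \<omega>) sums X t \<omega>"
    using X by (auto simp: linear_process_def)
  then have lim: "AE \<omega> in M. (\<lambda>N. \<Sum>j<N. lag_term d t j \<omega>) \<longlonglongrightarrow> X t \<omega>"
    by (simp add: sums_def)
  have bound: "AE \<omega> in M. norm (\<Sum>j<N. lag_term d t j \<omega>) \<le> 1 + H \<omega>" for N
    using H(2)
  proof eventually_elim
    case (elim \<omega>)
    have "\<bar>x\<bar> \<le> 1 + x\<^sup>2" for x :: real
      using sum_squares_bound[of "\<bar>x\<bar>" 1] by simp
    then show ?case using elim by (metis add_left_mono order_trans real_norm_def)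
  qed
  have "(\<lambda>N. \<integral>\<omega>. (\<Sum>j<N. lag_term d t j \<omega>) \<partial>M) \<longlonglongrightarrow> (\<integral>\<omega>. X t \<omega> \<partial>M)"
    by (rule integral_dominated_convergence[OF _ _ W lim bound]) auto
  moreover have "(\<integral>\<omega>. (\<Sum>j<N. lag_term d t j \<omega>) \<partial>M) = 0" for N
    by (subst Bochner_Integration.integral_sum) (auto simp: integral_lag_term)
  ultimately show ?thesis by (simp add: LIMSEQ_const_iff)
qed

end

section \<open>Sums over pairs of lags and the long-run covariance\<close>

lemma abs_summable_on_product:
  fixes x y :: "nat \<Rightarrow> real"
  assumes "summable (\<lambda>i. \<bar>x i\<bar>)" "summable (\<lambda>j. \<bar>y j\<bar>)"
  shows "Infinite_Sum.abs_summable_on (\<lambda>p. x (fst p) * y (snd p)) UNIV"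
proof -
  have x: "(\<lambda>i. \<bar>x i\<bar>) summable_on UNIV" and y: "(\<lambda>j. \<bar>y j\<bar>) summable_on UNIV"
    using assms by (auto intro!: summable_nonneg_imp_summable_on)
  have "Infinite_Sum.abs_summable_on (\<lambda>p. x (fst p) * y (snd p)) (UNIV \<times> UNIV)"
    unfolding Infinite_Sum.abs_summable_on_Sigma_iff
  proof (intro conjI ballI)
    fix i
    have "(\<lambda>j. \<bar>x i\<bar> * \<bar>y j\<bar>) summable_on UNIV" by (rule summable_on_cmult_right[OF y])
    then show "Infinite_Sum.abs_summable_on (\<lambda>j. x (fst (i, j)) * y (snd (i, j))) UNIV"
      by (simp only: fst_conv snd_conv real_norm_def abs_mult)
  next
    have "(\<lambda>i. \<bar>x i\<bar> * infsum (\<lambda>j. \<bar>y j\<bar>) UNIV) summable_on UNIV"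
      by (rule summable_on_cmult_left[OF x])
    moreover have "infsum (\<lambda>j. norm (x (fst (i, j)) * y (snd (i, j)))) UNIV = \<bar>x i\<bar> * infsum (\<lambda>j. \<bar>y j\<bar>) UNIV" for i
      unfolding fst_conv snd_conv real_norm_def abs_mult by (rule infsum_cmult_right) (rule y)
    moreover have "infsum (\<lambda>j. \<bar>y j\<bar>) UNIV \<ge> 0" by (rule infsum_nonneg) simp
    ultimately show "Infinite_Sum.abs_summable_on (\<lambda>i. infsum (\<lambda>j. norm (x (fst (i, j)) * y (snd (i, j)))) UNIV) UNIV"
      by (simp only: real_norm_def abs_mult abs_abs abs_of_nonneg)
  qed
  then show ?thesis by simp
qed

lemma summable_on_finite_sum:
  fixes f :: "'i \<Rightarrow> 'a \<Rightarrow> real"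
  assumes "finite I" "\<And>i. i \<in> I \<Longrightarrow> f i summable_on A"
  shows "(\<lambda>x. \<Sum>i\<in>I. f i x) summable_on A"
  using assms by (induction I) (auto intro: summable_on_add)

text \<open>Every finite set of pairs lies in some square, so an unordered sum can be evaluated
  along squares. This connects unconditional summation with the limits in
  \<open>linear_process_second_moment\<close>.\<close>

lemma has_sum_squares_limit:
  fixes f :: "nat \<times> nat \<Rightarrow> real"
  assumes "(f has_sum s) UNIV"
  shows "(\<lambda>N. \<Sum>i<N. \<Sum>j<N. f (i, j)) \<longlonglongrightarrow> s"
proof -
  have "filterlim (\<lambda>N. {..<N} \<times> {..<N}) (finite_subsets_at_top (UNIV :: (nat \<times> nat) set)) sequentially"
    unfolding filterlim_iff eventually_finite_subsets_at_top
  proof (intro allI impI)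
    fix P :: "(nat \<times> nat) set \<Rightarrow> bool"
    assume "\<exists>X. finite X \<and> X \<subseteq> UNIV \<and> (\<forall>Y. finite Y \<and> X \<subseteq> Y \<and> Y \<subseteq> UNIV \<longrightarrow> P Y)"
    then obtain X where X: "finite X" "\<And>Y. finite Y \<Longrightarrow> X \<subseteq> Y \<Longrightarrow> P Y" by auto
    have "X \<subseteq> {..<N} \<times> {..<N}" if N: "N > Max (insert 0 (fst ` X \<union> snd ` X))" for N
    proof
      fix p assume p: "p \<in> X"
      have "fst p \<le> Max (insert 0 (fst ` X \<union> snd ` X))" "snd p \<le> Max (insert 0 (fst ` X \<union> snd ` X))"
        using X p by (auto intro!: Max_ge)
      then show "p \<in> {..<N} \<times> {..<N}" using N by (cases p) auto
    qed
    then have "P ({..<N} \<times> {..<N})" if "N > Max (insert 0 (fst ` X \<union> snd ` X))" for N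
      by (intro X(2)) (use that in auto)
    then show "eventually (\<lambda>N. P ({..<N} \<times> {..<N})) sequentially"
      by (intro eventually_sequentiallyI[of "Suc (Max (insert 0 (fst ` X \<union> snd ` X)))"]) auto
  qed
  then have "(\<lambda>N. sum f ({..<N} \<times> {..<N})) \<longlonglongrightarrow> s"
    using assms unfolding has_sum_def by (rule filterlim_compose[rotated])
  then show ?thesis by (simp add: sum.cartesian_product)
qed

context white_noise
begin

lemma linear_process_coeff_summable: "linear_process d X \<Longrightarrow> l < k \<Longrightarrow> summable (\<lambda>j. d j l)"
  by (rule summable_rabs_cancel) (simp add: linear_process_def)

lemma linear_process_sums_total: "linear_process d X \<Longrightarrow> l < k \<Longrightarrow> (\<lambda>j. d j l) sums total d l"
  unfolding total_def by (intro summable_sums linear_process_coeff_summable)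

lemma quad_summable:
  assumes "linear_process d X" "linear_process d' Y"
  shows "Infinite_Sum.abs_summable_on (\<lambda>p. quad (d (fst p)) (d' (snd p))) UNIV"
    and "((\<lambda>p. quad (d (fst p)) (d' (snd p))) has_sum quad (total d) (total d')) UNIV"
proof -
  have 1: "Infinite_Sum.abs_summable_on (\<lambda>p. d (fst p) l * d' (snd p) m) UNIV" if "l < k" "m < k" for l m
    using that assms by (intro abs_summable_on_product[of "\<lambda>j. d j l" "\<lambda>j. d' j m"]) (auto simp: linear_process_def)
  have 2: "(\<lambda>p. norm (d (fst p) l * S l m * d' (snd p) m)) summable_on UNIV" if "l < k" "m < k" for l m
    using summable_on_cmult_left[OF 1[OF that], of "\<bar>S l m\<bar>"] by (simp add: abs_mult mult_ac)
  show abs: "Infinite_Sum.abs_summable_on (\<lambda>p. quad (d (fst p)) (d' (snd p))) UNIV"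
  proof (rule Infinite_Sum.abs_summable_on_comparison_test')
    show "(\<lambda>p. \<Sum>l<k. \<Sum>m<k. norm (d (fst p) l * S l m * d' (snd p) m)) summable_on UNIV"
      using 2 by (intro summable_on_finite_sum) auto
    show "norm (quad (d (fst p)) (d' (snd p))) \<le>
        (\<Sum>l<k. \<Sum>m<k. norm (d (fst p) l * S l m * d' (snd p) m))" for p
      unfolding quad_def by (intro order_trans[OF norm_sum] sum_mono norm_sum)
  qed
  define s where "s = infsum (\<lambda>p. quad (d (fst p)) (d' (snd p))) UNIV"
  have s: "((\<lambda>p. quad (d (fst p)) (d' (snd p))) has_sum s) UNIV"
    unfolding s_def by (intro has_sum_infsum Infinite_Sum.abs_summable_summable[OF abs])
  \<comment> \<open>On a square the double sum factors into partial sums of the two coefficient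
    sequences, so the value of the unordered sum can be computed there.\<close>
  have "(\<lambda>N. \<Sum>i<N. \<Sum>j<N. quad (d i) (d' j)) \<longlonglongrightarrow> s"
    using has_sum_squares_limit[OF s] by simp
  moreover have "(\<Sum>i<N. \<Sum>j<N. quad (d i) (d' j)) =
     (\<Sum>l<k. \<Sum>m<k. (\<Sum>i<N. d i l) * S l m * (\<Sum>j<N. d' j m))" for N
  proof -
    have "(\<Sum>i<N. \<Sum>j<N. quad (d i) (d' j)) = (\<Sum>i<N. \<Sum>l<k. \<Sum>j<N. \<Sum>m<k. d i l * S l m * d' j m)"
      unfolding quad_def by (intro sum.cong refl sum.swap)
    also have "\<dots> = (\<Sum>l<k. \<Sum>i<N. \<Sum>m<k. \<Sum>j<N. d i l * S l m * d' j m)"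
      by (subst sum.swap) (intro sum.cong refl sum.swap)
    also have "\<dots> = (\<Sum>l<k. \<Sum>m<k. \<Sum>i<N. \<Sum>j<N. d i l * S l m * d' j m)"
      by (intro sum.cong refl sum.swap)
    also have "\<dots> = (\<Sum>l<k. \<Sum>m<k. (\<Sum>i<N. d i l) * S l m * (\<Sum>j<N. d' j m))"
      by (intro sum.cong refl) (simp only: sum_distrib_right, simp only: sum_distrib_left)
    finally show ?thesis .
  qed
  moreover have "(\<lambda>N. \<Sum>l<k. \<Sum>m<k. (\<Sum>i<N. d i l) * S l m * (\<Sum>j<N. d' j m)) \<longlonglongrightarrow> quad (total d) (total d')"
    unfolding quad_def
    using linear_process_sums_total[OF assms(1)] linear_process_sums_total[OF assms(2)]
    by (intro tendsto_sum tendsto_mult tendsto_const) (auto simp: sums_def)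
  ultimately have "s = quad (total d) (total d')" by (simp add: LIMSEQ_unique)
  then show "((\<lambda>p. quad (d (fst p)) (d' (snd p))) has_sum quad (total d) (total d')) UNIV"
    using s by simp
qed

text \<open>The condition \<open>t + h - i = t - j\<close> that selects the nonzero terms does not
  involve \<open>t\<close> after cancellation, so both moments are limits of one and the same
  sequence.\<close>

lemma linear_process_autocov_shift:
  assumes "linear_process d X" "linear_process d' Y"
  shows "(\<integral>\<omega>. X (t + h) \<omega> * Y t \<omega> \<partial>M) = (\<integral>\<omega>. X h \<omega> * Y 0 \<omega> \<partial>M)"
proof -
  have "(\<lambda>N. \<Sum>i<N. \<Sum>j<N. if h - int i = 0 - int j then quad (d i) (d' j) else 0)
      \<longlonglongrightarrow> (\<integral>\<omega>. X (t + h) \<omega> * Y t \<omega> \<partial>M)"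
    using linear_process_second_moment(2)[OF assms, of "t + h" t] by (simp add: algebra_simps)
  then show ?thesis
    using linear_process_second_moment(2)[OF assms, of h 0] by (intro LIMSEQ_unique)
qed

text \<open>The unordered sum over all pairs \<open>(i, j)\<close> is regrouped by the diagonals
  \<open>i - j = h\<close>. The terms on the diagonal \<open>A h\<close> add up to the covariance at
  lag \<open>h\<close>, as one sees along squares after masking the other pairs; absolute
  summability over all pairs makes each diagonal summable.\<close>

lemma linear_process_long_run_cov:
  assumes "linear_process d X" "linear_process d' Y"
  shows "((\<lambda>h. \<integral>\<omega>. X h \<omega> * Y 0 \<omega> \<partial>M) has_sum quad (total d) (total d')) UNIV"
proof -
  define f where "f p = quad (d (fst p)) (d' (snd p))" for p
  define A where "A h = {p :: nat \<times> nat. int (fst p) - int (snd p) = h}" for h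
  have "(f has_sum quad (total d) (total d')) UNIV"
    unfolding f_def by (rule quad_summable(2)[OF assms])
  moreover have "bij_betw (\<lambda>q. snd q) (Sigma UNIV A) (UNIV :: (nat \<times> nat) set)"
    by (rule bij_betwI[where g = "\<lambda>p. (int (fst p) - int (snd p), p)"]) (auto simp: A_def)
  ultimately have tot: "((\<lambda>q. f (snd q)) has_sum quad (total d) (total d')) (Sigma UNIV A)"
    by (simp add: has_sum_reindex_bij_betw)
  show ?thesis
  proof (rule has_sum_SigmaD[OF tot])
    fix h :: int
    have "Infinite_Sum.abs_summable_on f (A h)"
    proof (rule summable_on_subset_banach)
      show "Infinite_Sum.abs_summable_on f UNIV"
        using quad_summable(1)[OF assms] by (simp only: f_def)
    qed simp
    then have s: "(f has_sum infsum f (A h)) (A h)"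
      by (rule has_sum_infsum[OF Infinite_Sum.abs_summable_summable])
    have "((\<lambda>p. if p \<in> A h then f p else 0) has_sum infsum f (A h)) UNIV"
      using s by (subst has_sum_cong_neutral[of "A h" UNIV f]) auto
    moreover have "(i, j) \<in> A h \<longleftrightarrow> h - int i = 0 - int j" for i j by (auto simp: A_def)
    ultimately
    have "(\<lambda>N. \<Sum>i<N. \<Sum>j<N. if h - int i = 0 - int j then quad (d i) (d' j) else 0) \<longlonglongrightarrow> infsum f (A h)"
      using has_sum_squares_limit[of "\<lambda>p. if p \<in> A h then f p else 0"]
      by (simp only: f_def fst_conv snd_conv)
    then have "infsum f (A h) = (\<integral>\<omega>. X h \<omega> * Y 0 \<omega> \<partial>M)"
      using linear_process_second_moment(2)[OF assms, of h 0] by (intro LIMSEQ_unique)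
    then show "((\<lambda>p. f (snd (h, p))) has_sum (\<integral>\<omega>. X h \<omega> * Y 0 \<omega> \<partial>M)) (A h)"
      using s by simp
  qed
qed

section \<open>Multiplication by powers of L, linear combinations and integration\<close>

definition lag_coeff :: "nat \<Rightarrow> (nat \<Rightarrow> nat \<Rightarrow> real) \<Rightarrow> nat \<Rightarrow> nat \<Rightarrow> real" where
  "lag_coeff i d j l = (if j < i then 0 else d (j - i) l)"

lemma lag_coeff_add: "lag_coeff i d (j + i) l = d j l"
  by (simp add: lag_coeff_def)

lemma lag_coeff_sums_iff: "(\<lambda>j. lag_coeff i d j l) sums s \<longleftrightarrow> (\<lambda>j. d j l) sums s"
  using sums_zero_iff_shift[of i "\<lambda>j. lag_coeff i d j l" s]
  by (simp add: lag_coeff_add) (simp add: lag_coeff_def)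

lemma linear_process_lag:
  assumes "linear_process d X"
  shows "linear_process (lag_coeff i d) (\<lambda>t. X (t - int i))"
  unfolding linear_process_def
proof (intro conjI allI impI)
  fix l assume "l < k"
  then have "summable (\<lambda>j. \<bar>d j l\<bar>)" using assms by (auto simp: linear_process_def)
  then have "summable (\<lambda>j. \<bar>lag_coeff i d (j + i) l\<bar>)" by (simp add: lag_coeff_add)
  then show "summable (\<lambda>j. \<bar>lag_coeff i d j l\<bar>)"
    by (subst (asm) summable_iff_shift)
next
  fix t
  show "X (t - int i) \<in> borel_measurable M" using assms by (auto simp: linear_process_def)
  have "AE \<omega> in M. (\<lambda>j. lag_term d (t - int i) j \<omega>) sums X (t - int i) \<omega>"
    using assms by (auto simp: linear_process_def)
  then show "AE \<omega> in M. (\<lambda>j. lag_term (lag_coeff i d) t j \<omega>) sums X (t - int i) \<omega>"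
  proof eventually_elim
    case (elim \<omega>)
    have "t - int (j + i) = t - int i - int j" for j by simp
    then have "lag_term (lag_coeff i d) t (j + i) \<omega> = lag_term d (t - int i) j \<omega>" for j
      by (simp only: lag_term_def lag_coeff_add)
    moreover have "lag_term (lag_coeff i d) t j \<omega> = 0" if "j < i" for j
      using that by (simp add: lag_term_def lag_coeff_def)
    ultimately show ?case
      using elim sums_zero_iff_shift[of i "\<lambda>j. lag_term (lag_coeff i d) t j \<omega>"] by simp
  qed
qed

lemma linear_process_combination:
  assumes "finite I" and "\<And>i. i \<in> I \<Longrightarrow> linear_process (d i) (X i)"
  shows "linear_process (\<lambda>j l. \<Sum>i\<in>I. a i * d i j l) (\<lambda>t \<omega>. \<Sum>i\<in>I. a i * X i t \<omega>)"
  unfolding linear_process_def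
proof (intro conjI allI impI)
  fix l assume l: "l < k"
  have "summable (\<lambda>j. \<Sum>i\<in>I. \<bar>a i\<bar> * \<bar>d i j l\<bar>)"
    using assms l by (intro summable_sum summable_mult) (auto simp: linear_process_def)
  then show "summable (\<lambda>j. \<bar>\<Sum>i\<in>I. a i * d i j l\<bar>)"
    by (rule summable_comparison_test'[where N = 0])
      (auto intro!: order_trans[OF sum_abs] simp: abs_mult)
next
  fix t
  have [measurable]: "i \<in> I \<Longrightarrow> X i t \<in> borel_measurable M" for i
    using assms by (auto simp: linear_process_def)
  show "(\<lambda>\<omega>. \<Sum>i\<in>I. a i * X i t \<omega>) \<in> borel_measurable M" by measurable
  have "AE \<omega> in M. \<forall>i\<in>I. (\<lambda>j. lag_term (d i) t j \<omega>) sums X i t \<omega>"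
    using assms by (intro AE_finite_allI) (auto simp: linear_process_def)
  then show "AE \<omega> in M. (\<lambda>j. lag_term (\<lambda>j l. \<Sum>i\<in>I. a i * d i j l) t j \<omega>) sums (\<Sum>i\<in>I. a i * X i t \<omega>)"
  proof eventually_elim
    case (elim \<omega>)
    have "lag_term (\<lambda>j l. \<Sum>i\<in>I. a i * d i j l) t j \<omega> = (\<Sum>i\<in>I. a i * lag_term (d i) t j \<omega>)" for j
      unfolding lag_term_def sum_distrib_left sum_distrib_right
      by (subst sum.swap) (simp add: mult.assoc)
    moreover have "(\<lambda>j. \<Sum>i\<in>I. a i * lag_term (d i) t j \<omega>) sums (\<Sum>i\<in>I. a i * X i t \<omega>)"
      by (rule sums_sum, rule sums_mult) (use elim in blast)
    ultimately show ?case by simp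
  qed
qed

lemma total_combination:
  assumes "finite I" "\<And>i. i \<in> I \<Longrightarrow> linear_process (d i) (X i)" "l < k"
  shows "total (\<lambda>j l. \<Sum>i\<in>I. a i * d i j l) l = (\<Sum>i\<in>I. a i * total (d i) l)"
proof -
  have "(\<lambda>j. \<Sum>i\<in>I. a i * d i j l) sums (\<Sum>i\<in>I. a i * total (d i) l)"
    by (rule sums_sum, rule sums_mult, rule linear_process_sums_total) (use assms in auto)
  then show ?thesis unfolding total_def by (rule sums_unique[symmetric])
qed

lemma linear_process_cong:
  assumes "linear_process d X" "\<And>t. Y t \<in> borel_measurable M" "\<And>t. AE \<omega> in M. Y t \<omega> = X t \<omega>"
  shows "linear_process d Y"
  unfolding linear_process_def
proof (intro conjI allI)
  fix t
  have "AE \<omega> in M. (\<lambda>j. lag_term d t j \<omega>) sums X t \<omega>" using assms by (auto simp: linear_process_def)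
  with assms(3)[of t] show "AE \<omega> in M. (\<lambda>j. lag_term d t j \<omega>) sums Y t \<omega>"
    by eventually_elim simp
qed (use assms in \<open>auto simp: linear_process_def\<close>)

lemma integrated_constant_variance_total_zero:
  assumes W: "linear_process d W"
    and X: "\<And>t. X t \<in> borel_measurable M" "\<And>t. integrable M (\<lambda>\<omega>. (X t \<omega>)\<^sup>2)"
    and var: "\<And>t. (\<integral>\<omega>. (X t \<omega>)\<^sup>2 \<partial>M) = c"
    and diff: "\<And>t. AE \<omega> in M. X t \<omega> - X (t - 1) \<omega> = W t \<omega>"
    and l: "l < k"
  shows "total d l = 0"
proof -
  \<comment> \<open>\<open>V T T\<close> is \<open>X T - X 0\<close>, a linear process whose coefficient at lag \<open>j < T\<close> is the partial sum \<open>D j\<close>.\<close>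
  define D where "D j l = (\<Sum>i\<le>j. d i l)" for j l
  define V where "V T t \<omega> = (\<Sum>i<T. 1 * W (t - int i) \<omega>)" for T :: nat and t \<omega>
  define dT where "dT T j l = (\<Sum>i<T. 1 * lag_coeff i d j l)" for T :: nat and j l
  have V: "linear_process (dT T) (V T)" for T
    unfolding V_def dT_def
    by (rule linear_process_combination[OF finite_lessThan linear_process_lag[OF W]])
  have dT: "dT T j = D j" if "j < T" for T j
  proof
    fix l
    have "dT T j l = (\<Sum>i\<in>{..j}. d (j - i) l)"
      unfolding dT_def mult_1 using that
      by (intro sum.mono_neutral_cong_right) (auto simp: lag_coeff_def)
    also have "\<dots> = D j l"
      unfolding D_def by (rule sum.reindex_bij_witness[of _ "\<lambda>i. j - i" "\<lambda>i. j - i"]) auto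
    finally show "dT T j l = D j l" .
  qed
  have telescope: "AE \<omega> in M. V T (int T) \<omega> = X (int T) \<omega> - X 0 \<omega>" for T
  proof -
    have "AE \<omega> in M. \<forall>i\<in>{..<T}. X (int T - int i) \<omega> - X (int T - int i - 1) \<omega> = W (int T - int i) \<omega>"
      by (intro AE_finite_allI diff) auto
    then show ?thesis
    proof eventually_elim
      case (elim \<omega>)
      have "V T (int T) \<omega> = (\<Sum>i<T. X (int T - int i) \<omega> - X (int T - int (Suc i)) \<omega>)"
        unfolding V_def using elim by (intro sum.cong) (auto simp: algebra_simps)
      also have "\<dots> = X (int T) \<omega> - X 0 \<omega>"
        using sum_lessThan_telescope'[of "\<lambda>i. X (int T - int i) \<omega>" T] by simp
      finally show ?case .
    qed
  qed
  \<comment> \<open>The levels at time \<open>T\<close> and at time 0 have the same second moment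
    \<open>c\<close>, so the second moment of the increment stays below \<open>4 * c\<close> for
    every horizon. A nonzero long-run coefficient would let it grow without bound.\<close>
  have bound: "(\<integral>\<omega>. V T (int T) \<omega> * V T (int T) \<omega> \<partial>M) \<le> 4 * c" for T
  proof -
    have "(\<integral>\<omega>. V T (int T) \<omega> * V T (int T) \<omega> \<partial>M) \<le> (\<integral>\<omega>. 2 * (X (int T) \<omega>)\<^sup>2 + 2 * (X 0 \<omega>)\<^sup>2 \<partial>M)"
    proof (rule integral_mono_AE)
      show "integrable M (\<lambda>\<omega>. V T (int T) \<omega> * V T (int T) \<omega>)"
        by (rule linear_process_second_moment(1)[OF V V])
      show "integrable M (\<lambda>\<omega>. 2 * (X (int T) \<omega>)\<^sup>2 + 2 * (X 0 \<omega>)\<^sup>2)" using X by simp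
      have ineq: "(x - y) * (x - y) \<le> 2 * x\<^sup>2 + 2 * y\<^sup>2" for x y :: real
        using zero_le_power2[of "x + y"] by (simp add: power2_eq_square algebra_simps)
      from telescope[of T]
      show "AE \<omega> in M. V T (int T) \<omega> * V T (int T) \<omega> \<le> 2 * (X (int T) \<omega>)\<^sup>2 + 2 * (X 0 \<omega>)\<^sup>2"
        by eventually_elim (simp only: ineq)
    qed
    also have "\<dots> = 4 * c" using X var by simp
    finally show ?thesis .
  qed
  \<comment> \<open>Only equal lags contribute, and the lags from \<open>T\<close> on, where the
    coefficients are no longer the full partial sums \<open>D\<close>, add nonnegative terms. So the
    first \<open>T\<close> terms form a lower bound.\<close>
  have lower: "(\<Sum>i<T. quad (D i) (D i)) \<le> (\<integral>\<omega>. V T (int T) \<omega> * V T (int T) \<omega> \<partial>M)" for T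
  proof (rule LIMSEQ_le_const[OF linear_process_second_moment(2)[OF V V]], intro exI allI impI)
    fix N assume N: "T \<le> N"
    have "(\<Sum>i<N. \<Sum>j<N. if int T - int i = int T - int j then quad (dT T i) (dT T j) else 0)
        = (\<Sum>i<N. quad (dT T i) (dT T i))"
      by (intro sum.cong) (auto simp: eq_commute)
    also have "\<dots> \<ge> (\<Sum>i<T. quad (dT T i) (dT T i))"
      using N by (intro sum_mono2) (auto simp: quad_nonneg)
    finally show "(\<Sum>i<T. quad (D i) (D i)) \<le>
      (\<Sum>i<N. \<Sum>j<N. if int T - int i = int T - int j then quad (dT T i) (dT T j) else 0)"
      by (simp add: dT)
  qed
  \<comment> \<open>The bound does not depend on \<open>T\<close>, so the series converges and its
    terms tend to 0. But \<open>D i\<close> tends to \<open>total d\<close>, hence the form vanishes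
    there, and it is positive definite.\<close>
  have "summable (\<lambda>i. quad (D i) (D i))"
    by (rule summableI_nonneg_bounded[OF quad_nonneg order_trans[OF lower bound]])
  then have "(\<lambda>i. quad (D i) (D i)) \<longlonglongrightarrow> 0" by (rule summable_LIMSEQ_zero)
  moreover have "(\<lambda>i. quad (D i) (D i)) \<longlonglongrightarrow> quad (total d) (total d)"
  proof -
    have "(\<lambda>j. D j l) \<longlonglongrightarrow> total d l" if "l < k" for l
      using linear_process_sums_total[OF W that] unfolding D_def sums_def_le .
    then show ?thesis unfolding quad_def
      by (intro tendsto_sum tendsto_mult tendsto_const) auto
  qed
  ultimately have "quad (total d) (total d) = 0" by (rule LIMSEQ_unique[symmetric])
  then show ?thesis using quad_pos[OF l, of "total d"] by auto
qed

lemma linear_process_add: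
  assumes "linear_process d X" "linear_process d' Y"
  shows "linear_process (\<lambda>j l. d j l + d' j l) (\<lambda>t \<omega>. X t \<omega> + Y t \<omega>)"
proof -
  \<comment> \<open>The sum of two processes is treated as a combination indexed by the two
    booleans.\<close>
  have "linear_process (\<lambda>j l. \<Sum>i\<in>UNIV. 1 * (if i then d else d') j l)
      (\<lambda>t \<omega>. \<Sum>i\<in>UNIV. 1 * (if i then X else Y) t \<omega>)"
    by (rule linear_process_combination) (use assms in auto)
  then show ?thesis by (simp add: UNIV_bool add.commute)
qed

lemma linear_process_diff:
  assumes "linear_process d X" "linear_process d' Y"
  shows "linear_process (\<lambda>j l. d j l - d' j l) (\<lambda>t \<omega>. X t \<omega> - Y t \<omega>)"
proof -
  have "linear_process (\<lambda>j l. \<Sum>i\<in>UNIV. (if i then 1 else -1) * (if i then d else d') j l)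
      (\<lambda>t \<omega>. \<Sum>i\<in>UNIV. (if i then 1 else -1) * (if i then X else Y) t \<omega>)"
    by (rule linear_process_combination) (use assms in auto)
  then show ?thesis by (simp add: UNIV_bool)
qed

lemma linear_process_noise:
  "linear_process (\<lambda>j l. if j = 0 then g l else 0) (\<lambda>t \<omega>. \<Sum>l<k. g l * e t l \<omega>)"
  unfolding linear_process_def
proof (intro conjI allI impI)
  fix l :: nat
  show "summable (\<lambda>j::nat. \<bar>if j = 0 then g l else 0\<bar>)"
    by (rule summable_finite[of "{0}"]) auto
next
  fix t
  show "(\<lambda>\<omega>. \<Sum>l<k. g l * e t l \<omega>) \<in> borel_measurable M" by measurable
  have "(\<lambda>j. lag_term (\<lambda>j l. if j = 0 then g l else 0) t j \<omega>) sums
      lag_term (\<lambda>j l. if j = 0 then g l else 0) t 0 \<omega>" for \<omega>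
    using sums_finite[of "{0}" "\<lambda>j. lag_term (\<lambda>j l. if j = 0 then g l else 0) t j \<omega>"]
    by (simp add: lag_term_def)
  then show "AE \<omega> in M. (\<lambda>j. lag_term (\<lambda>j l. if j = 0 then g l else 0) t j \<omega>) sums
      (\<Sum>l<k. g l * e t l \<omega>)"
    by (simp add: lag_term_def)
qed

text \<open>The series \<open>(1 - z) d(z)\<close> has a zero at \<open>z = 1\<close>: differencing
  a process that is already linear in the noise leaves no long-run coefficient.\<close>

lemma total_diff_lag:
  assumes "linear_process d X" "l < k"
  shows "total (\<lambda>j l. d j l - lag_coeff 1 d j l) l = 0"
proof -
  have "(\<lambda>j. d j l) sums total d l" by (rule linear_process_sums_total[OF assms])
  moreover from this have "(\<lambda>j. lag_coeff 1 d j l) sums total d l"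
    by (simp only: lag_coeff_sums_iff)
  ultimately have "(\<lambda>j. d j l - lag_coeff 1 d j l) sums (total d l - total d l)"
    by (rule sums_diff)
  then show ?thesis unfolding total_def by (simp add: sums_iff)
qed

section \<open>Stationarity and the spectrum at frequency zero\<close>

lemma cov_mat_linear_process:
  assumes "linear_process d (\<lambda>t \<omega>. x t \<omega> $ i)" "linear_process d' (\<lambda>t \<omega>. x t \<omega> $ j)" "i < n" "j < n"
  shows "cov_mat M n (x t) (x s) $$ (i, j) = (\<integral>\<omega>. x t \<omega> $ i * x s \<omega> $ j \<partial>M)"
proof -
  have "(\<integral>\<omega>. x t \<omega> $ i \<partial>M) = 0" "(\<integral>\<omega>. x s \<omega> $ j \<partial>M) = 0"
    using assms by (auto intro: linear_process_mean)
  then show ?thesis using assms(3,4) by (simp add: cov_mat_def)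
qed

lemma stationary_linear_process:
  assumes x: "random_process M n x"
    and lp: "\<And>i. i < n \<Longrightarrow> linear_process (D i) (\<lambda>t \<omega>. x t \<omega> $ i)"
  shows "stationary M n x"
  unfolding stationary_def
proof (intro conjI allI impI)
  fix t i assume i: "i < n"
  show "integrable M (\<lambda>\<omega>. (x t \<omega> $ i)\<^sup>2)"
    using linear_process_second_moment(1)[OF lp[OF i] lp[OF i], of t t]
    by (simp add: power2_eq_square)
  show "(\<integral>\<omega>. x t \<omega> $ i \<partial>M) = (\<integral>\<omega>. x 0 \<omega> $ i \<partial>M)"
    using linear_process_mean[OF lp[OF i]] by simp
next
  fix t h
  show "cov_mat M n (x (t + h)) (x t) = cov_mat M n (x h) (x 0)"
  proof (rule eq_matI)
    fix i j assume "i < dim_row (cov_mat M n (x h) (x 0))" "j < dim_col (cov_mat M n (x h) (x 0))"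
    then have ij: "i < n" "j < n" by (auto simp: cov_mat_def)
    show "cov_mat M n (x (t + h)) (x t) $$ (i, j) = cov_mat M n (x h) (x 0) $$ (i, j)"
      unfolding cov_mat_linear_process[OF lp[OF ij(1)] lp[OF ij(2)] ij]
      by (rule linear_process_autocov_shift[OF lp[OF ij(1)] lp[OF ij(2)]])
  qed (auto simp: cov_mat_def)
qed (rule x)

text \<open>Rows are functions rather than rows of a matrix, so that they can be selected, shifted
  and mixed without rebuilding matrices. The columns are those of the \<open>k\<close> noise
  coordinates.\<close>

definition rows_independent :: "nat \<Rightarrow> (nat \<Rightarrow> nat \<Rightarrow> real) \<Rightarrow> bool" where
  "rows_independent n T \<longleftrightarrow> (\<forall>a. (\<forall>l<k. (\<Sum>i<n. a i * T i l) = 0) \<longrightarrow> (\<forall>i<n. a i = 0))"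

text \<open>\<open>G\<close> is the Gram matrix of the rows for the inner product
  \<open>quad\<close>. If \<open>v\<close> is in its kernel, the form
  \<open>v \<bullet> (G *\<^sub>v v)\<close> is \<open>quad w w\<close> for the combination
  \<open>w\<close> of rows with weights \<open>v\<close>; positivity of \<open>quad\<close> makes
  \<open>w\<close> zero, and independence makes \<open>v\<close> zero.\<close>

lemma gram_invertible:
  assumes indep: "rows_independent n T"
  shows "\<exists>B. inverse_pair n (mat n n (\<lambda>(i, j). quad (T i) (T j))) B"
proof -
  define G where "G = mat n n (\<lambda>(i, j). quad (T i) (T j))"
  have G: "G \<in> carrier_mat n n" by (simp add: G_def)
  have "det G \<noteq> 0"
  proof
    assume "det G = 0"
    then obtain v where v: "v \<in> carrier_vec n" "v \<noteq> 0\<^sub>v n" "G *\<^sub>v v = 0\<^sub>v n"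
      using det_0_iff_vec_prod_zero[OF G] by auto
    define w where "w l = (\<Sum>i<n. v $ i * T i l)" for l
    have "quad w w = (\<Sum>l<k. \<Sum>m<k. \<Sum>i<n. \<Sum>j<n. v $ i * (T i l * S l m * T j m) * v $ j)"
      unfolding quad_def w_def
      by (intro sum.cong refl) (simp add: sum_distrib_right sum_distrib_left mult_ac)
    also have "\<dots> = (\<Sum>l<k. \<Sum>i<n. \<Sum>j<n. \<Sum>m<k. v $ i * (T i l * S l m * T j m) * v $ j)"
      by (rule sum.cong[OF refl], subst sum.swap, rule sum.cong[OF refl], rule sum.swap)
    also have "\<dots> = (\<Sum>i<n. \<Sum>j<n. \<Sum>l<k. \<Sum>m<k. v $ i * (T i l * S l m * T j m) * v $ j)"
      by (subst sum.swap, rule sum.cong[OF refl], rule sum.swap)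
    also have "\<dots> = (\<Sum>i<n. \<Sum>j<n. v $ i * quad (T i) (T j) * v $ j)"
      by (simp add: quad_def sum_distrib_left sum_distrib_right)
    also have "\<dots> = (\<Sum>i<n. v $ i * (G *\<^sub>v v) $ i)"
      using v(1) by (intro sum.cong refl)
        (auto simp: G_def scalar_prod_def sum_distrib_left lessThan_atLeast0 mult.assoc intro!: sum.cong)
    also have "\<dots> = 0" using v by simp
    finally have "quad w w = 0" .
    then have "w l = 0" if "l < k" for l using quad_pos[OF that, of w] by auto
    then have "\<forall>l<k. (\<Sum>i<n. v $ i * T i l) = 0" by (intro allI impI) (simp only: w_def)
    then have "\<forall>i<n. v $ i = 0"
      by (rule mp[OF spec[OF indep[unfolded rows_independent_def], of "\<lambda>i. v $ i"]])
    then have "v = 0\<^sub>v n" using v(1) by (intro eq_vecI) auto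
    then show False using v(2) by simp
  qed
  then obtain B where "B \<in> carrier_mat n n" "G * B = 1\<^sub>m n"
    using det_non_zero_imp_unit[OF G, of "()"] by (auto simp: Units_def ring_mat_def)
  then have "inverse_pair n G B" using G by (intro inverse_pairI)
  then show ?thesis unfolding G_def by (rule exI)
qed

text \<open>At \<open>z = 1\<close> the spectral series is the sum of the autocovariances over all
  lags, so the spectrum is the Gram matrix of the rows of the transfer function at 1, divided by
  \<open>2 * pi\<close>. The complex inverse is the real one, embedded and rescaled.\<close>

lemma nonsingular_spectrum_linear_process:
  assumes lp: "\<And>i. i < n \<Longrightarrow> linear_process (D i) (\<lambda>t \<omega>. x t \<omega> $ i)"
    and indep: "rows_independent n (\<lambda>i. total (D i))"
  shows "nonsingular_spectrum_at M n x 1"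
proof -
  define G where "G = mat n n (\<lambda>(i, j). quad (total (D i)) (total (D j)))"
  have hs: "((\<lambda>h::int. complex_of_real (cov_mat M n (x h) (x 0) $$ (i, j)) * 1 powi h)
      has_sum complex_of_real (quad (total (D i)) (total (D j)))) UNIV" if ij: "i < n" "j < n" for i j
  proof -
    have "((\<lambda>h. cov_mat M n (x h) (x 0) $$ (i, j)) has_sum quad (total (D i)) (total (D j))) UNIV"
      unfolding cov_mat_linear_process[OF lp[OF ij(1)] lp[OF ij(2)] ij]
      by (rule linear_process_long_run_cov[OF lp[OF ij(1)] lp[OF ij(2)]])
    then show ?thesis by (simp add: has_sum_of_real)
  qed
  obtain B where B: "inverse_pair n G B"
    unfolding G_def using gram_invertible[OF indep] by blast
  define c where "c = 1 / (2 * complex_of_real pi)"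
  have spec: "spectrum M n x 1 = c \<cdot>\<^sub>m map_mat complex_of_real G"
    unfolding spectrum_def G_def c_def
    by (rule eq_matI) (auto simp: infsumI[OF hs] simp del: power_int_1_left)
  have gb: "G \<in> carrier_mat n n" "B \<in> carrier_mat n n" "G * B = 1\<^sub>m n" "B * G = 1\<^sub>m n"
    using B by (auto simp: inverse_pair_def)
  have hom: "map_mat complex_of_real P * map_mat complex_of_real Q = 1\<^sub>m n"
    if "P \<in> carrier_mat n n" "Q \<in> carrier_mat n n" "P * Q = 1\<^sub>m n" for P Q
  proof -
    have "map_mat complex_of_real P * map_mat complex_of_real Q = map_mat complex_of_real (P * Q)"
      using that(1,2) by (intro eq_matI) (auto simp: scalar_prod_def)
    also have "\<dots> = 1\<^sub>m n" unfolding that(3) by (intro eq_matI) auto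
    finally show ?thesis .
  qed
  let ?R = "(1 / c) \<cdot>\<^sub>m map_mat complex_of_real B"
  have c0: "c \<noteq> 0" by (simp add: c_def)
  have "spectrum M n x 1 * ?R = 1\<^sub>m n" "?R * spectrum M n x 1 = 1\<^sub>m n"
    unfolding spec using gb hom[OF gb(1,2,3)] hom[OF gb(2,1,4)] c0
    by (auto simp: mult_smult_assoc_mat[of _ n n _ n] mult_smult_distrib[of _ n n _ n] intro!: eq_matI)
  then have "invertible_mat (spectrum M n x 1)"
    unfolding invertible_mat_def inverts_mat_def using gb
    by (intro conjI exI[of _ ?R]) (auto simp: spec)
  then show ?thesis
    unfolding nonsingular_spectrum_at_def using hs by (auto simp: summable_on_def)
qed

section \<open>Stationary combinations of partially integrated coordinates\<close>

text \<open>Stationarity fixes the mean and the centred covariances, and the mean need not be zero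
  here. Together they fix the raw second moment, the quantity on which
  \<open>integrated_constant_variance_total_zero\<close> is based.\<close>

lemma stationary_second_moment_const:
  assumes "stationary M 1 (\<lambda>t \<omega>. vec 1 (\<lambda>_. X t \<omega>))"
  shows "X t \<in> borel_measurable M" "integrable M (\<lambda>\<omega>. (X t \<omega>)\<^sup>2)"
    "(\<integral>\<omega>. (X t \<omega>)\<^sup>2 \<partial>M) = (\<integral>\<omega>. (X 0 \<omega>)\<^sup>2 \<partial>M)"
proof -
  have m: "X t \<in> borel_measurable M" for t
    using assms unfolding stationary_def random_process_def random_vector_def by simp
  have i: "integrable M (\<lambda>\<omega>. (X t \<omega>)\<^sup>2)" for t
    using assms unfolding stationary_def by simp
  have mean: "(\<integral>\<omega>. X t \<omega> \<partial>M) = (\<integral>\<omega>. X 0 \<omega> \<partial>M)" for t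
    using assms unfolding stationary_def by simp
  have i1: "integrable M (X t)" for t
    using m i square_integrable_imp_integrable by blast
  define \<mu> where "\<mu> = (\<integral>\<omega>. X 0 \<omega> \<partial>M)"
  have "cov_mat M 1 (\<lambda>\<omega>. vec 1 (\<lambda>_. X (t + 0) \<omega>)) (\<lambda>\<omega>. vec 1 (\<lambda>_. X t \<omega>)) $$ (0, 0)
      = cov_mat M 1 (\<lambda>\<omega>. vec 1 (\<lambda>_. X 0 \<omega>)) (\<lambda>\<omega>. vec 1 (\<lambda>_. X 0 \<omega>)) $$ (0, 0)" for t
    using assms unfolding stationary_def by metis
  from this[of t] have c: "(\<integral>\<omega>. (X t \<omega> - \<mu>) * (X t \<omega> - \<mu>) \<partial>M) = (\<integral>\<omega>. (X 0 \<omega> - \<mu>) * (X 0 \<omega> - \<mu>) \<partial>M)"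
    using mean[of t] by (simp add: cov_mat_def \<mu>_def)
  have "(\<integral>\<omega>. (X t \<omega> - \<mu>) * (X t \<omega> - \<mu>) \<partial>M) = (\<integral>\<omega>. (X t \<omega>)\<^sup>2 \<partial>M) - \<mu>\<^sup>2" for t
  proof -
    have "(\<integral>\<omega>. (X t \<omega> - \<mu>) * (X t \<omega> - \<mu>) \<partial>M) = (\<integral>\<omega>. (X t \<omega>)\<^sup>2 - 2 * \<mu> * X t \<omega> + \<mu>\<^sup>2 \<partial>M)"
      by (intro Bochner_Integration.integral_cong refl) (simp add: power2_eq_square algebra_simps)
    also have "\<dots> = (\<integral>\<omega>. (X t \<omega>)\<^sup>2 \<partial>M) - 2 * \<mu> * (\<integral>\<omega>. X t \<omega> \<partial>M) + \<mu>\<^sup>2"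
      using i i1 by (simp add: prob_space)
    also have "\<dots> = (\<integral>\<omega>. (X t \<omega>)\<^sup>2 \<partial>M) - \<mu>\<^sup>2"
      using mean[of t] by (simp add: \<mu>_def power2_eq_square)
    finally show ?thesis .
  qed
  with c show "(\<integral>\<omega>. (X t \<omega>)\<^sup>2 \<partial>M) = (\<integral>\<omega>. (X 0 \<omega>)\<^sup>2 \<partial>M)" by simp
  show "X t \<in> borel_measurable M" "integrable M (\<lambda>\<omega>. (X t \<omega>)\<^sup>2)" by (rule m, rule i)
qed

text \<open>For p below c, G p belongs to the differences of coordinate p; for p from c on, to the coordinate itself.\<close>
definition partially_integrated ::
    "nat \<Rightarrow> nat \<Rightarrow> (nat \<Rightarrow> nat \<Rightarrow> nat \<Rightarrow> real) \<Rightarrow> (nat \<Rightarrow> int \<Rightarrow> 'w \<Rightarrow> real) \<Rightarrow> bool" where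
  "partially_integrated m c G Z \<longleftrightarrow> c \<le> m \<and>
     (\<forall>p<c. linear_process (G p) (\<lambda>t \<omega>. Z p t \<omega> - Z p (t - 1) \<omega>)) \<and>
     (\<forall>p. c \<le> p \<and> p < m \<longrightarrow> linear_process (G p) (Z p))"

text \<open>Coordinates that are already stationary are differenced as well. Then every coordinate
  has a linear difference, and the additional factor \<open>1 - z\<close> removes the stationary
  ones from the total.\<close>

definition diff_coeff :: "nat \<Rightarrow> (nat \<Rightarrow> nat \<Rightarrow> nat \<Rightarrow> real) \<Rightarrow> nat \<Rightarrow> nat \<Rightarrow> nat \<Rightarrow> real" where
  "diff_coeff c G p j l = (if p < c then G p j l else G p j l - lag_coeff 1 (G p) j l)"

lemma partially_integrated_diff:
  assumes "partially_integrated m c G Z" "p < m"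
  shows "linear_process (diff_coeff c G p) (\<lambda>t \<omega>. Z p t \<omega> - Z p (t - 1) \<omega>)"
    and "l < k \<Longrightarrow> total (diff_coeff c G p) l = (if p < c then total (G p) l else 0)"
proof -
  have eq: "diff_coeff c G p = (if p < c then G p else (\<lambda>j l. G p j l - lag_coeff 1 (G p) j l))"
    by (auto simp: diff_coeff_def fun_eq_iff)
  have Z: "linear_process (G p) (Z p)" if "\<not> p < c"
    using assms that by (simp add: partially_integrated_def)
  show "linear_process (diff_coeff c G p) (\<lambda>t \<omega>. Z p t \<omega> - Z p (t - 1) \<omega>)"
  proof (cases "p < c")
    case True
    then show ?thesis using assms by (simp add: eq partially_integrated_def)
  next
    case False
    then show ?thesis
      using linear_process_diff[OF Z[OF False] linear_process_lag[OF Z[OF False], of 1]] by (simp add: eq)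
  qed
  show "total (diff_coeff c G p) l = (if p < c then total (G p) l else 0)" if "l < k"
    unfolding eq using total_diff_lag[OF Z that] by auto
qed

lemma partially_integrated_combination_diff:
  assumes "partially_integrated m c G Z"
  shows "linear_process (\<lambda>j l. \<Sum>p<m. a p * diff_coeff c G p j l)
      (\<lambda>t \<omega>. \<Sum>p<m. a p * (Z p t \<omega> - Z p (t - 1) \<omega>))"
    and "l < k \<Longrightarrow> total (\<lambda>j l. \<Sum>p<m. a p * diff_coeff c G p j l) l = (\<Sum>p<c. a p * total (G p) l)"
proof -
  show "linear_process (\<lambda>j l. \<Sum>p<m. a p * diff_coeff c G p j l)
      (\<lambda>t \<omega>. \<Sum>p<m. a p * (Z p t \<omega> - Z p (t - 1) \<omega>))"
    by (rule linear_process_combination) (use partially_integrated_diff(1)[OF assms] in auto)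
  assume l: "l < k"
  have "total (\<lambda>j l. \<Sum>p<m. a p * diff_coeff c G p j l) l = (\<Sum>p<m. a p * total (diff_coeff c G p) l)"
    by (rule total_combination[OF _ partially_integrated_diff(1)[OF assms] l]) auto
  also have "\<dots> = (\<Sum>p<m. a p * (if p < c then total (G p) l else 0))"
    using partially_integrated_diff(2)[OF assms _ l] by (intro sum.cong) auto
  also have "\<dots> = (\<Sum>p<c. a p * total (G p) l)"
    using assms by (intro sum.mono_neutral_cong_right) (auto simp: partially_integrated_def)
  finally show "total (\<lambda>j l. \<Sum>p<m. a p * diff_coeff c G p j l) l = (\<Sum>p<c. a p * total (G p) l)" .
qed

text \<open>The noise term accommodates the disturbance of \<open>y\<close>. It is itself a linear
  process, so it preserves stationarity in one direction; in the other its difference has total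
  zero, and the total of the differenced \<open>X\<close> is the combination of the rows of the
  integrated coordinates alone.\<close>

lemma stationary_combination_iff:
  assumes Z: "partially_integrated m c G Z"
    and indep: "rows_independent c (\<lambda>p. total (G p))"
    and X: "\<And>t. X t \<in> borel_measurable M"
    and eq: "\<And>t. AE \<omega> in M. X t \<omega> = (\<Sum>p<m. a p * Z p t \<omega>) + (\<Sum>l<k. g l * e t l \<omega>)"
  shows "stationary M 1 (\<lambda>t \<omega>. vec 1 (\<lambda>_. X t \<omega>)) \<longleftrightarrow> (\<forall>p<c. a p = 0)"
proof
  assume 0: "\<forall>p<c. a p = 0"
  have 1: "linear_process (\<lambda>j l. \<Sum>p\<in>{c..<m}. a p * G p j l) (\<lambda>t \<omega>. \<Sum>p\<in>{c..<m}. a p * Z p t \<omega>)"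
    by (rule linear_process_combination) (use Z in \<open>auto simp: partially_integrated_def\<close>)
  have "(\<Sum>p\<in>{c..<m}. a p * Z p t \<omega>) = (\<Sum>p<m. a p * Z p t \<omega>)" for t \<omega>
    using 0 by (intro sum.mono_neutral_left) auto
  then have "AE \<omega> in M. X t \<omega> = (\<Sum>p\<in>{c..<m}. a p * Z p t \<omega>) + (\<Sum>l<k. g l * e t l \<omega>)" for t
    using eq[of t] by simp
  from linear_process_cong[OF linear_process_add[OF 1 linear_process_noise] X this]
  have lp: "linear_process (\<lambda>j l. (\<Sum>p\<in>{c..<m}. a p * G p j l) + (if j = 0 then g l else 0)) X" .
  show "stationary M 1 (\<lambda>t \<omega>. vec 1 (\<lambda>_. X t \<omega>))"
  proof (rule stationary_linear_process)
    show "random_process M 1 (\<lambda>t \<omega>. vec 1 (\<lambda>_. X t \<omega>))"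
      using X by (auto simp: random_process_def random_vector_def)
    show "linear_process (\<lambda>j l. (\<Sum>p\<in>{c..<m}. a p * G p j l) + (if j = 0 then g l else 0))
        (\<lambda>t \<omega>. vec 1 (\<lambda>_. X t \<omega>) $ i)" if "i < 1" for i :: nat
      using lp that by simp
  qed
next
  assume st: "stationary M 1 (\<lambda>t \<omega>. vec 1 (\<lambda>_. X t \<omega>))"
  let ?n = "\<lambda>j l. if j = 0 then g l else 0" and ?N = "\<lambda>t \<omega>. \<Sum>l<k. g l * e t l \<omega>"
  let ?d = "\<lambda>j l. \<Sum>p<m. a p * diff_coeff c G p j l"
  have N: "linear_process (\<lambda>j l. ?n j l - lag_coeff 1 ?n j l) (\<lambda>t \<omega>. ?N t \<omega> - ?N (t - 1) \<omega>)"
    using linear_process_diff[OF linear_process_noise linear_process_lag[OF linear_process_noise, of 1]] by simp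
  have lp: "linear_process (\<lambda>j l. ?d j l + (?n j l - lag_coeff 1 ?n j l))
    (\<lambda>t \<omega>. (\<Sum>p<m. a p * (Z p t \<omega> - Z p (t - 1) \<omega>)) + (?N t \<omega> - ?N (t - 1) \<omega>))"
    by (rule linear_process_add[OF partially_integrated_combination_diff(1)[OF Z] N])
  have diff: "AE \<omega> in M. X t \<omega> - X (t - 1) \<omega> =
      (\<Sum>p<m. a p * (Z p t \<omega> - Z p (t - 1) \<omega>)) + (?N t \<omega> - ?N (t - 1) \<omega>)" for t
    using eq[of t] eq[of "t - 1"]
    by eventually_elim (simp add: sum_subtractf right_diff_distrib)
  have "(\<Sum>p<c. a p * total (G p) l) = 0" if l: "l < k" for l
  proof -
    have "total (\<lambda>j l. ?d j l + (?n j l - lag_coeff 1 ?n j l)) l = 0"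
      by (rule integrated_constant_variance_total_zero[OF lp stationary_second_moment_const(1)[OF st]
            stationary_second_moment_const(2)[OF st] stationary_second_moment_const(3)[OF st] diff l])
    moreover have "(\<lambda>j. ?d j l + (?n j l - lag_coeff 1 ?n j l)) sums
        (total ?d l + total (\<lambda>j l. ?n j l - lag_coeff 1 ?n j l) l)"
      by (rule sums_add[OF linear_process_sums_total[OF partially_integrated_combination_diff(1)[OF Z] l]
            linear_process_sums_total[OF N l]])
    ultimately have "total ?d l + total (\<lambda>j l. ?n j l - lag_coeff 1 ?n j l) l = 0"
      by (simp add: total_def sums_iff)
    then show ?thesis
      using partially_integrated_combination_diff(2)[OF Z l, of a] total_diff_lag[OF linear_process_noise l, of g]
      by simp
  qed
  then have "\<forall>l<k. (\<Sum>p<c. a p * total (G p) l) = 0" by (intro allI impI)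
  then show "\<forall>p<c. a p = 0"
    by (rule mp[OF spec[OF indep[unfolded rows_independent_def], of a]])
qed

end

section \<open>Vector processes and cointegrating spaces\<close>

lemma random_process_mult_mat_vec:
  assumes x: "random_process M n x" and A: "A \<in> carrier_mat m n"
  shows "random_process M m (\<lambda>t \<omega>. A *\<^sub>v x t \<omega>)"
  unfolding random_process_def random_vector_def
proof (intro allI conjI ballI impI)
  fix t
  have xc: "x t \<omega> \<in> carrier_vec n" if "\<omega> \<in> space M" for \<omega>
    using x that by (simp add: random_process_def random_vector_def)
  have xm: "(\<lambda>\<omega>. x t \<omega> $ j) \<in> borel_measurable M" if "j < n" for j
    using x that by (simp add: random_process_def random_vector_def)
  show "A *\<^sub>v x t \<omega> \<in> carrier_vec m" if "\<omega> \<in> space M" for \<omega>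
    using xc[OF that] A by simp
  fix i assume i: "i < m"
  have "(\<lambda>\<omega>. \<Sum>j<n. A $$ (i, j) * x t \<omega> $ j) \<in> borel_measurable M"
    using xm by (intro borel_measurable_sum borel_measurable_times) auto
  \<comment> \<open>The entry of the product agrees with this sum only where the vector has
    dimension \<open>n\<close>, which is known on \<open>space M\<close>; hence the passage through
    \<open>measurable_cong\<close>.\<close>
  then show "(\<lambda>\<omega>. (A *\<^sub>v x t \<omega>) $ i) \<in> borel_measurable M"
    by (rule measurable_cong[THEN iffD1, rotated])
      (use A i carrier_vecD[OF xc] in \<open>auto simp: scalar_prod_def lessThan_atLeast0 intro!: sum.cong\<close>)
qed

lemma random_process_minus:
  assumes "random_process M n x" "random_process M n y"
  shows "random_process M n (\<lambda>t \<omega>. x t \<omega> - y t \<omega>)"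
  unfolding random_process_def random_vector_def
proof (intro allI conjI ballI impI)
  fix t
  have c: "x t \<omega> \<in> carrier_vec n" "y t \<omega> \<in> carrier_vec n" if "\<omega> \<in> space M" for \<omega>
    using assms that by (simp_all add: random_process_def random_vector_def)
  then show "x t \<omega> - y t \<omega> \<in> carrier_vec n" if "\<omega> \<in> space M" for \<omega>
    using that by simp
  fix i assume i: "i < n"
  have "(\<lambda>\<omega>. x t \<omega> $ i - y t \<omega> $ i) \<in> borel_measurable M"
    using assms i by (intro borel_measurable_diff) (auto simp: random_process_def random_vector_def)
  then show "(\<lambda>\<omega>. (x t \<omega> - y t \<omega>) $ i) \<in> borel_measurable M"
    by (rule measurable_cong[THEN iffD1, rotated])
      (use i carrier_vecD[OF c(1)] carrier_vecD[OF c(2)] in simp)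
qed

lemma random_process_subvec:
  assumes "random_process M n x" "i + l \<le> n"
  shows "random_process M l (\<lambda>t \<omega>. subvec i l (x t \<omega>))"
  using assms by (auto simp: random_process_def random_vector_def subvec_def)

lemma random_process_diff:
  assumes "random_process M n x"
  shows "random_process M n (diff_proc x)"
proof -
  have "random_process M n (\<lambda>t. x (t - 1))" using assms by (simp add: random_process_def)
  from random_process_minus[OF assms this] show ?thesis by (simp add: diff_proc_def[abs_def])
qed

lemma random_process_append:
  assumes "random_process M n x" "random_process M m y"
  shows "random_process M (n + m) (\<lambda>t \<omega>. x t \<omega> @\<^sub>v y t \<omega>)"
  unfolding random_process_def random_vector_def
proof (intro allI conjI ballI impI)
  fix t
  have c: "x t \<omega> \<in> carrier_vec n" "y t \<omega> \<in> carrier_vec m" if "\<omega> \<in> space M" for \<omega>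
    using assms that by (simp_all add: random_process_def random_vector_def)
  then show "x t \<omega> @\<^sub>v y t \<omega> \<in> carrier_vec (n + m)" if "\<omega> \<in> space M" for \<omega>
    using that by simp
  fix i assume i: "i < n + m"
  have "(\<lambda>\<omega>. if i < n then x t \<omega> $ i else y t \<omega> $ (i - n)) \<in> borel_measurable M"
    using assms i by (cases "i < n") (auto simp: random_process_def random_vector_def)
  then show "(\<lambda>\<omega>. (x t \<omega> @\<^sub>v y t \<omega>) $ i) \<in> borel_measurable M"
    by (rule measurable_cong[THEN iffD1, rotated])
      (use i carrier_vecD[OF c(1)] carrier_vecD[OF c(2)] in simp)
qed

lemma mat_norm_ge_entry:
  assumes "i < dim_row A" "l < dim_col A"
  shows "\<bar>A $$ (i, l)\<bar> \<le> mat_norm A"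
proof -
  have "(A $$ (i, l))\<^sup>2 \<le> (\<Sum>j<dim_col A. (A $$ (i, j))\<^sup>2)"
    using assms by (intro member_le_sum) auto
  also have "\<dots> \<le> (\<Sum>i<dim_row A. \<Sum>j<dim_col A. (A $$ (i, j))\<^sup>2)"
    using assms by (intro member_le_sum) (auto intro!: sum_nonneg)
  finally have "sqrt ((A $$ (i, l))\<^sup>2) \<le> mat_norm A"
    unfolding mat_norm_def by (rule real_sqrt_le_mono)
  then show ?thesis by simp
qed

lemma mat_norm_le_sum: "mat_norm A \<le> (\<Sum>i<dim_row A. \<Sum>j<dim_col A. \<bar>A $$ (i, j)\<bar>)"
proof -
  have "mat_norm A = L2_set (\<lambda>p. \<bar>A $$ p\<bar>) ({..<dim_row A} \<times> {..<dim_col A})"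
    by (simp add: mat_norm_def L2_set_def sum.cartesian_product)
  also have "\<dots> \<le> (\<Sum>p\<in>{..<dim_row A} \<times> {..<dim_col A}. \<bar>A $$ p\<bar>)"
    by (rule L2_set_le_sum) auto
  finally show ?thesis by (simp add: sum.cartesian_product)
qed

lemma summable_entry:
  assumes "\<And>j. C j \<in> carrier_mat r k" "summable (\<lambda>j. mat_norm (C j))" "i < r" "l < k"
  shows "summable (\<lambda>j. \<bar>C j $$ (i, l)\<bar>)"
  by (rule summable_comparison_test'[OF assms(2), of 0])
    (use assms(3,4) carrier_matD[OF assms(1)] in \<open>auto intro!: mat_norm_ge_entry\<close>)

lemma summable_mat_norm:
  assumes C: "\<And>j. C j \<in> carrier_mat r k"
    and s: "\<And>i l. i < r \<Longrightarrow> l < k \<Longrightarrow> summable (\<lambda>j. \<bar>C j $$ (i, l)\<bar>)"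
  shows "summable (\<lambda>j. mat_norm (C j))"
proof (rule summable_comparison_test'[where N = 0])
  show "summable (\<lambda>j. \<Sum>i<r. \<Sum>l<k. \<bar>C j $$ (i, l)\<bar>)"
    by (intro summable_sum s) auto
  show "norm (mat_norm (C j)) \<le> (\<Sum>i<r. \<Sum>l<k. \<bar>C j $$ (i, l)\<bar>)" for j
    using mat_norm_le_sum[of "C j"] carrier_matD[OF C[of j]]
    by (simp add: mat_norm_def sum_nonneg)
qed

lemma summable_mat_norm_of_weighted:
  assumes "summable (\<lambda>j. real j powr a * mat_norm (C j))" "a > 0"
  shows "summable (\<lambda>j. mat_norm (C j))"
proof (rule summable_comparison_test'[OF assms(1), of 1])
  \<comment> \<open>The comparison begins at \<open>j = 1\<close>, since the weight
    \<open>0 powr a\<close> is 0 and gives no control over the first coefficient.\<close>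
  fix j :: nat assume "1 \<le> j"
  then have "1 \<le> real j powr a" using assms(2) by (intro ge_one_powr_ge_zero) auto
  moreover have "mat_norm (C j) \<ge> 0" by (simp add: mat_norm_def sum_nonneg)
  ultimately have "1 * mat_norm (C j) \<le> real j powr a * mat_norm (C j)" by (intro mult_right_mono)
  then show "norm (mat_norm (C j)) \<le> real j powr a * mat_norm (C j)"
    using \<open>mat_norm (C j) \<ge> 0\<close> by simp
qed

lemma transfer_fun_1:
  "i < r \<Longrightarrow> l < k \<Longrightarrow> transfer_fun r k C 1 $$ (i, l) = (\<Sum>j. C j $$ (i, l))"
  by (simp add: transfer_fun_def)

section \<open>The iid innovations as vector white noise\<close>

locale vector_noise = white_noise M k "\<lambda>t l \<omega>. eps t \<omega> $ l" S
  for M :: "'w measure" and k and eps :: "int \<Rightarrow> 'w \<Rightarrow> real vec" and S +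
  assumes eps_process: "random_process M k eps"

text \<open>Independence together with zero means yields vanishing covariances between different
  times, the inverse of \<open>Sig\<close> yields the trivial left kernel, and fourth moments
  control the squares through \<open>x^2 <= 1 + x^4\<close>.\<close>

lemma iid_vector_noise:
  assumes "prob_space M" and iid: "iid_process M k eps"
    and mean: "\<And>t i. i < k \<Longrightarrow> (\<integral>\<omega>. eps t \<omega> $ i \<partial>M) = 0"
    and cov: "\<And>t. cov_mat M k (eps t) (eps t) = Sig" and inv: "invertible_mat Sig"
    and fourth: "\<And>t i. i < k \<Longrightarrow> integrable M (\<lambda>\<omega>. (eps t \<omega> $ i) ^ 4)"
  shows "vector_noise M k eps (\<lambda>l m. Sig $$ (l, m))"
proof -
  interpret prob_space M by fact
  have rp: "random_process M k eps" using iid by (simp add: iid_process_def Let_def)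
  have meas [measurable]: "(\<lambda>\<omega>. eps t \<omega> $ l) \<in> borel_measurable M" if "l < k" for t l
    using rp that by (simp add: random_process_def random_vector_def)
  have square: "integrable M (\<lambda>\<omega>. (eps t \<omega> $ l)\<^sup>2)" if l: "l < k" for t l
  proof (rule Bochner_Integration.integrable_bound)
    show "integrable M (\<lambda>\<omega>. 1 + (eps t \<omega> $ l) ^ 4)" using fourth[OF l] by simp
    show "(\<lambda>\<omega>. (eps t \<omega> $ l)\<^sup>2) \<in> borel_measurable M" using l by measurable
    have "x\<^sup>2 \<le> 1 + x ^ 4" for x :: real
    proof -
      have "x ^ 4 = (x\<^sup>2)\<^sup>2" by (simp add: power4_eq_xxxx power2_eq_square)
      then have "2 * x\<^sup>2 \<le> x ^ 4 + 1" using sum_squares_bound[of "x\<^sup>2" 1] by simp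
      then show ?thesis using zero_le_power2[of x] by linarith
    qed
    then show "AE \<omega> in M. norm ((eps t \<omega> $ l)\<^sup>2) \<le> norm (1 + (eps t \<omega> $ l) ^ 4)" by simp
  qed
  have int: "integrable M (\<lambda>\<omega>. eps t \<omega> $ l)" if "l < k" for t l
    using square_integrable_imp_integrable[OF meas[OF that] square[OF that]] .
  have same: "(\<integral>\<omega>. eps t \<omega> $ l * eps t \<omega> $ m \<partial>M) = Sig $$ (l, m)" if "l < k" "m < k" for t l m
    using that by (subst cov[of t, symmetric]) (simp add: cov_mat_def mean)
  have diff: "(\<integral>\<omega>. eps t \<omega> $ l * eps s \<omega> $ m \<partial>M) = 0" if lm: "l < k" "m < k" and ts: "t \<noteq> s" for t s l m
  proof -
    define B where "B = PiM {..<k} (\<lambda>_. borel :: real measure)"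
    define X where "X = (\<lambda>t \<omega>. \<lambda>i\<in>{..<k}. eps t \<omega> $ i)"
    \<comment> \<open>Selecting coordinate l at time t and m elsewhere reduces to a family of real variables.\<close>
    define f where "f r = (if r = t then l else m)" for r :: int
    have f: "f r < k" for r using lm by (simp add: f_def)
    have "indep_vars (\<lambda>_. B) X UNIV"
      using iid by (simp add: iid_process_def Let_def B_def X_def)
    then have "indep_vars (\<lambda>_. borel) (\<lambda>r \<omega>. X r \<omega> (f r)) UNIV"
      by (rule indep_vars_compose2) (use f in \<open>simp add: B_def\<close>)
    then have "indep_vars (\<lambda>_. borel) (\<lambda>r \<omega>. eps r \<omega> $ f r) UNIV"
      using f by (simp add: X_def)
    then have "indep_vars (\<lambda>_. borel) (\<lambda>r \<omega>. eps r \<omega> $ f r) {t, s}"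
      by (rule indep_vars_subset) simp
    then have "(\<integral>\<omega>. (\<Prod>r\<in>{t, s}. eps r \<omega> $ f r) \<partial>M) = (\<Prod>r\<in>{t, s}. \<integral>\<omega>. eps r \<omega> $ f r \<partial>M)"
      by (rule indep_vars_lebesgue_integral[rotated]) (use f int in auto)
    then show ?thesis using ts lm by (simp add: f_def mean)
  qed
  have "Sig \<in> carrier_mat k k" by (subst cov[of 0, symmetric]) (simp add: cov_mat_def)
  then obtain Inv where Inv: "inverse_pair k Sig Inv"
    using invertible_inverse_pair[OF inv] by blast
  show ?thesis
  proof (unfold_locales)
    fix x l assume 0: "\<And>m. m < k \<Longrightarrow> (\<Sum>l<k. x l * Sig $$ (l, m)) = 0" and l: "l < k"
    have c: "Sig \<in> carrier_mat k k" "Inv \<in> carrier_mat k k" "Sig * Inv = 1\<^sub>m k"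
      using Inv by (auto simp: inverse_pair_def)
    \<comment> \<open>Entry \<open>l\<close> of the row identity \<open>x = (x * Sig) * Inv\<close>,
      in which the bracket is zero by assumption.\<close>
    have "x l = (\<Sum>i<k. x i * (Sig * Inv) $$ (i, l))"
      using l by (simp add: c(3) if_distrib[of "\<lambda>y. _ * y"] cong: if_cong)
    also have "\<dots> = (\<Sum>i<k. \<Sum>m<k. x i * (Sig $$ (i, m) * Inv $$ (m, l)))"
      using l c(1,2) by (intro sum.cong) (auto simp: scalar_prod_def lessThan_atLeast0 sum_distrib_left)
    also have "\<dots> = (\<Sum>m<k. (\<Sum>i<k. x i * Sig $$ (i, m)) * Inv $$ (m, l))"
      by (subst sum.swap) (simp add: sum_distrib_right mult.assoc)
    also have "\<dots> = 0" using 0 by simp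
    finally show "x l = 0" .
  qed (use meas square mean same diff rp in auto)
qed

text \<open>Weights on the selected rows are extended by zero to all rows. In this way the full row
  rank of \<open>c(1)\<close> passes to the integrated rows, to the stationary rows, and to each of
  the two groups of regressors.\<close>

lemma (in white_noise) rows_independent_reindex:
  assumes "rows_independent N T" "inj_on f {..<n}" "f ` {..<n} \<subseteq> {..<N}"
  shows "rows_independent n (\<lambda>i. T (f i))"
  unfolding rows_independent_def
proof (intro allI impI)
  fix a i assume 0: "\<forall>l<k. (\<Sum>i<n. a i * T (f i) l) = 0" and i: "i < n"
  define b where "b p = (if p \<in> f ` {..<n} then a (the_inv_into {..<n} f p) else 0)" for p
  have bf: "b (f i) = a i" if "i < n" for i
    using that assms(2) by (simp add: b_def the_inv_into_f_f)
  have "(\<Sum>p<N. b p * T p l) = (\<Sum>i<n. a i * T (f i) l)" for l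
  proof -
    have "(\<Sum>p<N. b p * T p l) = (\<Sum>p\<in>f ` {..<n}. b p * T p l)"
      using assms(3) by (intro sum.mono_neutral_right) (auto simp: b_def)
    also have "\<dots> = (\<Sum>i<n. b (f i) * T (f i) l)"
      using assms(2) by (subst sum.reindex) (auto simp: o_def)
    also have "\<dots> = (\<Sum>i<n. a i * T (f i) l)" by (intro sum.cong) (auto simp: bf)
    finally show ?thesis .
  qed
  then have "\<forall>l<k. (\<Sum>p<N. b p * T p l) = 0" using 0 by simp
  then have "\<forall>p<N. b p = 0"
    by (rule mp[OF spec[OF assms(1)[unfolded rows_independent_def], of b]])
  moreover have "f i < N" using assms(3) i by auto
  ultimately show "a i = 0" using bf[OF i] by simp
qed

section \<open>Matrix transfer functions and cointegrating ranks\<close>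

context vector_noise
begin

lemma AE_eps_carrier: "AE \<omega> in M. eps t \<omega> \<in> carrier_vec k"
  using eps_process by (auto simp: random_process_def random_vector_def)

lemma lag_term_mult_mat_vec:
  assumes "A \<in> carrier_mat r k" "i < r" "eps (t - int j) \<omega> \<in> carrier_vec k" "C j = A"
  shows "lag_term (\<lambda>j l. C j $$ (i, l)) t j \<omega> = (C j *\<^sub>v eps (t - int j) \<omega>) $ i"
  using assms by (auto simp: lag_term_def scalar_prod_def lessThan_atLeast0 intro!: sum.cong)

lemma is_filtered_linear_process:
  assumes "is_filtered M r C eps x" "random_process M r x" and C: "\<And>j. C j \<in> carrier_mat r k"
    and s: "summable (\<lambda>j. mat_norm (C j))" and i: "i < r"
  shows "linear_process (\<lambda>j l. C j $$ (i, l)) (\<lambda>t \<omega>. x t \<omega> $ i)"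
  unfolding linear_process_def
proof (intro conjI allI impI)
  show "summable (\<lambda>j. \<bar>C j $$ (i, l)\<bar>)" if "l < k" for l
    by (rule summable_entry[OF C s i that])
  fix t
  show "(\<lambda>\<omega>. x t \<omega> $ i) \<in> borel_measurable M"
    using assms(2) i by (simp add: random_process_def random_vector_def)
  have "AE \<omega> in M. \<forall>j. eps (t - int j) \<omega> \<in> carrier_vec k"
    by (subst AE_all_countable) (intro allI AE_eps_carrier)
  moreover have "AE \<omega> in M. x t \<omega> \<in> carrier_vec r \<and>
      (\<forall>i<r. (\<lambda>j. (C j *\<^sub>v eps (t - int j) \<omega>) $ i) sums (x t \<omega> $ i))"
    using assms(1) by (simp add: is_filtered_def)
  ultimately show "AE \<omega> in M. (\<lambda>j. lag_term (\<lambda>j l. C j $$ (i, l)) t j \<omega>) sums x t \<omega> $ i"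
  proof eventually_elim
    case (elim \<omega>)
    have "lag_term (\<lambda>j l. C j $$ (i, l)) t j \<omega> = (C j *\<^sub>v eps (t - int j) \<omega>) $ i" for j
      using elim by (intro lag_term_mult_mat_vec[OF C i]) auto
    then show ?case using elim i by simp
  qed
qed

lemma linear_process_is_filtered:
  assumes x: "random_process M r x"
    and lp: "\<And>i. i < r \<Longrightarrow> linear_process (D i) (\<lambda>t \<omega>. x t \<omega> $ i)"
  defines "C \<equiv> \<lambda>j. mat r k (\<lambda>(i, l). D i j l)"
  shows "is_filtered M r C eps x" "summable (\<lambda>j. mat_norm (C j))"
proof -
  have C: "C j \<in> carrier_mat r k" for j by (simp add: C_def)
  show "is_filtered M r C eps x"
    unfolding is_filtered_def
  proof
    fix t
    have 1: "AE \<omega> in M. \<forall>j. eps (t - int j) \<omega> \<in> carrier_vec k"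
      by (subst AE_all_countable) (intro allI AE_eps_carrier)
    have 2: "AE \<omega> in M. \<forall>i\<in>{..<r}. (\<lambda>j. lag_term (D i) t j \<omega>) sums (x t \<omega> $ i)"
      using lp by (intro AE_finite_allI) (auto simp: linear_process_def)
    have 3: "AE \<omega> in M. x t \<omega> \<in> carrier_vec r"
      using x by (auto simp: random_process_def random_vector_def)
    from 1 2 3 show "AE \<omega> in M. x t \<omega> \<in> carrier_vec r \<and>
        (\<forall>i<r. (\<lambda>j. (C j *\<^sub>v eps (t - int j) \<omega>) $ i) sums (x t \<omega> $ i))"
    proof eventually_elim
      case (elim \<omega>)
      have "(C j *\<^sub>v eps (t - int j) \<omega>) $ i = lag_term (D i) t j \<omega>" if "i < r" for i j
      proof -
        have "(C j *\<^sub>v eps (t - int j) \<omega>) $ i = lag_term (\<lambda>j l. C j $$ (i, l)) t j \<omega>"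
          using elim that by (intro lag_term_mult_mat_vec[OF C, symmetric]) auto
        also have "\<dots> = lag_term (D i) t j \<omega>"
          using that unfolding lag_term_def by (intro sum.cong) (auto simp: C_def)
        finally show ?thesis .
      qed
      then show ?case using elim by auto
    qed
  qed
  show "summable (\<lambda>j. mat_norm (C j))"
    by (rule summable_mat_norm[OF C]) (use lp in \<open>auto simp: C_def linear_process_def\<close>)
qed

text \<open>The combination of \<open>x\<close> with weights \<beta> puts the weights
  \<open>B\<^sup>T *\<^sub>v \<beta>\<close> on the coordinates of \<open>z\<close>, and only those
  on the first \<open>c\<close> coordinates decide about stationarity. So the cointegrating space is
  the left kernel of \<open>A\<close>, the first \<open>c\<close> columns of \<open>B\<close>. The
  noise matrix \<open>N\<close> allows one statement to serve both \<open>zr\<close> and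
  \<open>y - b_u zu\<close>.\<close>

lemma cointegrating_rank_partially_integrated:
  assumes Z: "partially_integrated m c G (\<lambda>p t \<omega>. z t \<omega> $ p)"
    and indep: "rows_independent c (\<lambda>p. total (G p))"
    and z: "random_process M m z" and x: "random_process M n x"
    and B: "B \<in> carrier_mat n m" and N: "N \<in> carrier_mat n k" and A: "A \<in> carrier_mat n c"
    and AB: "\<And>i p. i < n \<Longrightarrow> p < c \<Longrightarrow> A $$ (i, p) = B $$ (i, p)"
    and eq: "\<And>t. AE \<omega> in M. x t \<omega> = B *\<^sub>v z t \<omega> + N *\<^sub>v eps t \<omega>"
  shows "cointegrating_rank M n x = n - mat_rank A"
proof -
  have "stationary M 1 (\<lambda>t \<omega>. vec 1 (\<lambda>_. \<beta> \<bullet> x t \<omega>)) \<longleftrightarrow> A\<^sup>T *\<^sub>v \<beta> = 0\<^sub>v c"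
    if \<beta>: "\<beta> \<in> carrier_vec n" for \<beta>
  proof -
    define a where "a p = (\<Sum>i<n. \<beta> $ i * B $$ (i, p))" for p
    define g where "g l = (\<Sum>i<n. \<beta> $ i * N $$ (i, l))" for l
    have xc: "x t \<omega> \<in> carrier_vec n" if "\<omega> \<in> space M" for t \<omega>
      using x that by (simp add: random_process_def random_vector_def)
    have dot: "\<beta> \<bullet> v = (\<Sum>i<n. \<beta> $ i * v $ i)" if "v \<in> carrier_vec n" for v
      using that by (auto simp: scalar_prod_def lessThan_atLeast0)
    have m: "(\<lambda>\<omega>. \<beta> \<bullet> x t \<omega>) \<in> borel_measurable M" for t
    proof -
      have "(\<lambda>\<omega>. \<Sum>i<n. \<beta> $ i * x t \<omega> $ i) \<in> borel_measurable M"
        using x by (intro borel_measurable_sum borel_measurable_times)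
          (auto simp: random_process_def random_vector_def)
      then show ?thesis
        by (rule measurable_cong[THEN iffD1, rotated]) (use xc dot in auto)
    qed
    have "AE \<omega> in M. \<beta> \<bullet> x t \<omega> = (\<Sum>p<m. a p * z t \<omega> $ p) + (\<Sum>l<k. g l * eps t \<omega> $ l)" for t
    proof -
      have "AE \<omega> in M. z t \<omega> \<in> carrier_vec m"
        using z by (auto simp: random_process_def random_vector_def)
      then show ?thesis using eq[of t] AE_eps_carrier[of t]
      proof eventually_elim
        case (elim \<omega>)
        have 1: "(B *\<^sub>v z t \<omega>) $ i = (\<Sum>p<m. B $$ (i, p) * z t \<omega> $ p)"
          "(N *\<^sub>v eps t \<omega>) $ i = (\<Sum>l<k. N $$ (i, l) * eps t \<omega> $ l)" if "i < n" for i
          using elim that B N by (auto simp: scalar_prod_def lessThan_atLeast0 intro!: sum.cong)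
        have "\<beta> \<bullet> x t \<omega> = (\<Sum>i<n. \<beta> $ i * (B *\<^sub>v z t \<omega> + N *\<^sub>v eps t \<omega>) $ i)"
          using elim B N by (subst dot) auto
        also have "\<dots> = (\<Sum>i<n. \<beta> $ i * ((\<Sum>p<m. B $$ (i, p) * z t \<omega> $ p) +
            (\<Sum>l<k. N $$ (i, l) * eps t \<omega> $ l)))"
          using B N 1 by (intro sum.cong) (auto simp del: index_mult_mat_vec)
        also have "\<dots> = (\<Sum>i<n. \<Sum>p<m. \<beta> $ i * B $$ (i, p) * z t \<omega> $ p) +
            (\<Sum>i<n. \<Sum>l<k. \<beta> $ i * N $$ (i, l) * eps t \<omega> $ l)"
          by (simp add: distrib_left sum.distrib sum_distrib_left mult.assoc)
        also have "\<dots> = (\<Sum>p<m. a p * z t \<omega> $ p) + (\<Sum>l<k. g l * eps t \<omega> $ l)"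
          unfolding a_def g_def sum_distrib_right by (intro arg_cong2[where f = "(+)"] sum.swap)
        finally show ?case .
      qed
    qed
    from stationary_combination_iff[OF Z indep m this]
    have "stationary M 1 (\<lambda>t \<omega>. vec 1 (\<lambda>_. \<beta> \<bullet> x t \<omega>)) \<longleftrightarrow> (\<forall>p<c. a p = 0)" .
    also have "\<dots> \<longleftrightarrow> A\<^sup>T *\<^sub>v \<beta> = 0\<^sub>v c"
    proof -
      have "(A\<^sup>T *\<^sub>v \<beta>) $ p = a p" if "p < c" for p
        using that A \<beta> AB by (auto simp: scalar_prod_def a_def lessThan_atLeast0 mult.commute intro!: sum.cong)
      then show ?thesis using A
        by (auto simp: vec_eq_iff simp del: index_mult_mat_vec)
    qed
    finally show ?thesis .
  qed
  then have "cointegrating_space M n x = {\<beta> \<in> carrier_vec n. A\<^sup>T *\<^sub>v \<beta> = 0\<^sub>v c}"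
    unfolding cointegrating_space_def by blast
  then show ?thesis
    unfolding cointegrating_rank_def using dim_transpose_kernel[OF A] by simp
qed

end

section \<open>The normal form of the coefficient matrix\<close>

lemma append_cols_carrier:
  assumes "A \<in> carrier_mat n p" "B \<in> carrier_mat n q"
  shows "A @\<^sub>c B \<in> carrier_mat n (p + q)"
  using four_block_carrier_mat[OF assms(1) zero_carrier_mat, of B "0\<^sub>m 0 (dim_col A)" 0 "dim_col B"]
  unfolding append_cols_def carrier_matD(2)[OF assms(2)] by simp

lemma append_cols_index:
  assumes "A \<in> carrier_mat n p" "B \<in> carrier_mat n q" "i < n" "j < p + q"
  shows "(A @\<^sub>c B) $$ (i, j) = (if j < p then A $$ (i, j) else B $$ (i, j - p))"
proof -
  have d: "dim_row A = n" "dim_col A = p" "dim_row B = n" "dim_col B = q" using assms(1,2) by blast+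
  have "i < dim_row A + dim_row (0\<^sub>m 0 (dim_col B))" "j < dim_col A + dim_col (0\<^sub>m 0 (dim_col B))"
    using assms(3,4) d by simp_all
  from index_mat_four_block(1)[OF this, of B "0\<^sub>m 0 (dim_col A)"] show ?thesis
    unfolding append_cols_def d using assms(3) by simp
qed

lemma append_rows_index:
  assumes "A \<in> carrier_mat p n" "B \<in> carrier_mat q n" "i < p + q" "j < n"
  shows "(A @\<^sub>r B) $$ (i, j) = (if i < p then A $$ (i, j) else B $$ (i - p, j))"
proof -
  have d: "dim_row A = p" "dim_col A = n" "dim_row B = q" "dim_col B = n" using assms(1,2) by blast+
  have "i < dim_row A + dim_row (0\<^sub>m (dim_row B) 0)" "j < dim_col A + dim_col (0\<^sub>m (dim_row B) 0)"
    using assms(3,4) d by simp_all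
  from index_mat_four_block(1)[OF this, of "0\<^sub>m (dim_row A) 0" B] show ?thesis
    unfolding append_rows_def d using assms(4) by simp
qed

lemma mult_append_cols:
  fixes A :: "real mat"
  assumes "A \<in> carrier_mat m n" "B \<in> carrier_mat n p" "D \<in> carrier_mat n q"
  shows "A * (B @\<^sub>c D) = (A * B) @\<^sub>c (A * D)"
proof (rule eq_matI)
  fix i j assume "i < dim_row ((A * B) @\<^sub>c (A * D))" "j < dim_col ((A * B) @\<^sub>c (A * D))"
  then have ij: "i < m" "j < p + q" using assms by (auto simp: append_cols_def)
  have c: "B @\<^sub>c D \<in> carrier_mat n (p + q)" by (rule append_cols_carrier[OF assms(2,3)])
  have AB: "A * B \<in> carrier_mat m p" "A * D \<in> carrier_mat m q"
    by (rule mult_carrier_mat[OF assms(1,2)], rule mult_carrier_mat[OF assms(1,3)])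
  have entry: "(A * E) $$ (i, t) = (\<Sum>u<n. A $$ (i, u) * E $$ (u, t))"
    if "E \<in> carrier_mat n r" "t < r" for E :: "real mat" and t r
    using that ij assms(1) by (simp add: scalar_prod_def lessThan_atLeast0)
  have "(A * (B @\<^sub>c D)) $$ (i, j) = (\<Sum>u<n. A $$ (i, u) * (B @\<^sub>c D) $$ (u, j))"
    by (rule entry[OF c ij(2)])
  also have "\<dots> = (\<Sum>u<n. A $$ (i, u) * (if j < p then B $$ (u, j) else D $$ (u, j - p)))"
    using ij(2) by (intro sum.cong refl arg_cong2[where f = times] append_cols_index[OF assms(2,3)]) auto
  also have "\<dots> = (if j < p then (A * B) $$ (i, j) else (A * D) $$ (i, j - p))"
    using ij(2) entry[OF assms(2), of j] entry[OF assms(3), of "j - p"] by (cases "j < p") simp_all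
  also have "\<dots> = ((A * B) @\<^sub>c (A * D)) $$ (i, j)"
    by (rule append_cols_index[OF AB ij, symmetric])
  finally show "(A * (B @\<^sub>c D)) $$ (i, j) = ((A * B) @\<^sub>c (A * D)) $$ (i, j)" .
qed (use assms in \<open>auto simp: append_cols_def\<close>)

lemma rank_form_mult:
  assumes "A \<in> carrier_mat nc q" "i < nr" "j < q" "r \<le> nc"
  shows "(rank_form nr nc r * A) $$ (i, j) = (if i < r then A $$ (i, j) else 0)"
proof -
  have "(rank_form nr nc r * A) $$ (i, j) = (rank_form nr nc r *\<^sub>v col A j) $ i"
    using assms by (simp add: rank_form_def)
  also have "\<dots> = (if i < r then A $$ (i, j) else 0)"
    using assms rank_form_mult_vec[of "col A j" nc i nr r] by auto
  finally show ?thesis .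
qed

lemma inverse_pair_upper_block:
  assumes "inverse_pair c R R'" and F: "F \<in> carrier_mat c d"
  shows "inverse_pair (c + d) (four_block_mat R F (0\<^sub>m d c) (1\<^sub>m d))
     (four_block_mat R' (- (R' * F)) (0\<^sub>m d c) (1\<^sub>m d))"
proof (rule inverse_pairI)
  have c: "R \<in> carrier_mat c c" "R' \<in> carrier_mat c c" "R * R' = 1\<^sub>m c"
    using assms by (auto simp: inverse_pair_def)
  show "four_block_mat R F (0\<^sub>m d c) (1\<^sub>m d) \<in> carrier_mat (c + d) (c + d)"
    "four_block_mat R' (- (R' * F)) (0\<^sub>m d c) (1\<^sub>m d) \<in> carrier_mat (c + d) (c + d)"
    using c by auto
  have RF: "R' * F \<in> carrier_mat c d" using c F by simp
  have "R * (- (R' * F)) = - (R * (R' * F))"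
    using c(1) RF by (intro eq_matI) (auto simp: scalar_prod_def sum_negf)
  also have "R * (R' * F) = R * R' * F"
    using c F by (intro assoc_mult_mat[symmetric]) auto
  also have "\<dots> = F" using c F by simp
  finally have 1: "R * (- (R' * F)) + F = 0\<^sub>m c d" using F by (intro eq_matI) auto
  have "four_block_mat R F (0\<^sub>m d c) (1\<^sub>m d) * four_block_mat R' (- (R' * F)) (0\<^sub>m d c) (1\<^sub>m d)
    = four_block_mat (R * R' + F * 0\<^sub>m d c) (R * (- (R' * F)) + F * 1\<^sub>m d)
        (0\<^sub>m d c * R' + 1\<^sub>m d * 0\<^sub>m d c) (0\<^sub>m d c * (- (R' * F)) + 1\<^sub>m d * 1\<^sub>m d)"
    using c F RF by (intro mult_four_block_mat) auto
  also have "\<dots> = four_block_mat (1\<^sub>m c) (0\<^sub>m c d) (0\<^sub>m d c) (1\<^sub>m d)"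
    using c F RF 1 by (intro cong_four_block_mat) auto
  finally show "four_block_mat R F (0\<^sub>m d c) (1\<^sub>m d) * four_block_mat R' (- (R' * F)) (0\<^sub>m d c) (1\<^sub>m d)
    = 1\<^sub>m (c + d)" by simp
qed

lemma orthogonal_inverse_pair: "orthogonal_matrix_of m H \<Longrightarrow> inverse_pair m (H\<^sup>T) H"
  by (auto simp: orthogonal_matrix_of_def inverse_pair_def)

text \<open>A rank factorization of \<open>b * Hp\<close> yields \<open>T\<close> and
  \<open>R\<close>, and then \<open>T * b * H\<close> has the column blocks
  \<open>rank_form s c r * R\<close> and \<open>E = T * (b * Hq)\<close>. The first \<open>r\<close>
  rows of \<open>E\<close> have to disappear from the coefficient matrix: they become the block
  \<open>F\<close> of the change of basis, since the rank form reproduces them from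
  \<open>F\<close>. The remaining rows of \<open>E\<close> are \<open>b23\<close>.\<close>

lemma coefficient_normal_form:
  assumes b: "b \<in> carrier_mat s m" and c: "c \<le> m"
    and Hp: "Hp \<in> carrier_mat m c" and Hq: "Hq \<in> carrier_mat m (m - c)"
    and H: "orthogonal_matrix_of m (Hp @\<^sub>c Hq)"
  defines "r \<equiv> mat_rank (b * Hp)"
  obtains T T' R R' F b23 where "inverse_pair s T T'" "inverse_pair c R R'" "r \<le> min s c"
    "F \<in> carrier_mat c (m - c)" "b23 \<in> carrier_mat (s - r) (m - c)"
    "T * b = ((1\<^sub>m r @\<^sub>c 0\<^sub>m r (c - r) @\<^sub>c 0\<^sub>m r (m - c)) @\<^sub>r
        (0\<^sub>m (s - r) r @\<^sub>c 0\<^sub>m (s - r) (c - r) @\<^sub>c b23)) *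
       (four_block_mat R F (0\<^sub>m (m - c) c) (1\<^sub>m (m - c)) * (Hp @\<^sub>c Hq)\<^sup>T)"
proof -
  let ?H = "Hp @\<^sub>c Hq"
  have bHp: "b * Hp \<in> carrier_mat s c" using b Hp by simp
  obtain P T R R' where 1: "inverse_pair s P T" "inverse_pair c R R'"
    "b * Hp = P * rank_form s c r * R" and r: "r \<le> min s c"
    by (rule rank_factorization[OF bHp, folded r_def]) blast
  have cc: "P \<in> carrier_mat s s" "T \<in> carrier_mat s s" "R \<in> carrier_mat c c" "T * P = 1\<^sub>m s"
    using 1 by (auto simp: inverse_pair_def)
  have JR: "rank_form s c r * R \<in> carrier_mat s c"
    by (rule mult_carrier_mat[OF rank_form_carrier cc(3)])
  have "T * (b * Hp) = T * (P * (rank_form s c r * R))"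
    using cc unfolding 1(3) by (subst assoc_mult_mat[of P s s _ c R c]) auto
  also have "\<dots> = (T * P) * (rank_form s c r * R)"
    by (rule assoc_mult_mat[symmetric, OF cc(2) cc(1) JR])
  also have "\<dots> = rank_form s c r * R" unfolding cc(4) by (rule left_mult_one_mat[OF JR])
  finally have TbHp: "T * (b * Hp) = rank_form s c r * R" .
  define E where "E = T * (b * Hq)"
  have E: "E \<in> carrier_mat s (m - c)" unfolding E_def by (rule mult_carrier_mat[OF cc(2) mult_carrier_mat[OF b Hq]])
  \<comment> \<open>The rank form reads the first \<open>r\<close> rows of \<open>F\<close>; the
    others are filled with zeros to reach \<open>c\<close> rows.\<close>
  define F where "F = mat c (m - c) (\<lambda>(i, j). if i < r then E $$ (i, j) else 0)"
  define b23 where "b23 = mat (s - r) (m - c) (\<lambda>(i, j). E $$ (r + i, j))"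
  have Fc: "F \<in> carrier_mat c (m - c)" and b23: "b23 \<in> carrier_mat (s - r) (m - c)"
    by (auto simp: F_def b23_def)
  let ?bt = "(1\<^sub>m r @\<^sub>c 0\<^sub>m r (c - r) @\<^sub>c 0\<^sub>m r (m - c)) @\<^sub>r
        (0\<^sub>m (s - r) r @\<^sub>c 0\<^sub>m (s - r) (c - r) @\<^sub>c b23)"
  let ?B = "four_block_mat R F (0\<^sub>m (m - c) c) (1\<^sub>m (m - c))"
  \<comment> \<open>Joining the first two column blocks turns the 2 by 3 scheme into a 2 by 2 one
    that matches the blocks of \<open>?B\<close>.\<close>
  have bt: "?bt = four_block_mat (rank_form r c r) (0\<^sub>m r (m - c)) (0\<^sub>m (s - r) c) b23"
  proof (rule eq_matI)
    have top: "1\<^sub>m r @\<^sub>c 0\<^sub>m r (c - r) @\<^sub>c 0\<^sub>m r (m - c) \<in> carrier_mat r (r + (c - r + (m - c)))"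
      by (intro append_cols_carrier one_carrier_mat zero_carrier_mat)
    have bot: "0\<^sub>m (s - r) r @\<^sub>c 0\<^sub>m (s - r) (c - r) @\<^sub>c b23 \<in> carrier_mat (s - r) (r + (c - r + (m - c)))"
      by (intro append_cols_carrier zero_carrier_mat b23)
    have sm: "r + (c - r + (m - c)) = m" "r + (s - r) = s" "c + (m - c) = m" using r c by auto
    let ?fb = "four_block_mat (rank_form r c r) (0\<^sub>m r (m - c)) (0\<^sub>m (s - r) c) b23"
    have dims: "?fb \<in> carrier_mat s m"
      using four_block_carrier_mat[OF rank_form_carrier[of r c r] b23, of "0\<^sub>m r (m - c)" "0\<^sub>m (s - r) c"]
      unfolding sm .
    have dims': "?bt \<in> carrier_mat s m"
      using carrier_append_rows[OF top bot] unfolding sm .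
    show "dim_row ?bt = dim_row ?fb" "dim_col ?bt = dim_col ?fb"
      using carrier_matD[OF dims] carrier_matD[OF dims'] by simp_all
    fix i j assume "i < dim_row ?fb" "j < dim_col ?fb"
    then have ij: "i < s" "j < m" using carrier_matD[OF dims] by simp_all
    have t: "(1\<^sub>m r @\<^sub>c 0\<^sub>m r (c - r) @\<^sub>c 0\<^sub>m r (m - c)) $$ (i, j) = (if i = j then 1 else 0)" if "i < r"
      using that ij sm
      by (subst append_cols_index[OF one_carrier_mat append_cols_carrier[OF zero_carrier_mat zero_carrier_mat]])
        (auto simp: append_cols_index[OF zero_carrier_mat zero_carrier_mat])
    have b: "(0\<^sub>m (s - r) r @\<^sub>c 0\<^sub>m (s - r) (c - r) @\<^sub>c b23) $$ (i - r, j)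
        = (if j < c then 0 else b23 $$ (i - r, j - c))" if "\<not> i < r"
      using that ij sm r
      by (subst append_cols_index[OF zero_carrier_mat append_cols_carrier[OF zero_carrier_mat b23]])
        (auto simp: append_cols_index[OF zero_carrier_mat b23])
    have "?bt $$ (i, j) = (if i < r then if i = j then 1 else 0 else if j < c then 0 else b23 $$ (i - r, j - c))"
    proof (cases "i < r")
      case True
      then show ?thesis using ij sm append_rows_index[OF top bot, of i j] by (simp only: t[OF True] if_True)
    next
      case False
      then show ?thesis using ij sm append_rows_index[OF top bot, of i j] by (simp only: b[OF False] if_False)
    qed
    also have "\<dots> = ?fb $$ (i, j)"
    proof -
      have dJ: "dim_row (rank_form r c r) = r" "dim_col (rank_form r c r) = c"
        using carrier_matD[OF rank_form_carrier[of r c r]] by blast+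
      have "i < dim_row (rank_form r c r) + dim_row b23" "j < dim_col (rank_form r c r) + dim_col b23"
        using ij sm unfolding dJ carrier_matD[OF b23] by linarith+
      from index_mat_four_block(1)[OF this, of "0\<^sub>m r (m - c)" "0\<^sub>m (s - r) c"]
      have "?fb $$ (i, j) = (if i < r then if j < c then rank_form r c r $$ (i, j) else 0\<^sub>m r (m - c) $$ (i, j - c)
          else if j < c then 0\<^sub>m (s - r) c $$ (i - r, j) else b23 $$ (i - r, j - c))"
        unfolding dJ .
      moreover have "rank_form r c r $$ (i, j) = (if i = j then 1 else 0)" if "i < r" "j < c"
        using that by (simp add: rank_form_def)
      moreover have "i \<noteq> j" if "i < r" "\<not> j < c" using that r by simp
      ultimately show ?thesis using ij sm r by (cases "i < r"; cases "j < c") simp_all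
    qed
    finally show "?bt $$ (i, j) = ?fb $$ (i, j)" .
  qed
  have btB: "?bt * ?B = four_block_mat (rank_form r c r * R) (rank_form r c r * F) (0\<^sub>m (s - r) c) b23"
  proof -
    have "?bt * ?B = four_block_mat (rank_form r c r * R + 0\<^sub>m r (m - c) * 0\<^sub>m (m - c) c)
       (rank_form r c r * F + 0\<^sub>m r (m - c) * 1\<^sub>m (m - c))
       (0\<^sub>m (s - r) c * R + b23 * 0\<^sub>m (m - c) c) (0\<^sub>m (s - r) c * F + b23 * 1\<^sub>m (m - c))"
      unfolding bt using cc Fc b23 rank_form_carrier[of r c r]
      by (intro mult_four_block_mat) auto
    also have "\<dots> = four_block_mat (rank_form r c r * R) (rank_form r c r * F) (0\<^sub>m (s - r) c) b23"
      using cc Fc b23 mult_carrier_mat[OF rank_form_carrier[of r c r] cc(3)]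
        mult_carrier_mat[OF rank_form_carrier[of r c r] Fc]
      by (intro cong_four_block_mat) auto
    finally show ?thesis .
  qed
  have Hc: "?H \<in> carrier_mat m m" "?H * ?H\<^sup>T = 1\<^sub>m m"
    using H by (auto simp: orthogonal_matrix_of_def)
  \<comment> \<open>The identity is verified after multiplication by the orthogonal
    \<open>?H\<close> from the right, where the parallel and perpendicular columns separate;
    \<open>?H * ?H\<^sup>T = 1\<^sub>m m\<close> then undoes the multiplication.\<close>
  have "T * b * ?H = T * (b * ?H)"
    by (rule assoc_mult_mat[OF cc(2) b Hc(1)])
  also have "\<dots> = (T * (b * Hp)) @\<^sub>c (T * (b * Hq))"
    using mult_append_cols[OF b Hp Hq] mult_append_cols[OF cc(2) bHp, of "b * Hq" "m - c"] b Hq by simp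
  also have "\<dots> = (rank_form s c r * R) @\<^sub>c E" by (simp add: TbHp E_def)
  also have "\<dots> = ?bt * ?B"
  proof (rule eq_matI)
    have dims: "?bt * ?B \<in> carrier_mat (r + (s - r)) (c + (m - c))"
      unfolding btB by (rule four_block_carrier_mat)
        (use b23 mult_carrier_mat[OF rank_form_carrier[of r c r] cc(3)] in auto)
    have dims': "(rank_form s c r * R) @\<^sub>c E \<in> carrier_mat s (c + (m - c))"
      by (rule append_cols_carrier[OF JR E])
    show "dim_row ((rank_form s c r * R) @\<^sub>c E) = dim_row (?bt * ?B)"
      "dim_col ((rank_form s c r * R) @\<^sub>c E) = dim_col (?bt * ?B)"
      using carrier_matD[OF dims] carrier_matD[OF dims'] r by auto
    fix i j assume "i < dim_row (?bt * ?B)" "j < dim_col (?bt * ?B)"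
    then have ij: "i < s" "j < c + (m - c)" using carrier_matD[OF dims] r by auto
    have d: "dim_row (rank_form r c r) = r" "dim_col (rank_form r c r) = c"
      using carrier_matD[OF rank_form_carrier[of r c r]] by auto
    have "(?bt * ?B) $$ (i, j) = (if i < r then if j < c then (rank_form r c r * R) $$ (i, j)
        else (rank_form r c r * F) $$ (i, j - c)
        else if j < c then 0\<^sub>m (s - r) c $$ (i - r, j) else b23 $$ (i - r, j - c))"
    proof -
      have dJ: "dim_row (rank_form r c r * R) = r" "dim_col (rank_form r c r * R) = c"
        using d carrier_matD[OF cc(3)] by simp_all
      have "i < dim_row (rank_form r c r * R) + dim_row b23" "j < dim_col (rank_form r c r * R) + dim_col b23"
        using ij r unfolding dJ carrier_matD[OF b23] by linarith+
      from index_mat_four_block(1)[OF this, of "rank_form r c r * F" "0\<^sub>m (s - r) c"]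
      show ?thesis unfolding btB dJ .
    qed
    also have "\<dots> = ((rank_form s c r * R) @\<^sub>c E) $$ (i, j)"
    proof -
      have "(rank_form r c r * R) $$ (i, j) = R $$ (i, j)" if "i < r" "j < c"
        using that r rank_form_mult[OF cc(3), of i r j r] by simp
      moreover have "(rank_form s c r * R) $$ (i, j) = (if i < r then R $$ (i, j) else 0)" if "j < c"
        using that r ij rank_form_mult[OF cc(3), of i s j r] by simp
      moreover have "(rank_form r c r * F) $$ (i, j - c) = E $$ (i, j - c)" if "i < r" "\<not> j < c"
        using that r ij rank_form_mult[OF Fc, of i r "j - c" r] by (simp add: F_def)
      ultimately show ?thesis
        using ij r by (auto simp: append_cols_index[OF JR E] b23_def simp del: index_mult_mat(1))
    qed
    finally show "((rank_form s c r * R) @\<^sub>c E) $$ (i, j) = (?bt * ?B) $$ (i, j)" by (rule sym)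
  qed
  finally have TbH: "T * b * ?H = ?bt * ?B" .
  have sm: "r + (s - r) = s" "c + (m - c) = m" using r c by auto
  have btc: "?bt \<in> carrier_mat s m"
    using four_block_carrier_mat[OF rank_form_carrier[of r c r] b23, of "0\<^sub>m r (m - c)" "0\<^sub>m (s - r) c"]
    unfolding bt sm .
  have Bc: "?B \<in> carrier_mat m m"
    using four_block_carrier_mat[OF cc(3) one_carrier_mat, of F "0\<^sub>m (m - c) c" "m - c"]
    unfolding sm .
  have "T * b = T * b * (?H * ?H\<^sup>T)"
    unfolding Hc(2) by (rule right_mult_one_mat[symmetric, OF mult_carrier_mat[OF cc(2) b]])
  also have "\<dots> = T * b * ?H * ?H\<^sup>T"
    by (rule assoc_mult_mat[symmetric, OF mult_carrier_mat[OF cc(2) b] Hc(1) transpose_carrier_mat[THEN iffD2, OF Hc(1)]])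
  also have "\<dots> = ?bt * (?B * ?H\<^sup>T)"
    unfolding TbH by (rule assoc_mult_mat[OF btc Bc transpose_carrier_mat[THEN iffD2, OF Hc(1)]])
  finally show ?thesis
    by (rule that[OF inverse_pair_sym[OF 1(1)] 1(2) r Fc b23])
qed

section \<open>Representation of the transformed processes\<close>

text \<open>The column space of a product lies in that of its left factor. This is what bounds
  \<open>c_y\<close> by the rank of \<open>b_r\<close>.\<close>

lemma mat_rank_mult_le:
  assumes A: "A \<in> carrier_mat nr n" and B: "B \<in> carrier_mat n nc"
  shows "mat_rank (A * B) \<le> mat_rank A"
proof -
  interpret vec_space "TYPE(real)" nr .
  have AB: "A * B \<in> carrier_mat nr nc" by (rule mult_carrier_mat[OF A B])
  have sub: "span (set (cols (A * B))) \<subseteq> span (set (cols A))"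
  proof
    fix y assume "y \<in> span (set (cols (A * B)))"
    then have "y \<in> {y \<in> carrier_vec nr. \<exists>x\<in>carrier_vec nc. (A * B) *\<^sub>v x = y}"
      using col_space_eq[OF AB] carrier_matD[OF AB] by (simp only: col_space_def)
    then obtain x where x: "y \<in> carrier_vec nr" "x \<in> carrier_vec nc" "(A * B) *\<^sub>v x = y" by auto
    then have "A *\<^sub>v (B *\<^sub>v x) = y" using assoc_mult_mat_vec[OF A B] by simp
    moreover have "B *\<^sub>v x \<in> carrier_vec n" by (rule mult_mat_vec_carrier[OF B x(2)])
    ultimately have "y \<in> {y \<in> carrier_vec nr. \<exists>x\<in>carrier_vec n. A *\<^sub>v x = y}" using x(1) by blast
    then show "y \<in> span (set (cols A))"
      using col_space_eq[OF A] carrier_matD[OF A] by (simp only: col_space_def)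
  qed
  have S: "subspace class_ring (span (set (cols A))) V" "subspace class_ring (span (set (cols (A * B)))) V"
    using span_is_subspace cols_dim[of A] cols_dim[of "A * B"] carrier_matD(1)[OF A] carrier_matD(1)[OF AB]
    by auto
  have "vectorspace.dim class_ring (vs (span (set (cols (A * B))))) \<le> vectorspace.dim class_ring (vs (span (set (cols A))))"
    using vectorspace.subspace_dim[OF subspace_is_vs[OF S(1)] nested_subspaces[OF S sub] fin_dim_span_cols[OF A]]
      fin_dim_span_cols[OF AB] by simp
  then show ?thesis
    using carrier_matD(1)[OF A] by (simp add: mat_rank_def rank_def)
qed

text \<open>A kernel vector of \<open>Hp\<close>, padded with zeros, is a kernel vector of the
  invertible \<open>Hp @\<^sub>c Hq\<close>. This turns the dimension of the left kernel of
  \<open>Hr_par\<close> into \<open>m_r - c_r\<close>.\<close>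

lemma orthogonal_columns_rank:
  assumes Hp: "Hp \<in> carrier_mat m c" and Hq: "Hq \<in> carrier_mat m (m - c)" and c: "c \<le> m"
    and H: "orthogonal_matrix_of m (Hp @\<^sub>c Hq)"
  shows "mat_rank Hp = c"
proof (rule injective_full_col_rank[OF Hp])
  fix x :: "real vec" assume x: "x \<in> carrier_vec c" "Hp *\<^sub>v x = 0\<^sub>v m"
  define x' where "x' = vec m (\<lambda>j. if j < c then x $ j else 0)"
  have x': "x' \<in> carrier_vec m" by (simp add: x'_def)
  let ?H = "Hp @\<^sub>c Hq"
  have Hc: "?H \<in> carrier_mat m m" and inv: "inverse_pair m (?H\<^sup>T) ?H"
    using H orthogonal_inverse_pair[OF H] by (simp_all add: orthogonal_matrix_of_def)
  have "?H *\<^sub>v x' = Hp *\<^sub>v x"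
  proof (rule eq_vecI)
    fix i assume "i < dim_vec (Hp *\<^sub>v x)"
    then have i: "i < m" using Hp by simp
    have "(?H *\<^sub>v x') $ i = (\<Sum>j<m. ?H $$ (i, j) * x' $ j)"
      using i Hc x' by (simp add: scalar_prod_def lessThan_atLeast0)
    also have "\<dots> = (\<Sum>j<c. Hp $$ (i, j) * x $ j)"
      using i c by (intro sum.mono_neutral_cong_right) (auto simp: x'_def append_cols_index[OF Hp Hq])
    also have "\<dots> = (Hp *\<^sub>v x) $ i"
      using i Hp x(1) by (simp add: scalar_prod_def lessThan_atLeast0)
    finally show "(?H *\<^sub>v x') $ i = (Hp *\<^sub>v x) $ i" .
  qed (use Hc Hp in simp)
  then have "x' = ?H\<^sup>T *\<^sub>v 0\<^sub>v m"
    using inverse_pair_cancel_vec(1)[OF inv x'] x(2) by simp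
  also have "\<dots> = 0\<^sub>v m" using Hc by (intro mat_mult_zero_vec) simp
  finally have "x' = 0\<^sub>v m" .
  have "x $ j = 0" if j: "j < c" for j
  proof -
    have "x $ j = x' $ j" using j c by (simp add: x'_def)
    also have "\<dots> = 0" unfolding \<open>x' = 0\<^sub>v m\<close> using j c by simp
    finally show ?thesis .
  qed
  then show "x = 0\<^sub>v c" using x(1) by (intro eq_vecI) auto
qed

section \<open>Rows of the transfer function at 1: rank conditions, change of basis, rotated
  coordinates\<close>

context white_noise
begin

lemma full_row_rank_rows_independent:
  assumes T: "T \<in> carrier_mat n k" and "full_row_rank T" and \<rho>: "\<And>i l. i < n \<Longrightarrow> l < k \<Longrightarrow> T $$ (i, l) = \<rho> i l"
  shows "rows_independent n \<rho>"
  unfolding rows_independent_def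
proof (intro allI impI)
  fix a i assume 0: "\<forall>l<k. (\<Sum>i<n. a i * \<rho> i l) = 0" and i: "i < n"
  have "T\<^sup>T *\<^sub>v vec n a = 0\<^sub>v k"
  proof (rule eq_vecI)
    fix l assume "l < dim_vec (0\<^sub>v k :: real vec)"
    then have l: "l < k" by simp
    have "(T\<^sup>T *\<^sub>v vec n a) $ l = (\<Sum>i<n. T $$ (i, l) * a i)"
      using l T by (simp add: scalar_prod_def lessThan_atLeast0)
    also have "\<dots> = (\<Sum>i<n. a i * \<rho> i l)" using l by (intro sum.cong) (auto simp: \<rho>)
    finally show "(T\<^sup>T *\<^sub>v vec n a) $ l = 0\<^sub>v k $ l" using 0 l by simp
  qed (use T in simp)
  then have "vec n a = 0\<^sub>v n"
    by (intro full_row_rank_left_kernel[OF T assms(2)]) simp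
  then have "vec n a $ i = 0\<^sub>v n $ i" by simp
  then show "a i = 0" using i by simp
qed

lemma rows_independent_full_col_rank:
  assumes K: "K \<in> carrier_mat k n" and "rows_independent n \<rho>"
    and \<rho>: "\<And>i l. i < n \<Longrightarrow> l < k \<Longrightarrow> K $$ (l, i) = \<rho> i l"
  shows "full_col_rank K"
proof -
  have "mat_rank K = n"
  proof (rule injective_full_col_rank[OF K])
    fix x :: "real vec" assume x: "x \<in> carrier_vec n" "K *\<^sub>v x = 0\<^sub>v k"
    have "\<forall>l<k. (\<Sum>i<n. x $ i * \<rho> i l) = 0"
    proof (intro allI impI)
      fix l assume l: "l < k"
      have "(\<Sum>i<n. x $ i * \<rho> i l) = (\<Sum>i<n. K $$ (l, i) * x $ i)"
        using l by (intro sum.cong) (auto simp: \<rho>)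
      also have "\<dots> = (K *\<^sub>v x) $ l" using l K x(1) by (simp add: scalar_prod_def lessThan_atLeast0)
      finally show "(\<Sum>i<n. x $ i * \<rho> i l) = 0" using x(2) l by simp
    qed
    then have "\<forall>i<n. x $ i = 0"
      by (rule mp[OF spec[OF assms(2)[unfolded rows_independent_def], of "\<lambda>i. x $ i"]])
    then show "x = 0\<^sub>v n" using x(1) by (intro eq_vecI) auto
  qed
  then show ?thesis using carrier_matD[OF K] by (simp add: full_col_rank_def)
qed

text \<open>The change of basis \<open>R\<close> acts on the integrated coordinates of
  \<open>zr\<close> only, while those of \<open>zu\<close> keep their rows. Weights \<open>a\<close>
  on the new rows amount to weights \<open>b\<close> on the old ones, with first block
  \<open>R\<^sup>T *\<^sub>v vec c a\<close>, and \<open>R\<^sup>T\<close> is injective.\<close>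

lemma rows_independent_block_transform:
  assumes T: "rows_independent (c + d) T" and R: "inverse_pair c R R'"
  shows "rows_independent (c + d) (\<lambda>i l. if i < c then \<Sum>p<c. R $$ (i, p) * T p l else T i l)"
  unfolding rows_independent_def
proof (rule allI, rule impI)
  fix a :: "nat \<Rightarrow> real"
  let ?\<rho> = "\<lambda>i l. if i < c then \<Sum>p<c. R $$ (i, p) * T p l else T i l"
  assume 0: "\<forall>l<k. (\<Sum>i<c + d. a i * ?\<rho> i l) = 0"
  define b where "b p = (if p < c then \<Sum>i<c. a i * R $$ (i, p) else a p)" for p
  have split: "{..<c + d} = {..<c} \<union> {c..<c + d}" by auto
  have "(\<Sum>p<c + d. b p * T p l) = (\<Sum>i<c + d. a i * ?\<rho> i l)" for l
  proof -
    have "(\<Sum>p<c. b p * T p l) = (\<Sum>p<c. \<Sum>i<c. a i * (R $$ (i, p) * T p l))"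
      by (intro sum.cong) (auto simp: b_def sum_distrib_right mult.assoc)
    also have "\<dots> = (\<Sum>i<c. a i * ?\<rho> i l)"
      by (subst sum.swap) (simp add: sum_distrib_left)
    finally have "(\<Sum>p<c. b p * T p l) = (\<Sum>i<c. a i * ?\<rho> i l)" .
    moreover have "(\<Sum>p=c..<c + d. b p * T p l) = (\<Sum>i=c..<c + d. a i * ?\<rho> i l)"
      by (intro sum.cong) (auto simp: b_def)
    ultimately show ?thesis
      unfolding split by (subst (1 2) sum.union_disjoint) auto
  qed
  then have "\<forall>l<k. (\<Sum>p<c + d. b p * T p l) = 0" using 0 by simp
  then have b0: "\<forall>p<c + d. b p = 0"
    by (rule mp[OF spec[OF T[unfolded rows_independent_def], of b]])
  have Rc: "R \<in> carrier_mat c c" using R by (simp add: inverse_pair_def)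
  have "R\<^sup>T *\<^sub>v vec c a = 0\<^sub>v c"
  proof (rule eq_vecI)
    fix p assume "p < dim_vec (0\<^sub>v c :: real vec)"
    then have p: "p < c" by simp
    have "(R\<^sup>T *\<^sub>v vec c a) $ p = b p"
      using p Rc by (simp add: scalar_prod_def lessThan_atLeast0 b_def mult.commute)
    then show "(R\<^sup>T *\<^sub>v vec c a) $ p = 0\<^sub>v c $ p" using b0 p by simp
  qed (use Rc in simp)
  then have "vec c a = R'\<^sup>T *\<^sub>v 0\<^sub>v c"
    using inverse_pair_cancel_vec(2)[OF inverse_pair_transpose[OF R], of "vec c a"] by simp
  also have "\<dots> = 0\<^sub>v c" using R by (intro mat_mult_zero_vec) (simp add: inverse_pair_def)
  finally have 1: "vec c a $ i = 0\<^sub>v c $ i" for i by simp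
  show "\<forall>i<c + d. a i = 0"
  proof (intro allI impI)
    fix i assume i: "i < c + d"
    show "a i = 0"
    proof (cases "i < c")
      case True then show ?thesis using 1[of i] by simp
    next
      case False then show ?thesis using b0 i by (auto simp: b_def)
    qed
  qed
qed

lemma partially_integrated_rotated:
  assumes H: "H \<in> carrier_mat m m" and c: "c \<le> m" and z: "random_process M m z"
    and pd: "\<And>t. AE \<omega> in M. partial_diff c m (\<lambda>t \<omega>. H\<^sup>T *\<^sub>v z t \<omega>) t \<omega> = v t \<omega>"
    and lp: "\<And>p. p < m \<Longrightarrow> linear_process (G p) (\<lambda>t \<omega>. v t \<omega> $ p)"
  shows "partially_integrated m c G (\<lambda>p t \<omega>. (H\<^sup>T *\<^sub>v z t \<omega>) $ p)"
proof -
  define x where "x = (\<lambda>t \<omega>. H\<^sup>T *\<^sub>v z t \<omega>)"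
  have dimx: "dim_vec (x t \<omega>) = m" for t \<omega> using H by (simp add: x_def)
  have xp: "random_process M m x"
    unfolding x_def by (rule random_process_mult_mat_vec[OF z]) (use H in simp)
  then have xm: "(\<lambda>\<omega>. x t \<omega> $ p) \<in> borel_measurable M" if "p < m" for p t
    using that by (simp add: random_process_def random_vector_def)
  have "linear_process (G p) (\<lambda>t \<omega>. x t \<omega> $ p - x (t - 1) \<omega> $ p)" if p: "p < c" for p
  proof (rule linear_process_cong[OF lp])
    show "p < m" using p c by simp
    then show "(\<lambda>\<omega>. x t \<omega> $ p - x (t - 1) \<omega> $ p) \<in> borel_measurable M" for t
      by (intro borel_measurable_diff xm)
    show "AE \<omega> in M. x t \<omega> $ p - x (t - 1) \<omega> $ p = v t \<omega> $ p" for t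
      using pd[of t]
    proof eventually_elim
      case (elim \<omega>)
      have "v t \<omega> $ p = partial_diff c m x t \<omega> $ p" using elim by (simp add: x_def)
      also have "\<dots> = x t \<omega> $ p - x (t - 1) \<omega> $ p"
        using p c dimx by (simp add: partial_diff_def subvec_def diff_proc_def)
      finally show ?case by simp
    qed
  qed
  moreover have "linear_process (G p) (\<lambda>t \<omega>. x t \<omega> $ p)" if p: "c \<le> p" "p < m" for p
  proof (rule linear_process_cong[OF lp[OF p(2)]])
    show "(\<lambda>\<omega>. x t \<omega> $ p) \<in> borel_measurable M" for t by (rule xm[OF p(2)])
    show "AE \<omega> in M. x t \<omega> $ p = v t \<omega> $ p" for t
      using pd[of t]
    proof eventually_elim
      case (elim \<omega>)
      have "v t \<omega> $ p = partial_diff c m x t \<omega> $ p" using elim by (simp add: x_def)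
      also have "\<dots> = x t \<omega> $ p"
        using p c dimx by (simp add: partial_diff_def subvec_def diff_proc_def)
      finally show ?case by simp
    qed
  qed
  ultimately show ?thesis using c unfolding partially_integrated_def x_def by simp
qed

lemma stationary_block:
  assumes Z: "partially_integrated m c G Z" and x: "random_process M (m - c) x"
    and eq: "\<forall>i<m - c. \<forall>t. AE \<omega> in M. x t \<omega> $ i = Z (c + i) t \<omega>"
    and indep: "rows_independent (m - c) (\<lambda>i. total (G (c + i)))"
  shows "stationary M (m - c) x" "nonsingular_spectrum_at M (m - c) x 1"
proof -
  have lp: "linear_process (G (c + i)) (\<lambda>t \<omega>. x t \<omega> $ i)" if i: "i < m - c" for i
  proof (rule linear_process_cong)
    show "linear_process (G (c + i)) (Z (c + i))"
      using Z i by (simp add: partially_integrated_def)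
    show "(\<lambda>\<omega>. x t \<omega> $ i) \<in> borel_measurable M" for t
      using x i by (simp add: random_process_def random_vector_def)
  qed (rule eq[rule_format, OF i])
  show "stationary M (m - c) x" by (rule stationary_linear_process[OF x lp])
  show "nonsingular_spectrum_at M (m - c) x 1"
    by (rule nonsingular_spectrum_linear_process[OF lp indep])
qed

end

context vector_noise
begin

text \<open>Each row of \<open>B\<close> may mix integrated and stationary coordinates. After
  differencing, the stationary ones carry the factor \<open>1 - z\<close>, so the transfer function
  at 1 sees only the first \<open>c\<close> columns of \<open>B\<close>. For this reason the block
  \<open>F\<close> of the normal form leaves the rank condition intact.\<close>

lemma differenced_combination_filtered:
  assumes Z: "partially_integrated m c G Z" and x: "random_process M r x"
    and eq: "\<forall>i<r. \<forall>t. AE \<omega> in M. x t \<omega> $ i = (\<Sum>p<m. B i p * Z p t \<omega>)"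
  defines "C \<equiv> \<lambda>j. mat r k (\<lambda>(i, l). \<Sum>p<m. B i p * diff_coeff c G p j l)"
  shows "is_filtered M r C eps (diff_proc x)" "summable (\<lambda>j. mat_norm (C j))"
    "\<And>i l. i < r \<Longrightarrow> l < k \<Longrightarrow> transfer_fun r k C 1 $$ (i, l) = (\<Sum>p<c. B i p * total (G p) l)"
proof -
  have dx: "random_process M r (diff_proc x)" by (rule random_process_diff[OF x])
  have lp: "linear_process (\<lambda>j l. \<Sum>p<m. B i p * diff_coeff c G p j l) (\<lambda>t \<omega>. diff_proc x t \<omega> $ i)"
    if i: "i < r" for i
  proof (rule linear_process_cong[OF partially_integrated_combination_diff(1)[OF Z]])
    show "(\<lambda>\<omega>. diff_proc x t \<omega> $ i) \<in> borel_measurable M" for t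
      using dx i by (simp add: random_process_def random_vector_def)
    show "AE \<omega> in M. diff_proc x t \<omega> $ i = (\<Sum>p<m. B i p * (Z p t \<omega> - Z p (t - 1) \<omega>))" for t
    proof -
      have "AE \<omega> in M. x (t - 1) \<omega> \<in> carrier_vec r"
        using x by (auto simp: random_process_def random_vector_def)
      then show ?thesis using eq[rule_format, OF i, of t] eq[rule_format, OF i, of "t - 1"]
      proof eventually_elim
        case (elim \<omega>)
        then have "diff_proc x t \<omega> $ i = x t \<omega> $ i - x (t - 1) \<omega> $ i"
          using i by (simp add: diff_proc_def)
        then show ?case using elim by (simp add: sum_subtractf right_diff_distrib)
      qed
    qed
  qed
  show "is_filtered M r C eps (diff_proc x)" "summable (\<lambda>j. mat_norm (C j))"
    unfolding C_def by (rule linear_process_is_filtered[OF dx lp]; assumption)+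
  show "transfer_fun r k C 1 $$ (i, l) = (\<Sum>p<c. B i p * total (G p) l)" if "i < r" "l < k" for i l
  proof -
    have "transfer_fun r k C 1 $$ (i, l) = total (\<lambda>j l. \<Sum>p<m. B i p * diff_coeff c G p j l) l"
      using that by (simp add: transfer_fun_1 C_def total_def)
    then show ?thesis using partially_integrated_combination_diff(2)[OF Z that(2)] by simp
  qed
qed

end

section \<open>Cointegrating ranks and normal form under Assumption P\<close>

theorem theorem3p1:
  fixes M :: "'w measure"
    and s k m_r m_u n c_r c_u c_y :: nat
    and y zr zu u eps v w :: "int \<Rightarrow> 'w \<Rightarrow> real vec"
    and b_r b_u Lam Sig Hr_par Hr_perp Hu_par Hu_perp :: "real mat"
    and C :: "nat \<Rightarrow> real mat"
    and a :: real
  assumes "prob_space M"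
    and "random_process M s y" and "random_process M m_r zr" and "random_process M m_u zu"
    and "b_r \<in> carrier_mat s m_r" and "b_u \<in> carrier_mat s m_u"
    and "\<forall>t. AE \<omega> in M. y t \<omega> = b_r *\<^sub>v zr t \<omega> + b_u *\<^sub>v zu t \<omega> + u t \<omega>"
    and "mat_rank b_r = n" and "n < min s m_r"
    and "Lam \<in> carrier_mat s k" and "full_row_rank Lam"
    and "random_process M s u" and "\<forall>t. AE \<omega> in M. u t \<omega> = Lam *\<^sub>v eps t \<omega>"
    and "iid_process M k eps"
    and "\<forall>t. \<forall>i<k. (\<integral>\<omega>. eps t \<omega> $ i \<partial>M) = 0"
    and "\<forall>t. cov_mat M k (eps t) (eps t) = Sig" and "invertible_mat Sig"
    and "\<forall>t. \<forall>i<k. integrable M (\<lambda>\<omega>. (eps t \<omega> $ i) ^ 4)"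
    and "c_r \<le> m_r" and "c_u \<le> m_u"
    and "Hr_par \<in> carrier_mat m_r c_r" and "Hr_perp \<in> carrier_mat m_r (m_r - c_r)"
    and "Hu_par \<in> carrier_mat m_u c_u" and "Hu_perp \<in> carrier_mat m_u (m_u - c_u)"
    and "orthogonal_matrix_of m_r (Hr_par @\<^sub>c Hr_perp)"
    and "orthogonal_matrix_of m_u (Hu_par @\<^sub>c Hu_perp)"
    and "random_process M m_r v" and "random_process M m_u w"
    and "\<forall>t. AE \<omega> in M.
           partial_diff c_r m_r (\<lambda>t \<omega>. (Hr_par @\<^sub>c Hr_perp)\<^sup>T *\<^sub>v zr t \<omega>) t \<omega> = v t \<omega>"
    and "\<forall>t. AE \<omega> in M.
           partial_diff c_u m_u (\<lambda>t \<omega>. (Hu_par @\<^sub>c Hu_perp)\<^sup>T *\<^sub>v zu t \<omega>) t \<omega> = w t \<omega>"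
    and "\<forall>j. C j \<in> carrier_mat (m_r + m_u) k" and "C 0 = 0\<^sub>m (m_r + m_u) k"
    and "is_filtered M (m_r + m_u) C eps (\<lambda>t \<omega>. v t \<omega> @\<^sub>v w t \<omega>)"
    and "a > 3 / 2" and "summable (\<lambda>j. real j powr a * mat_norm (C j))"
    and "full_row_rank (transfer_fun (m_r + m_u) k C 1)"
    and "\<forall>t. pos_def_mat ((m_r - c_r) + (m_u - c_u))
           (cov_mat M ((m_r - c_r) + (m_u - c_u))
              (\<lambda>\<omega>. (Hr_perp\<^sup>T *\<^sub>v zr t \<omega>) @\<^sub>v (Hu_perp\<^sup>T *\<^sub>v zu t \<omega>))
              (\<lambda>\<omega>. (Hr_perp\<^sup>T *\<^sub>v zr t \<omega>) @\<^sub>v (Hu_perp\<^sup>T *\<^sub>v zu t \<omega>)))"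
    and "AE \<omega> in M. Hr_par\<^sup>T *\<^sub>v zr 0 \<omega> = 0\<^sub>v c_r"
    and "AE \<omega> in M. Hu_par\<^sup>T *\<^sub>v zu 0 \<omega> = 0\<^sub>v c_u"
    and "c_y = mat_rank (b_r * Hr_par)"
  shows
    "c_y \<le> n \<and>
     cointegrating_rank M m_r zr = m_r - c_r \<and>
     cointegrating_rank M s (\<lambda>t \<omega>. y t \<omega> - b_u *\<^sub>v zu t \<omega>) = s - c_y \<and>
     (\<exists>T_y T_zr T_zu b23 C1 C2 Cu.
        T_y \<in> carrier_mat s s \<and> invertible_mat T_y \<and>
        T_zr \<in> carrier_mat m_r m_r \<and> invertible_mat T_zr \<and>
        T_zu \<in> carrier_mat m_u m_u \<and> invertible_mat T_zu \<and>
        b23 \<in> carrier_mat (s - c_y) (m_r - c_r) \<and>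
        (\<forall>j. C1 j \<in> carrier_mat c_y k) \<and> summable (\<lambda>j. mat_norm (C1 j)) \<and>
        (\<forall>j. C2 j \<in> carrier_mat (c_r - c_y) k) \<and> summable (\<lambda>j. mat_norm (C2 j)) \<and>
        (\<forall>j. Cu j \<in> carrier_mat c_u k) \<and> summable (\<lambda>j. mat_norm (Cu j)) \<and>
        (let zt = (\<lambda>t \<omega>. T_zr *\<^sub>v zr t \<omega>);
             z1 = (\<lambda>t \<omega>. subvec 0 c_y (zt t \<omega>));
             z2 = (\<lambda>t \<omega>. subvec c_y (c_r - c_y) (zt t \<omega>));
             z3 = (\<lambda>t \<omega>. subvec c_r (m_r - c_r) (zt t \<omega>));
             zut = (\<lambda>t \<omega>. T_zu *\<^sub>v zu t \<omega>);
             zu1 = (\<lambda>t \<omega>. subvec 0 c_u (zut t \<omega>));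
             zu2 = (\<lambda>t \<omega>. subvec c_u (m_u - c_u) (zut t \<omega>));
             epst = (\<lambda>t \<omega>. T_y *\<^sub>v (Lam *\<^sub>v eps t \<omega>));
             bt = (1\<^sub>m c_y @\<^sub>c 0\<^sub>m c_y (c_r - c_y) @\<^sub>c 0\<^sub>m c_y (m_r - c_r)) @\<^sub>r
                  (0\<^sub>m (s - c_y) c_y @\<^sub>c 0\<^sub>m (s - c_y) (c_r - c_y) @\<^sub>c b23)
         in (\<forall>t. AE \<omega> in M. T_y *\<^sub>v (y t \<omega> - b_u *\<^sub>v zu t \<omega>) = bt *\<^sub>v zt t \<omega> + epst t \<omega>) \<and>
            is_filtered M c_y C1 eps (diff_proc z1) \<and>
            is_filtered M (c_r - c_y) C2 eps (diff_proc z2) \<and>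
            is_filtered M c_u Cu eps (diff_proc zu1) \<and>
            full_col_rank ((transfer_fun c_y k C1 1)\<^sup>T @\<^sub>c (transfer_fun (c_r - c_y) k C2 1)\<^sup>T @\<^sub>c
                           (transfer_fun c_u k Cu 1)\<^sup>T) \<and>
            stationary M (m_r - c_r) z3 \<and> nonsingular_spectrum_at M (m_r - c_r) z3 1 \<and>
            stationary M (m_u - c_u) zu2 \<and> nonsingular_spectrum_at M (m_u - c_u) zu2 1))"
proof -
  note asm = assms
  interpret vector_noise M k eps "\<lambda>l m. Sig $$ (l, m)"
    by (rule iid_vector_noise) (use asm(1,14-18) in auto)
  define Hr Hu where "Hr = Hr_par @\<^sub>c Hr_perp" and "Hu = Hu_par @\<^sub>c Hu_perp"
  have Hr: "inverse_pair m_r (Hr\<^sup>T) Hr" and Hu: "inverse_pair m_u (Hu\<^sup>T) Hu"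
    using orthogonal_inverse_pair asm(25,26) by (auto simp: Hr_def Hu_def)
  have Hrc: "Hr \<in> carrier_mat m_r m_r" "Hr\<^sup>T \<in> carrier_mat m_r m_r"
    and Huc: "Hu \<in> carrier_mat m_u m_u" "Hu\<^sup>T \<in> carrier_mat m_u m_u"
    using Hr Hu by (auto simp: inverse_pair_def)
  define zbr zbu where "zbr = (\<lambda>t \<omega>. Hr\<^sup>T *\<^sub>v zr t \<omega>)" and "zbu = (\<lambda>t \<omega>. Hu\<^sup>T *\<^sub>v zu t \<omega>)"
  have zbr: "random_process M m_r zbr" and zbu: "random_process M m_u zbu"
    unfolding zbr_def zbu_def
    by (rule random_process_mult_mat_vec[OF asm(3) Hrc(2)], rule random_process_mult_mat_vec[OF asm(4) Huc(2)])
  have zrc: "zr t \<omega> \<in> carrier_vec m_r" and zuc: "zu t \<omega> \<in> carrier_vec m_u"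
    and zbrc: "zbr t \<omega> \<in> carrier_vec m_r" if "\<omega> \<in> space M" for t \<omega>
    using asm(3,4) zbr that by (simp_all add: random_process_def random_vector_def)
  have C: "C j \<in> carrier_mat (m_r + m_u) k" for j using asm(31) by simp
  have sumC: "summable (\<lambda>j. mat_norm (C j))"
    by (rule summable_mat_norm_of_weighted[OF asm(35)]) (use asm(34) in simp)
  have vw: "random_process M (m_r + m_u) (\<lambda>t \<omega>. v t \<omega> @\<^sub>v w t \<omega>)"
    by (rule random_process_append[OF asm(27,28)])
  \<comment> \<open>One coefficient family for both groups of regressors: the rows below
    \<open>m_r\<close> belong to \<open>v\<close>, the rows from \<open>m_r\<close> on to
    \<open>w\<close>.\<close>
  define G where "G i j l = C j $$ (i, l)" for i j l
  have lp: "linear_process (G i) (\<lambda>t \<omega>. (v t \<omega> @\<^sub>v w t \<omega>) $ i)" if "i < m_r + m_u" for i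
    using is_filtered_linear_process[OF asm(33) vw C sumC that] by (simp only: G_def[abs_def])
  have vwc: "AE \<omega> in M. v t \<omega> \<in> carrier_vec m_r \<and> w t \<omega> \<in> carrier_vec m_u" for t
    using asm(27,28) by (intro AE_I2) (simp add: random_process_def random_vector_def)
  have lp_v: "linear_process (G p) (\<lambda>t \<omega>. v t \<omega> $ p)" if p: "p < m_r" for p
  proof (rule linear_process_cong[OF lp])
    show "p < m_r + m_u" using p by simp
    show "(\<lambda>\<omega>. v t \<omega> $ p) \<in> borel_measurable M" for t
      using asm(27) p by (simp add: random_process_def random_vector_def)
    show "AE \<omega> in M. v t \<omega> $ p = (v t \<omega> @\<^sub>v w t \<omega>) $ p" for t
      using vwc[of t] by eventually_elim (use p in auto)
  qed
  have lp_w: "linear_process (G (m_r + p)) (\<lambda>t \<omega>. w t \<omega> $ p)" if p: "p < m_u" for p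
  proof (rule linear_process_cong[OF lp])
    show "m_r + p < m_r + m_u" using p by simp
    show "(\<lambda>\<omega>. w t \<omega> $ p) \<in> borel_measurable M" for t
      using asm(28) p by (simp add: random_process_def random_vector_def)
    show "AE \<omega> in M. w t \<omega> $ p = (v t \<omega> @\<^sub>v w t \<omega>) $ (m_r + p)" for t
      using vwc[of t] by eventually_elim (use p in auto)
  qed
  have pi_r: "partially_integrated m_r c_r G (\<lambda>p t \<omega>. zbr t \<omega> $ p)"
    unfolding zbr_def
    by (rule partially_integrated_rotated[OF Hrc(1) asm(19) asm(3) _ lp_v]) (use asm(29) in \<open>simp_all add: Hr_def\<close>)
  have pi_u: "partially_integrated m_u c_u (\<lambda>p. G (m_r + p)) (\<lambda>p t \<omega>. zbu t \<omega> $ p)"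
    unfolding zbu_def
    by (rule partially_integrated_rotated[OF Huc(1) asm(20) asm(4) _ lp_w]) (use asm(30) in \<open>simp_all add: Hu_def\<close>)
  \<comment> \<open>Here the full row rank of \<open>c(1)\<close> enters; every later independence
    of rows is derived from this one by selecting rows or by a change of basis.\<close>
  have ind: "rows_independent (m_r + m_u) (\<lambda>i. total (G i))"
  proof (rule full_row_rank_rows_independent[OF _ asm(36)])
    show "transfer_fun (m_r + m_u) k C 1 \<in> carrier_mat (m_r + m_u) k" by (simp add: transfer_fun_def)
    show "transfer_fun (m_r + m_u) k C 1 $$ (i, l) = total (G i) l" if "i < m_r + m_u" "l < k" for i l
      using that by (simp add: transfer_fun_1 total_def G_def)
  qed
  have ind_r: "rows_independent c_r (\<lambda>p. total (G p))"
    by (rule rows_independent_reindex[OF ind, of "\<lambda>p. p"]) (use asm(19) in \<open>auto simp: inj_on_def\<close>)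
  have zr_eq: "AE \<omega> in M. zr t \<omega> = Hr *\<^sub>v zbr t \<omega>" for t
    by (rule AE_I2) (simp add: zbr_def inverse_pair_cancel_vec[OF Hr zrc])
  have dims: "A *\<^sub>v x \<in> carrier_vec s" if "A \<in> carrier_mat s q" for A :: "real mat" and x q
    using that by (intro carrier_vecI) simp
  have y_eq: "AE \<omega> in M. y t \<omega> - b_u *\<^sub>v zu t \<omega> = b_r *\<^sub>v zr t \<omega> + Lam *\<^sub>v eps t \<omega>" for t
    using asm(7)[THEN spec, of t] asm(13)[THEN spec, of t] AE_space
  proof eventually_elim
    case (elim \<omega>)
    have cancel: "p + q + r - q = p + r" if "p \<in> carrier_vec s" "q \<in> carrier_vec s" "r \<in> carrier_vec s"
      for p q r :: "real vec"
      by (intro eq_vecI) (use that in auto)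
    show ?case unfolding elim(1,2) by (rule cancel[OF dims[OF asm(5)] dims[OF asm(6)] dims[OF asm(10)]])
  qed
  have yp: "random_process M s (\<lambda>t \<omega>. y t \<omega> - b_u *\<^sub>v zu t \<omega>)"
    by (rule random_process_minus[OF asm(2) random_process_mult_mat_vec[OF asm(4) asm(6)]])

  have c_y_le: "c_y \<le> n"
    using mat_rank_mult_le[OF asm(5) asm(21)] asm(8,40) by simp
  have rank_zr: "cointegrating_rank M m_r zr = m_r - c_r"
  proof -
    \<comment> \<open>With the zero noise matrix, \<open>zr\<close> takes the form of
      \<open>cointegrating_rank_partially_integrated\<close>; the relevant columns of
      \<open>Hr\<close> are \<open>Hr_par\<close>.\<close>
    have "AE \<omega> in M. zr t \<omega> = Hr *\<^sub>v zbr t \<omega> + 0\<^sub>m m_r k *\<^sub>v eps t \<omega>" for t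
      using zr_eq[of t] AE_eps_carrier[of t] AE_space
    proof eventually_elim
      case (elim \<omega>)
      have "0\<^sub>m m_r k *\<^sub>v eps t \<omega> = 0\<^sub>v m_r" using elim(2) by (intro eq_vecI) auto
      then show ?case using elim(1) zrc[OF elim(3), of t] by simp
    qed
    from cointegrating_rank_partially_integrated[OF pi_r ind_r zbr asm(3) Hrc(1) zero_carrier_mat asm(21) _ this]
    have "cointegrating_rank M m_r zr = m_r - mat_rank Hr_par"
      using asm(19) by (simp add: Hr_def append_cols_index[OF asm(21,22)])
    then show ?thesis
      by (simp only: orthogonal_columns_rank[OF asm(21,22,19,25)])
  qed
  have rank_y: "cointegrating_rank M s (\<lambda>t \<omega>. y t \<omega> - b_u *\<^sub>v zu t \<omega>) = s - c_y"
  proof -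
    have B: "b_r * Hr \<in> carrier_mat s m_r" by (rule mult_carrier_mat[OF asm(5) Hrc(1)])
    have A: "b_r * Hr_par \<in> carrier_mat s c_r" "b_r * Hr_perp \<in> carrier_mat s (m_r - c_r)"
      by (rule mult_carrier_mat[OF asm(5) asm(21)], rule mult_carrier_mat[OF asm(5) asm(22)])
    \<comment> \<open>Now the matrix is \<open>b_r * Hr\<close>, whose first \<open>c_r\<close>
      columns are \<open>b_r * Hr_par\<close>, and \<open>Lam\<close> is the noise matrix.\<close>
    have "AE \<omega> in M. y t \<omega> - b_u *\<^sub>v zu t \<omega> = (b_r * Hr) *\<^sub>v zbr t \<omega> + Lam *\<^sub>v eps t \<omega>" for t
      using y_eq[of t] zr_eq[of t] AE_space
    proof eventually_elim
      case (elim \<omega>)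
      then show ?case
        using assoc_mult_mat_vec[OF asm(5) Hrc(1) zbrc[OF elim(3), of t]] by simp
    qed
    moreover have "(b_r * Hr_par) $$ (i, p) = (b_r * Hr) $$ (i, p)" if "i < s" "p < c_r" for i p
      unfolding Hr_def mult_append_cols[OF asm(5,21,22)] using append_cols_index[OF A, of i p] that by simp
    ultimately have "cointegrating_rank M s (\<lambda>t \<omega>. y t \<omega> - b_u *\<^sub>v zu t \<omega>) = s - mat_rank (b_r * Hr_par)"
      by (intro cointegrating_rank_partially_integrated[OF pi_r ind_r zbr yp B asm(10) A(1)])
    then show ?thesis using asm(40) by simp
  qed
  obtain T_y T' R R' F b23 where nf: "inverse_pair s T_y T'" "inverse_pair c_r R R'" "c_y \<le> min s c_r"
    "F \<in> carrier_mat c_r (m_r - c_r)" "b23 \<in> carrier_mat (s - c_y) (m_r - c_r)"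
    "T_y * b_r = ((1\<^sub>m c_y @\<^sub>c 0\<^sub>m c_y (c_r - c_y) @\<^sub>c 0\<^sub>m c_y (m_r - c_r)) @\<^sub>r
        (0\<^sub>m (s - c_y) c_y @\<^sub>c 0\<^sub>m (s - c_y) (c_r - c_y) @\<^sub>c b23)) *
       (four_block_mat R F (0\<^sub>m (m_r - c_r) c_r) (1\<^sub>m (m_r - c_r)) * Hr\<^sup>T)"
    using coefficient_normal_form[OF asm(5,19,21,22,25)] unfolding Hr_def asm(40) by metis
  define bt where "bt = (1\<^sub>m c_y @\<^sub>c 0\<^sub>m c_y (c_r - c_y) @\<^sub>c 0\<^sub>m c_y (m_r - c_r)) @\<^sub>r
                  (0\<^sub>m (s - c_y) c_y @\<^sub>c 0\<^sub>m (s - c_y) (c_r - c_y) @\<^sub>c b23)"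
  define B where "B = four_block_mat R F (0\<^sub>m (m_r - c_r) c_r) (1\<^sub>m (m_r - c_r))"
  \<comment> \<open>First the rotation that separates integrated from stationary coordinates, then
    the triangular \<open>B\<close>. Its lower right block is the identity, so the third block
    \<open>z3\<close> consists of the stationary coordinates themselves.\<close>
  define T_zr where "T_zr = B * Hr\<^sup>T"
  define zt z1 z2 z3 where "zt = (\<lambda>t \<omega>. T_zr *\<^sub>v zr t \<omega>)" and "z1 = (\<lambda>t \<omega>. subvec 0 c_y (zt t \<omega>))"
    and "z2 = (\<lambda>t \<omega>. subvec c_y (c_r - c_y) (zt t \<omega>))" and "z3 = (\<lambda>t \<omega>. subvec c_r (m_r - c_r) (zt t \<omega>))"
  \<comment> \<open>For \<open>zu\<close> the rotation alone serves as the transformation, because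
    the term with \<open>b_u\<close> is subtracted from \<open>y\<close> and needs no normal
    form.\<close>
  define zu1 zu2 where "zu1 = (\<lambda>t \<omega>. subvec 0 c_u (zbu t \<omega>))" and "zu2 = (\<lambda>t \<omega>. subvec c_u (m_u - c_u) (zbu t \<omega>))"
  have mr: "c_r + (m_r - c_r) = m_r" "c_y \<le> c_r" "c_y \<le> s" using asm(19) nf(3) by auto
  have Binv: "inverse_pair m_r B (four_block_mat R' (- (R' * F)) (0\<^sub>m (m_r - c_r) c_r) (1\<^sub>m (m_r - c_r)))"
    using inverse_pair_upper_block[OF nf(2,4)] unfolding B_def mr(1) .
  then have Bc: "B \<in> carrier_mat m_r m_r" by (simp add: inverse_pair_def)
  have Tzr: "inverse_pair m_r T_zr (Hr * four_block_mat R' (- (R' * F)) (0\<^sub>m (m_r - c_r) c_r) (1\<^sub>m (m_r - c_r)))"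
    unfolding T_zr_def by (rule inverse_pair_mult[OF Binv Hr])
  then have Tzrc: "T_zr \<in> carrier_mat m_r m_r" by (simp add: inverse_pair_def)
  have Tyc: "T_y \<in> carrier_mat s s" using nf(1) by (simp add: inverse_pair_def)
  have Rc: "R \<in> carrier_mat c_r c_r" using nf(2) by (simp add: inverse_pair_def)
  have Bidx: "B $$ (i, p) = (if i < c_r then if p < c_r then R $$ (i, p) else F $$ (i, p - c_r)
      else if p = i then 1 else 0)" if "i < m_r" "p < m_r" for i p
  proof -
    have "i < dim_row R + dim_row (1\<^sub>m (m_r - c_r))" "p < dim_col R + dim_col (1\<^sub>m (m_r - c_r))"
      using that mr(1) carrier_matD[OF Rc] by simp_all
    from index_mat_four_block(1)[OF this, of F "0\<^sub>m (m_r - c_r) c_r"]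
    show ?thesis unfolding B_def using that carrier_matD[OF Rc] by auto
  qed
  have btc: "bt \<in> carrier_mat s m_r"
  proof -
    have "bt \<in> carrier_mat (c_y + (s - c_y)) (c_y + (c_r - c_y + (m_r - c_r)))"
      unfolding bt_def
      by (intro carrier_append_rows append_cols_carrier one_carrier_mat zero_carrier_mat nf(5))
    moreover have "c_y + (s - c_y) = s" "c_y + (c_r - c_y + (m_r - c_r)) = m_r" using mr by auto
    ultimately show ?thesis by (simp only:)
  qed
  have ztp: "random_process M m_r zt"
    unfolding zt_def by (rule random_process_mult_mat_vec[OF asm(3) Tzrc])
  have zt_eq: "AE \<omega> in M. zt t \<omega> $ i = (\<Sum>p<m_r. B $$ (i, p) * zbr t \<omega> $ p)" if i: "i < m_r" for i t
  proof (rule AE_I2)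
    fix \<omega> assume \<omega>: "\<omega> \<in> space M"
    have "zt t \<omega> = B *\<^sub>v zbr t \<omega>"
      unfolding zt_def T_zr_def zbr_def by (rule assoc_mult_mat_vec[OF Bc Hrc(2) zrc[OF \<omega>]])
    then show "zt t \<omega> $ i = (\<Sum>p<m_r. B $$ (i, p) * zbr t \<omega> $ p)"
      using i Bc zbrc[OF \<omega>, of t] by (simp add: scalar_prod_def lessThan_atLeast0)
  qed
  have z1p: "random_process M c_y z1" and z2p: "random_process M (c_r - c_y) z2"
    and z3p: "random_process M (m_r - c_r) z3"
    unfolding z1_def z2_def z3_def by (rule random_process_subvec[OF ztp]; use mr in simp)+
  have zu1p: "random_process M c_u zu1" and zu2p: "random_process M (m_u - c_u) zu2"
    unfolding zu1_def zu2_def by (rule random_process_subvec[OF zbu]; use asm(20) in simp)+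
  \<comment> \<open>The witnesses are the coefficients of the differenced rows of \<open>B\<close>,
    split at the offset \<open>c_y\<close>. For \<open>zu\<close> the rows of an identity matrix are
    written as indicators, so that the same lemma applies.\<close>
  define C1 where "C1 = (\<lambda>j. mat c_y k (\<lambda>(i, l). \<Sum>p<m_r. B $$ (i, p) * diff_coeff c_r G p j l))"
  define C2 where "C2 = (\<lambda>j. mat (c_r - c_y) k (\<lambda>(i, l). \<Sum>p<m_r. B $$ (c_y + i, p) * diff_coeff c_r G p j l))"
  define Cu where "Cu = (\<lambda>j. mat c_u k (\<lambda>(i, l). \<Sum>p<m_u. (if p = i then 1 else 0) * diff_coeff c_u (\<lambda>p. G (m_r + p)) p j l))"
  have z1_eq: "AE \<omega> in M. z1 t \<omega> $ i = (\<Sum>p<m_r. B $$ (i, p) * zbr t \<omega> $ p)" if "i < c_y" for i t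
    using zt_eq[of i t] that mr by (simp add: z1_def subvec_def)
  have z2_eq: "AE \<omega> in M. z2 t \<omega> $ i = (\<Sum>p<m_r. B $$ (c_y + i, p) * zbr t \<omega> $ p)" if "i < c_r - c_y" for i t
    using zt_eq[of "c_y + i" t] that mr by (simp add: z2_def subvec_def)
  have z3_eq: "AE \<omega> in M. z3 t \<omega> $ i = zbr t \<omega> $ (c_r + i)" if i: "i < m_r - c_r" for i t
  proof -
    have "(\<Sum>p<m_r. B $$ (c_r + i, p) * zbr t \<omega> $ p) = (\<Sum>p<m_r. if p = c_r + i then zbr t \<omega> $ p else 0)" for \<omega>
      using i by (intro sum.cong) (auto simp: Bidx)
    also have "\<dots> \<omega> = zbr t \<omega> $ (c_r + i)" for \<omega> using i by simp
    finally show ?thesis using zt_eq[of "c_r + i" t] i by (simp add: z3_def subvec_def)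
  qed
  have zu1_eq: "AE \<omega> in M. zu1 t \<omega> $ i = (\<Sum>p<m_u. (if p = i then 1 else 0) * zbu t \<omega> $ p)" if i: "i < c_u" for i t
  proof (rule AE_I2)
    fix \<omega>
    have "(\<Sum>p<m_u. (if p = i then 1 else 0) * zbu t \<omega> $ p) = (\<Sum>p<m_u. if p = i then zbu t \<omega> $ p else 0)"
      by (intro sum.cong) auto
    then show "zu1 t \<omega> $ i = (\<Sum>p<m_u. (if p = i then 1 else 0) * zbu t \<omega> $ p)"
      using i asm(20) by (simp add: zu1_def subvec_def)
  qed
  have z1_eq_all: "\<forall>i<c_y. \<forall>t. AE \<omega> in M. z1 t \<omega> $ i = (\<Sum>p<m_r. B $$ (i, p) * zbr t \<omega> $ p)"
    and z2_eq_all: "\<forall>i<c_r - c_y. \<forall>t. AE \<omega> in M. z2 t \<omega> $ i = (\<Sum>p<m_r. B $$ (c_y + i, p) * zbr t \<omega> $ p)"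
    and z3_eq_all: "\<forall>i<m_r - c_r. \<forall>t. AE \<omega> in M. z3 t \<omega> $ i = zbr t \<omega> $ (c_r + i)"
    and zu1_eq_all: "\<forall>i<c_u. \<forall>t. AE \<omega> in M. zu1 t \<omega> $ i = (\<Sum>p<m_u. (if p = i then 1 else 0) * zbu t \<omega> $ p)"
    by (intro allI impI, erule z1_eq, intro allI impI, erule z2_eq, intro allI impI, erule z3_eq,
        intro allI impI, erule zu1_eq)
  note f1 = differenced_combination_filtered[OF pi_r z1p z1_eq_all, folded C1_def]
  note f2 = differenced_combination_filtered[OF pi_r z2p z2_eq_all, folded C2_def]
  note fu = differenced_combination_filtered[OF pi_u zu1p zu1_eq_all, folded Cu_def]
  have full: "full_col_rank ((transfer_fun c_y k C1 1)\<^sup>T @\<^sub>c (transfer_fun (c_r - c_y) k C2 1)\<^sup>T @\<^sub>c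
                           (transfer_fun c_u k Cu 1)\<^sup>T)"
  proof (rule rows_independent_full_col_rank)
    \<comment> \<open>The rows of \<open>c(1)\<close> for the integrated coordinates of
      \<open>zr\<close>, followed by those of \<open>zu\<close>. The shift by
      \<open>m_r - c_r\<close> jumps over the stationary coordinates of \<open>zr\<close>.\<close>
    let ?T = "\<lambda>i. total (G (if i < c_r then i else m_r + (i - c_r)))"
    let ?\<rho> = "\<lambda>i l. if i < c_r then \<Sum>p<c_r. R $$ (i, p) * ?T p l else ?T i l"
    have "rows_independent (c_r + c_u) ?T"
      by (rule rows_independent_reindex[OF ind]) (use asm(19,20) in \<open>auto simp: inj_on_def\<close>)
    from rows_independent_block_transform[OF this nf(2)] show "rows_independent (c_r + c_u) ?\<rho>" .
    have c1: "(transfer_fun c_y k C1 1)\<^sup>T \<in> carrier_mat k c_y"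
      and c2: "(transfer_fun (c_r - c_y) k C2 1)\<^sup>T \<in> carrier_mat k (c_r - c_y)"
      and cu: "(transfer_fun c_u k Cu 1)\<^sup>T \<in> carrier_mat k c_u"
      by (simp_all add: transfer_fun_def)
    have c12: "(transfer_fun (c_r - c_y) k C2 1)\<^sup>T @\<^sub>c (transfer_fun c_u k Cu 1)\<^sup>T \<in> carrier_mat k (c_r - c_y + c_u)"
      by (rule append_cols_carrier[OF c2 cu])
    have n: "c_y + (c_r - c_y + c_u) = c_r + c_u" using mr by simp
    let ?K = "(transfer_fun c_y k C1 1)\<^sup>T @\<^sub>c (transfer_fun (c_r - c_y) k C2 1)\<^sup>T @\<^sub>c (transfer_fun c_u k Cu 1)\<^sup>T"
    show "?K \<in> carrier_mat k (c_r + c_u)"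
      using append_cols_carrier[OF c1 c12] unfolding n .
    fix i l assume il: "i < c_r + c_u" "l < k"
    have "?K $$ (l, i) = (if i < c_y then transfer_fun c_y k C1 1 $$ (i, l)
        else if i - c_y < c_r - c_y then transfer_fun (c_r - c_y) k C2 1 $$ (i - c_y, l)
        else transfer_fun c_u k Cu 1 $$ (i - c_y - (c_r - c_y), l))"
    proof -
      have "?K $$ (l, i) = (if i < c_y then (transfer_fun c_y k C1 1)\<^sup>T $$ (l, i)
         else ((transfer_fun (c_r - c_y) k C2 1)\<^sup>T @\<^sub>c (transfer_fun c_u k Cu 1)\<^sup>T) $$ (l, i - c_y))"
        by (rule append_cols_index[OF c1 c12 il(2)]) (use il n in simp)
      moreover have "((transfer_fun (c_r - c_y) k C2 1)\<^sup>T @\<^sub>c (transfer_fun c_u k Cu 1)\<^sup>T) $$ (l, i - c_y)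
         = (if i - c_y < c_r - c_y then (transfer_fun (c_r - c_y) k C2 1)\<^sup>T $$ (l, i - c_y)
            else (transfer_fun c_u k Cu 1)\<^sup>T $$ (l, i - c_y - (c_r - c_y)))" if "\<not> i < c_y"
        by (rule append_cols_index[OF c2 cu il(2)]) (use il n that in linarith)
      ultimately show ?thesis
        using il mr by (simp add: transfer_fun_def) 
    qed
    also have "\<dots> = ?\<rho> i l"
    proof -
      have BR: "(\<Sum>p<c_r. B $$ (q, p) * total (G p) l) = (\<Sum>p<c_r. R $$ (q, p) * ?T p l)" if "q < c_r" for q
        using that asm(19) by (intro sum.cong) (auto simp: Bidx)
      have U: "(\<Sum>p<c_u. (if p = q then 1 else 0) * total (G (m_r + p)) l) = total (G (m_r + q)) l" if "q < c_u" for q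
      proof -
        have "(\<Sum>p<c_u. (if p = q then 1 else 0) * total (G (m_r + p)) l) =
            (\<Sum>p<c_u. if p = q then total (G (m_r + p)) l else 0)" by (intro sum.cong) auto
        then show ?thesis using that by simp
      qed
      \<comment> \<open>The first two blocks together run through all \<open>c_r\<close> rows of
        \<open>R\<close>, so the split at \<open>c_y\<close> disappears; the third block holds the
        unchanged rows of \<open>zu\<close>.\<close>
      consider "i < c_y" | "\<not> i < c_y" "i < c_r" | "\<not> i < c_r" by blast
      then show ?thesis
      proof cases
        case 1
        then show ?thesis using f1(3)[OF 1 il(2)] BR[of i] mr by simp
      next
        case 2
        then have q: "i - c_y < c_r - c_y" by simp
        then show ?thesis using 2 f2(3)[OF q il(2)] BR[of i] by simp
      next
        case 3
        then have q: "i - c_r < c_u" and e: "i - c_y - (c_r - c_y) = i - c_r" and n: "\<not> i < c_y"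
          "\<not> i - c_y < c_r - c_y" using il mr by auto
        show ?thesis using 3 fu(3)[OF q il(2)] U[OF q] unfolding e by (simp only: n if_False)
      qed
    qed
    finally show "?K $$ (l, i) = ?\<rho> i l" .
  qed
  have st3: "stationary M (m_r - c_r) z3" "nonsingular_spectrum_at M (m_r - c_r) z3 1"
    by (rule stationary_block[OF pi_r z3p z3_eq_all],
        rule rows_independent_reindex[OF ind, of "\<lambda>i. c_r + i"],
        use asm(19) in \<open>auto simp: inj_on_def\<close>)+
  have zu2_eq_all: "\<forall>i<m_u - c_u. \<forall>t. AE \<omega> in M. zu2 t \<omega> $ i = zbu t \<omega> $ (c_u + i)"
    by (simp add: zu2_def subvec_def)
  have stu: "stationary M (m_u - c_u) zu2" "nonsingular_spectrum_at M (m_u - c_u) zu2 1"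
    by (rule stationary_block[OF pi_u zu2p zu2_eq_all],
        rule rows_independent_reindex[OF ind, of "\<lambda>i. m_r + (c_u + i)"],
        use asm(20) in \<open>auto simp: inj_on_def\<close>)+
  have main: "AE \<omega> in M. T_y *\<^sub>v (y t \<omega> - b_u *\<^sub>v zu t \<omega>) = bt *\<^sub>v zt t \<omega> + T_y *\<^sub>v (Lam *\<^sub>v eps t \<omega>)" for t
    using y_eq[of t] AE_space
  proof eventually_elim
    case (elim \<omega>)
    have L: "Lam *\<^sub>v eps t \<omega> \<in> carrier_vec s" "b_r *\<^sub>v zr t \<omega> \<in> carrier_vec s"
      by (rule dims[OF asm(10)], rule dims[OF asm(5)])
    have "T_y *\<^sub>v (y t \<omega> - b_u *\<^sub>v zu t \<omega>) = T_y *\<^sub>v (b_r *\<^sub>v zr t \<omega>) + T_y *\<^sub>v (Lam *\<^sub>v eps t \<omega>)"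
      unfolding elim(1) by (rule mult_add_distrib_mat_vec[OF Tyc L(2,1)])
    also have "T_y *\<^sub>v (b_r *\<^sub>v zr t \<omega>) = (T_y * b_r) *\<^sub>v zr t \<omega>"
      by (rule assoc_mult_mat_vec[OF Tyc asm(5) zrc[OF elim(2)], symmetric])
    also have "T_y * b_r = bt * T_zr" unfolding bt_def T_zr_def B_def by (rule nf(6))
    also have "(bt * T_zr) *\<^sub>v zr t \<omega> = bt *\<^sub>v zt t \<omega>"
      unfolding zt_def by (rule assoc_mult_mat_vec[OF btc Tzrc zrc[OF elim(2)]])
    finally show ?case .
  qed
  have c12u: "\<forall>j. C1 j \<in> carrier_mat c_y k" "\<forall>j. C2 j \<in> carrier_mat (c_r - c_y) k" "\<forall>j. Cu j \<in> carrier_mat c_u k"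
    by (simp_all add: C1_def C2_def Cu_def)
  have sums: "summable (\<lambda>j. mat_norm (C1 j))" "summable (\<lambda>j. mat_norm (C2 j))" "summable (\<lambda>j. mat_norm (Cu j))"
    using f1(2) f2(2) fu(2) by (simp_all only: C1_def C2_def Cu_def)
  show ?thesis
    unfolding Let_def
    by (rule conjI[OF c_y_le conjI[OF rank_zr conjI[OF rank_y]]],
        rule exI[of _ T_y], rule exI[of _ T_zr], rule exI[of _ "Hu\<^sup>T"], rule exI[of _ b23],
        rule exI[of _ C1], rule exI[of _ C2], rule exI[of _ Cu],
        intro conjI allI Tyc Tzrc Huc(2) nf(5) inverse_pair_invertible[OF nf(1)] inverse_pair_invertible[OF Tzr]
        inverse_pair_invertible[OF Hu] c12u[rule_format] sums
        main[unfolded bt_def zt_def] f1(1)[unfolded z1_def zt_def] f2(1)[unfolded z2_def zt_def]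
        fu(1)[unfolded zu1_def zbu_def] full st3[unfolded z3_def zt_def] stu[unfolded zu2_def zbu_def])
qed

end
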